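(* Let $d,N\in\mathbb{N}$ and let $P,P'\subseteq\mathbb{R}^d$ be two $\mathbb{Z}$-solid lattice polytopes with $|P\cap\mathbb{Z}^d|\le N+1$ and $|P'\cap\mathbb{Z}^d|\le N+1$. Then $X(P)\subseteq\mathbb{P}^N$ and $X(P')\subseteq\mathbb{P}^N$ are projectively equivalent if and only if $P$ and $P'$ are affinely equivalent. In particular, in this case $X(P)=X(P')$ for suitable enumerations of $P\cap\mathbb{Z}^d$ and $P'\cap\mathbb{Z}^d$.
   Context: Everything is over $\mathbb{C}$; $\mathbb{P}^N=\mathbb{P}^N(\mathbb{C})$ and $\mathbb{N}$ includes $0$. Two subvarieties $X,X'\subseteq\mathbb{P}^N$ are projectively equivalent if there is $g\in\mathrm{PGL}(N+1)=\mathrm{PGL}(N+1,\mathbb{C})$ with $g(X)=X'$. Construction of $X(S)$: let $S\subseteq\mathbb{Z}^d$ be a non-empty subset with $|S|\le N+1$, and enumerate $S=\{m_0,\ldots,m_r\}$ with the $m_i$ distinct (so $r\le N$). For $t=(t_1,\dots,t_d)\in(\mathbb{C}^* )^d$ and $m=(a_1,\dots,a_d)\in\mathbb{Z}^d$ put $t^m=t_1^{a_1}\cdots t_d^{a_d}$. Let $T\subseteq\mathrm{PGL}(N+1)$ be the image of the homomorphism $(\mathbb{C}^* )^d\to\mathrm{PGL}(N+1)$, $t\mapsto\mathrm{diag}(t^{m_0},\ldots,t^{m_r},1,\ldots,1)$ (with $N-r$ ones), and let $x=[1:\ldots:1:0:\ldots:0]\in\mathbb{P}^N$ (with $r+1$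 ones and $N-r$ zeros). Then $X(S):=\overline{Tx}\subseteq\mathbb{P}^N$. It depends on the enumeration of $S$, but any two enumerations give projectively equivalent subvarieties. A lattice polytope $P\subseteq\mathbb{R}^d$ is the convex hull of a non-empty finite subset of $\mathbb{Z}^d$. Put $S_P:=P\cap\mathbb{Z}^d$ (a finite set with convex hull $P$) and $X(P):=X(S_P)$. A subset $S\subseteq\mathbb{Z}^d$ is affinely generating if $\mathbb{Z}^d$ is generated as a group by the differences $m-m'$ with $m,m'\in S$; the lattice polytope $P$ is $\mathbb{Z}$-solid if $S_P$ is affinely generating. Two lattice polytopes $P,P'\subseteq\mathbb{R}^d$ are affinely equivalent if $P'=\Phi(P)$ for some map $\Phi$ of the form $\Phi(m)=Am+b$ with $A\in\mathrm{GL}(d,\mathbb{Z})$ and $b\in\mathbb{Z}^d$. *)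

theory Defs
  imports
    "Jordan_Normal_Form.Matrix"
    "HOL-Algebra.Coset"
    "HOL-Algebra.Generated_Groups"
    "HOL-Library.Poly_Mapping"
begin

text \<open>
  The dimensions \<open>d\<close> and \<open>N\<close> are natural numbers, possibly \<open>0\<close>, so vectors and matrices are those of
  \<^theory>\<open>Jordan_Normal_Form.Matrix\<close>, with explicit carriers.
\<close>

subsection \<open>Linear and projective linear groups\<close>

definition GL :: "'a::comm_ring_1 itself \<Rightarrow> nat \<Rightarrow> 'a mat monoid" where
  "GL ty n = units_of (ring_mat ty n ())"

definition scalar_matrices :: "nat \<Rightarrow> complex mat set" where
  "scalar_matrices n = {c \<cdot>\<^sub>m 1\<^sub>m n | c. c \<noteq> 0}"

definition PGL :: "nat \<Rightarrow> complex mat set monoid" where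
  "PGL n = GL TYPE(complex) n Mod scalar_matrices n"

definition PGL_class :: "nat \<Rightarrow> complex mat \<Rightarrow> complex mat set" where
  "PGL_class n A = scalar_matrices n #>\<^bsub>GL TYPE(complex) n\<^esub> A"


subsection \<open>Projective space and its Zariski topology\<close>

text \<open>A point of \<open>\<P>\<^sup>N\<close> is the set of all its vectors of homogeneous coordinates, indexed by \<open>0, \<dots>, N\<close>.\<close>

definition proj_point :: "complex vec \<Rightarrow> complex vec set" where
  "proj_point v = {c \<cdot>\<^sub>v v | c. c \<noteq> 0}"

definition proj_space :: "nat \<Rightarrow> complex vec set set" where
  "proj_space N = proj_point ` (carrier_vec (N + 1) - {0\<^sub>v (N + 1)})"

text \<open>
  For a class \<open>g\<close> in \<open>PGL(N + 1)\<close> and a point \<open>p\<close>, all products of representatives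
  together form the point \<open>g p\<close>.
\<close>

definition PGL_act :: "complex mat set \<Rightarrow> complex vec set \<Rightarrow> complex vec set" where
  "PGL_act g p = {A *\<^sub>v v | A v. A \<in> g \<and> v \<in> p}"

text \<open>
  Polynomials in the variables \<open>x\<^sub>0, \<dots>, x\<^sub>N\<close> are finitely supported families of coefficients,
  indexed by the exponent vectors of the monomials.
\<close>

type_synonym mpoly = "(nat \<Rightarrow>\<^sub>0 nat) \<Rightarrow>\<^sub>0 complex"

definition homogeneous_poly :: "nat \<Rightarrow> mpoly \<Rightarrow> bool" where
  "homogeneous_poly N f \<longleftrightarrow>
     (\<exists>k. \<forall>\<alpha>\<in>Poly_Mapping.keys f.
        Poly_Mapping.keys \<alpha> \<subseteq> {..N} \<and> (\<Sum>i\<le>N. Poly_Mapping.lookup \<alpha> i) = k)"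

definition poly_value :: "nat \<Rightarrow> mpoly \<Rightarrow> complex vec \<Rightarrow> complex" where
  "poly_value N f v =
     (\<Sum>\<alpha>\<in>Poly_Mapping.keys f.
        Poly_Mapping.lookup f \<alpha> * (\<Prod>i\<le>N. v $ i ^ Poly_Mapping.lookup \<alpha> i))"

definition zariski_closed :: "nat \<Rightarrow> complex vec set set \<Rightarrow> bool" where
  "zariski_closed N Z \<longleftrightarrow>
     (\<exists>F. (\<forall>f\<in>F. homogeneous_poly N f) \<and>
          Z = {p \<in> proj_space N. \<forall>f\<in>F. \<forall>v\<in>p. poly_value N f v = 0})"

definition zariski_closure :: "nat \<Rightarrow> complex vec set set \<Rightarrow> complex vec set set" where
  "zariski_closure N Z = zariski_closed N hull Z"

definition projectively_equivalent ::
    "nat \<Rightarrow> complex vec set set \<Rightarrow> complex vec set set \<Rightarrow> bool" where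
  "projectively_equivalent N X X' \<longleftrightarrow> (\<exists>g\<in>carrier (PGL (N + 1)). PGL_act g ` X = X')"


subsection \<open>The toric variety of an enumerated set of characters\<close>

definition torus :: "nat \<Rightarrow> complex vec set" where
  "torus d = {t \<in> carrier_vec d. \<forall>i<d. t $ i \<noteq> 0}"

definition character :: "nat \<Rightarrow> int vec \<Rightarrow> complex vec \<Rightarrow> complex" where
  "character d m t = (\<Prod>i<d. t $ i powi m $ i)"

definition enumerates :: "'a list \<Rightarrow> 'a set \<Rightarrow> bool" where
  "enumerates ms S \<longleftrightarrow> distinct ms \<and> set ms = S"

definition torus_image :: "nat \<Rightarrow> nat \<Rightarrow> int vec list \<Rightarrow> complex mat set set" where
  "torus_image d N ms =
     (\<lambda>t. PGL_class (N + 1)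
        (mat_diag (N + 1) (\<lambda>i. if i < length ms then character d (ms ! i) t else 1))) ` torus d"

definition base_point :: "nat \<Rightarrow> int vec list \<Rightarrow> complex vec set" where
  "base_point N ms = proj_point (vec (N + 1) (\<lambda>i. if i < length ms then 1 else 0))"

text \<open>
  The list \<open>ms\<close> is the chosen enumeration of \<open>S\<close>; the definition is only meaningful if
  it is distinct, non-empty and of length at most \<open>N + 1\<close>.
\<close>

definition toric_variety :: "nat \<Rightarrow> nat \<Rightarrow> int vec list \<Rightarrow> complex vec set set" where
  "toric_variety d N ms =
     zariski_closure N ((\<lambda>g. PGL_act g (base_point N ms)) ` torus_image d N ms)"


subsection \<open>Lattice polytopes\<close>

text \<open>
  The type of vectors of unspecified dimension is not a real vector space, so convexity is
  relativised to \<open>carrier_vec d\<close>.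
\<close>

definition convex_vec :: "nat \<Rightarrow> real vec set \<Rightarrow> bool" where
  "convex_vec d C \<longleftrightarrow> C \<subseteq> carrier_vec d \<and>
     (\<forall>x\<in>C. \<forall>y\<in>C. \<forall>u\<ge>0. \<forall>v\<ge>0. u + v = 1 \<longrightarrow> u \<cdot>\<^sub>v x + v \<cdot>\<^sub>v y \<in> C)"

definition real_vec :: "int vec \<Rightarrow> real vec" where
  "real_vec m = map_vec real_of_int m"

definition lattice_polytope :: "nat \<Rightarrow> real vec set \<Rightarrow> bool" where
  "lattice_polytope d P \<longleftrightarrow>
     (\<exists>V. V \<subseteq> carrier_vec d \<and> finite V \<and> V \<noteq> {} \<and> P = convex_vec d hull (real_vec ` V))"

definition lattice_points :: "nat \<Rightarrow> real vec set \<Rightarrow> int vec set" where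
  "lattice_points d P = {m \<in> carrier_vec d. real_vec m \<in> P}"

definition affinely_generating :: "nat \<Rightarrow> int vec set \<Rightarrow> bool" where
  "affinely_generating d S \<longleftrightarrow>
     generate (monoid_vec TYPE(int) d) {m - m' | m m'. m \<in> S \<and> m' \<in> S} = carrier_vec d"

definition Z_solid :: "nat \<Rightarrow> real vec set \<Rightarrow> bool" where
  "Z_solid d P \<longleftrightarrow> affinely_generating d (lattice_points d P)"

definition affinely_equivalent :: "nat \<Rightarrow> real vec set \<Rightarrow> real vec set \<Rightarrow> bool" where
  "affinely_equivalent d P P' \<longleftrightarrow>
     (\<exists>A\<in>carrier (GL TYPE(int) d). \<exists>b\<in>carrier_vec d.
        P' = (\<lambda>x. map_mat real_of_int A *\<^sub>v x + real_vec b) ` P)"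

end

theory Submission
  imports
    Defs
    "HOL-Library.Function_Algebras"
    "HOL-Analysis.Continuum_Not_Denumerable"
    "HOL-Combinatorics.Permutations"
    "Jordan_Normal_Form.Determinant"
begin

text \<open>
  The difficult direction replaces the conjugacy of maximal tori by a direct argument. Restrict a
  projective equivalence to the linear spans of the two varieties; it becomes an invertible matrix
  \<open>Q\<close> between the cones \<open>X\<close> and \<open>X'\<close> in the same space \<open>\<complex>\<^sup>n\<close>, and it conjugates
  the Lie algebra \<open>G\<close> of linear vector fields tangent to \<open>X\<close> into the one, \<open>G'\<close>, of \<open>X'\<close>. Fix a
  rationally independent \<open>\<theta> \<in> \<real>\<^sup>d\<close>; the numbers \<open>\<nu>\<^sub>i = \<langle>m\<^sub>i, \<theta>\<rangle>\<close> are distinct, likewise the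
  \<open>\<mu>\<^sub>i = \<langle>m'\<^sub>i, \<theta>\<rangle>\<close>, so they induce gradings of \<open>\<complex>\<^sup>n\<close>, of \<open>G\<close> and of \<open>G'\<close>. Choose a full flag \<open>F\<close> for
  which \<open>G \<inter> stab F\<close> has maximal dimension. Passing to initial subspaces for \<open>\<nu>\<close> preserves
  dimensions, so \<open>F\<close> may be taken to be a coordinate flag. The initial space for \<open>\<mu>\<close> of
  \<open>Q (G \<inter> stab F) Q\<^sup>-\<^sup>1\<close> lies in the stabilizer in \<open>G'\<close> of the initial flag of \<open>Q F\<close>, hence by maximality
  equals it, and therefore contains \<open>diag \<mu>\<close>. So some \<open>D \<in> G \<inter> stab F\<close> is conjugate to \<open>diag \<mu>\<close> plus
  terms of higher weight: the \<open>\<mu>\<^sub>i\<close> are the diagonal entries of \<open>D\<close> up to a permutation \<open>\<sigma>\<close>. The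
  diagonal part of \<open>D\<close> is in \<open>G\<close>, so the binomial equations of \<open>X\<close> show that every integral affine
  relation between the \<open>m\<^sub>i\<close> holds between the \<open>\<mu>\<^sub>\<sigma>\<^sub>i\<close>, and by the choice of \<open>\<theta>\<close> between the \<open>m'\<^sub>\<sigma>\<^sub>i\<close>.
\<close>

subsection \<open>Pivots and dimensions of spaces of functions\<close>

text \<open>Conjugacy of maximal tori is usually proved through Borel subgroups and a fixed point
  theorem; a flag with a stabilizer of maximal dimension takes over that role. The reason is that an
  initial space is the limit of a subspace under a one-parameter diagonal group, and a limit of
  matrices stabilizing a flag stabilizes the limit of the flag. So the dimension of the stabilizer
  can only grow in the limit, and at a maximum nothing is added. Limits are taken on both sides for
  different purposes: for \<nu>, to have a coordinate flag, where eigenvalues of a stabilizing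
  matrix appear on its diagonal; for \<mu>, because distinct weights make the limit flag a
  coordinate flag, which all diagonal matrices stabilize. What comes out is one real number per
  lattice point. Rational independence of \<theta> turns a relation between these numbers into
  \<open>d\<close> relations between coordinates, and Z-solidity turns the relations into an
  integral matrix with integral inverse. In the other direction, an affine map only reparametrizes
  the torus and rescales its orbit, so the cones are equal.\<close>

definition fscale :: "complex \<Rightarrow> ('a \<Rightarrow> complex) \<Rightarrow> 'a \<Rightarrow> complex" where
  "fscale c f = (\<lambda>x. c * f x)"

interpretation fs: vector_space "fscale :: complex \<Rightarrow> ('a \<Rightarrow> complex) \<Rightarrow> 'a \<Rightarrow> complex"
  by unfold_locales (auto simp: fscale_def fun_eq_iff algebra_simps)

interpretation fsp: vector_space_pair
  "fscale :: complex \<Rightarrow> ('a \<Rightarrow> complex) \<Rightarrow> 'a \<Rightarrow> complex"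
  "fscale :: complex \<Rightarrow> ('b \<Rightarrow> complex) \<Rightarrow> 'b \<Rightarrow> complex"
  by unfold_locales

text \<open>Plays the role of C^K, for \<open>{..<n}\<close> in the case of vectors and
  \<open>sq n\<close> in the case of matrices, so that one theory of dimension and of initial spaces
  covers both.\<close>

definition supp_on :: "'a set \<Rightarrow> ('a \<Rightarrow> complex) set" where
  "supp_on K = {f. \<forall>x. x \<notin> K \<longrightarrow> f x = 0}"

lemma subspace_iff:
  "fs.subspace W \<longleftrightarrow> (\<lambda>_. 0) \<in> W \<and> (\<forall>f\<in>W. \<forall>g\<in>W. (\<lambda>x. f x + g x) \<in> W) \<and>
    (\<forall>c. \<forall>f\<in>W. (\<lambda>x. c * f x) \<in> W)"
  by (simp add: fs.subspace_def fscale_def zero_fun_def plus_fun_def)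

lemma subspace_zero: "fs.subspace W \<Longrightarrow> (\<lambda>_. 0) \<in> W"
  and subspace_add: "fs.subspace W \<Longrightarrow> f \<in> W \<Longrightarrow> g \<in> W \<Longrightarrow> (\<lambda>x. f x + g x) \<in> W"
  and subspace_cmult: "fs.subspace W \<Longrightarrow> f \<in> W \<Longrightarrow> (\<lambda>x. c * f x) \<in> W"
  by (auto simp: subspace_iff)

lemma subspace_axpy:
  assumes "fs.subspace W" "f \<in> W" "g \<in> W"
  shows "(\<lambda>x. f x + c * g x) \<in> W"
  using subspace_add[OF assms(1,2) subspace_cmult[OF assms(1,3), of c]] .

lemma subspace_sum:
  "fs.subspace W \<Longrightarrow> (\<And>i. i \<in> A \<Longrightarrow> F i \<in> W) \<Longrightarrow> (\<lambda>x. \<Sum>i\<in>A. F i x) \<in> W"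
  by (induction A rule: infinite_finite_induct) (auto simp: subspace_iff)

lemma subspace_supp_on: "fs.subspace (supp_on K)"
  by (auto simp: subspace_iff supp_on_def)

definition leads :: "'a set \<Rightarrow> ('a \<Rightarrow> nat) \<Rightarrow> 'a \<Rightarrow> ('a \<Rightarrow> complex) \<Rightarrow> bool" where
  "leads K \<rho> p w \<longleftrightarrow> w p \<noteq> 0 \<and> (\<forall>q\<in>K. \<rho> q < \<rho> p \<longrightarrow> w q = 0)"

text \<open>For \<open>\<rho>\<close> injective on \<open>K\<close> these are the pivot columns of
  an echelon form of \<open>W\<close>, with the coordinates ordered by
  \<open>\<rho>\<close>.\<close>

definition pivots :: "'a set \<Rightarrow> ('a \<Rightarrow> nat) \<Rightarrow> ('a \<Rightarrow> complex) set \<Rightarrow> 'a set" where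
  "pivots K \<rho> W = {p \<in> K. \<exists>w\<in>W. leads K \<rho> p w}"

lemma pivots_subset: "pivots K \<rho> W \<subseteq> K"
  by (auto simp: pivots_def)

lemma pivots_mono: "U \<subseteq> W \<Longrightarrow> pivots K \<rho> U \<subseteq> pivots K \<rho> W"
  by (auto simp: pivots_def)

text \<open>Gaussian elimination: where an element of \<open>W\<close> has its leading coordinate,
  some element of \<open>U\<close> leads as well, and subtracting a multiple of it moves the leading
  position further along \<open>\<rho>\<close>, until nothing is left.\<close>

lemma subset_of_pivots_subset:
  assumes K: "finite K" "inj_on \<rho> K" and U: "fs.subspace U" and W: "fs.subspace W"
    and sub: "U \<subseteq> W" "W \<subseteq> supp_on K" and piv: "pivots K \<rho> W \<subseteq> pivots K \<rho> U"
  shows "W \<subseteq> U"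
proof
  fix w assume "w \<in> W"
  \<comment> \<open>A bound above all ranks: a vector of \<open>W\<close> whose coordinates of rank
    below \<open>M\<close> vanish is zero, which starts the induction on \<open>M - m\<close>. The
    inserted 0 covers an empty \<open>K\<close>.\<close>
  define M where "M = Suc (Max (insert 0 (\<rho> ` K)))"
  have M: "\<rho> q < M" if "q \<in> K" for q
    using K that by (auto simp: M_def less_Suc_eq_le)
  have "w \<in> U" if "w \<in> W" "\<forall>q\<in>K. \<rho> q < m \<longrightarrow> w q = 0" for m w
    using that
  proof (induction "M - m" arbitrary: m w)
    case 0
    have "w = (\<lambda>_. 0)"
    proof
      fix x
      have "\<rho> x < m" if "x \<in> K" using M[OF that] 0(1) by simp
      then show "w x = 0" using 0 sub by (cases "x \<in> K") (auto simp: supp_on_def)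
    qed
    then show ?case using subspace_zero[OF U] by simp
  next
    case (Suc k)
    show ?case
    proof (cases "\<exists>p\<in>K. \<rho> p = m \<and> w p \<noteq> 0")
      case False
      then have "\<forall>q\<in>K. \<rho> q < Suc m \<longrightarrow> w q = 0"
        using Suc.prems by (auto simp: less_Suc_eq)
      moreover have "k = M - Suc m" using Suc by auto
      ultimately show ?thesis using Suc by blast
    next
      case True
      then obtain p where p: "p \<in> K" "\<rho> p = m" "w p \<noteq> 0" by blast
      then have "p \<in> pivots K \<rho> W"
        using Suc.prems by (auto simp: pivots_def leads_def)
      then obtain u where u: "u \<in> U" "u p \<noteq> 0" "\<forall>q\<in>K. \<rho> q < m \<longrightarrow> u q = 0"
        using piv p by (auto simp: pivots_def leads_def)
      define w' where "w' = (\<lambda>x. w x + (- (w p / u p)) * u x)"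
      have "w' \<in> W"
        unfolding w'_def by (rule subspace_axpy[OF W]) (use Suc.prems u sub in auto)
      moreover have "\<forall>q\<in>K. \<rho> q < Suc m \<longrightarrow> w' q = 0"
      proof (intro ballI impI)
        fix q assume q: "q \<in> K" "\<rho> q < Suc m"
        show "w' q = 0"
        proof (cases "\<rho> q = m")
          case True
          then have "q = p" using K p q by (auto dest: inj_onD)
          then show ?thesis using u by (simp add: w'_def)
        next
          case False
          then show ?thesis using q u Suc.prems by (auto simp: w'_def)
        qed
      qed
      moreover have "k = M - Suc m" using Suc by auto
      ultimately have "w' \<in> U" using Suc by blast
      then have "(\<lambda>x. w' x + (w p / u p) * u x) \<in> U"
        by (rule subspace_axpy[OF U]) (use u in auto)
      also have "(\<lambda>x. w' x + (w p / u p) * u x) = w"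
        by (auto simp: w'_def)
      finally show ?thesis .
    qed
  qed
  from this[of w 0] show "w \<in> U" using \<open>w \<in> W\<close> by simp
qed

text \<open>One vector is chosen per pivot. In a vanishing combination, the pivot of least rank with
  a non-zero coefficient sees no other summand, hence independence; the span has all pivots of
  \<open>W\<close>, hence is \<open>W\<close>.\<close>

lemma basis_pivots:
  assumes K: "finite K" "inj_on \<rho> K" and W: "fs.subspace W" "W \<subseteq> supp_on K"
  obtains B where "finite B" "B \<subseteq> W" "fs.independent B" "fs.span B = W"
    "card B = card (pivots K \<rho> W)"
proof -
  let ?P = "pivots K \<rho> W"
  have "\<forall>p\<in>?P. \<exists>w. w \<in> W \<and> leads K \<rho> p w"
    by (auto simp: pivots_def)
  then obtain b where b: "\<And>p. p \<in> ?P \<Longrightarrow> b p \<in> W" "\<And>p. p \<in> ?P \<Longrightarrow> leads K \<rho> p (b p)"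
    by metis
  have PK: "?P \<subseteq> K" by (rule pivots_subset)
  then have fin: "finite ?P" using K finite_subset by blast
  have inj: "inj_on b ?P"
  proof (rule inj_onI)
    fix p q assume pq: "p \<in> ?P" "q \<in> ?P" "b p = b q"
    have "\<not> \<rho> p < \<rho> q" "\<not> \<rho> q < \<rho> p"
      using b(2)[OF pq(1)] b(2)[OF pq(2)] pq PK by (auto simp: leads_def)
    then show "p = q" using K pq PK by (metis inj_onD linorder_neqE_nat subsetD)
  qed
  have ind: "c p = 0" if sum0: "\<forall>x. (\<Sum>p\<in>?P. c p * b p x) = 0" and pP: "p \<in> ?P" for c p
  proof (rule ccontr)
    assume "c p \<noteq> 0"
    then obtain q where q: "q \<in> ?P" "c q \<noteq> 0" "\<And>r. r \<in> ?P \<Longrightarrow> c r \<noteq> 0 \<Longrightarrow> \<rho> q \<le> \<rho> r"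
      using ex_has_least_nat[of "\<lambda>p. p \<in> ?P \<and> c p \<noteq> 0" p \<rho>] pP by blast
    have "(\<Sum>r\<in>?P - {q}. c r * b r q) = 0"
    proof (rule sum.neutral, rule ballI)
      fix r assume r: "r \<in> ?P - {q}"
      then have "\<rho> r \<noteq> \<rho> q" using K q PK by (auto dest: inj_onD)
      then show "c r * b r q = 0"
        using q(3)[of r] b(2)[of r] r q(1) PK by (cases "c r = 0") (auto simp: leads_def)
    qed
    then have "c q * b q q = 0"
      using sum0 sum.remove[OF fin q(1), of "\<lambda>r. c r * b r q"] by simp
    then show False using q b(2)[of q] by (auto simp: leads_def)
  qed
  have indep: "fs.independent (b ` ?P)"
    unfolding fs.independent_explicit_finite_subsets
  proof (intro allI impI ballI)
    fix S u v assume S: "S \<subseteq> b ` ?P" "finite S" and sum: "(\<Sum>v\<in>S. fscale (u v) v) = 0" and v: "v \<in> S"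
    define c where "c p = (if b p \<in> S then u (b p) else 0)" for p
    obtain p where p: "p \<in> ?P" "v = b p" using S v by auto
    have "(\<Sum>p\<in>?P. c p * b p x) = 0" for x
    proof -
      have "(\<Sum>p\<in>?P. c p * b p x) = (\<Sum>w\<in>b ` ?P. (if w \<in> S then u w else 0) * w x)"
        by (simp add: sum.reindex[OF inj] c_def)
      also have "\<dots> = (\<Sum>w\<in>S. u w * w x)"
        by (rule sum.mono_neutral_cong_right) (use S fin in auto)
      also have "\<dots> = (\<Sum>v\<in>S. fscale (u v) v) x"
        by (induction S rule: infinite_finite_induct) (auto simp: fscale_def)
      finally show ?thesis using sum by simp
    qed
    then have "c p = 0" using ind p by blast
    then show "u v = 0" using p v by (simp add: c_def)
  qed
  have sub: "b ` ?P \<subseteq> W" using b by auto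
  have spanW: "fs.span (b ` ?P) \<subseteq> W" using sub W(1) by (rule fs.span_minimal)
  have "W \<subseteq> fs.span (b ` ?P)"
  proof (rule subset_of_pivots_subset[OF K fs.subspace_span W(1) spanW W(2)])
    show "?P \<subseteq> pivots K \<rho> (fs.span (b ` ?P))"
      using b(2) PK by (auto simp: pivots_def[of K \<rho> "fs.span _"] intro: fs.span_base)
  qed
  then show ?thesis
    using that[of "b ` ?P"] fin sub indep spanW card_image[OF inj] by auto
qed

lemma dim_eq_card_pivots:
  assumes "finite K" "inj_on \<rho> K" "fs.subspace W" "W \<subseteq> supp_on K"
  shows "fs.dim W = card (pivots K \<rho> W)"
proof -
  obtain B where "fs.independent B" "fs.span B = W" "card B = card (pivots K \<rho> W)"
    using basis_pivots[OF assms] by blast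
  then show ?thesis using fs.dim_span_eq_card_independent[of B] by (simp del: fs.dim_span)
qed

lemma ex_nat_rank: "finite K \<Longrightarrow> \<exists>\<rho>::'a \<Rightarrow> nat. inj_on \<rho> K"
  by (metis finite_imp_inj_to_nat_seg)

lemma dim_mono:
  assumes "finite K" "fs.subspace U" "fs.subspace W" "U \<subseteq> W" "W \<subseteq> supp_on K"
  shows "fs.dim U \<le> fs.dim W"
proof -
  obtain \<rho> :: "'a \<Rightarrow> nat" where \<rho>: "inj_on \<rho> K" using ex_nat_rank[OF assms(1)] by blast
  have "card (pivots K \<rho> U) \<le> card (pivots K \<rho> W)"
    by (intro card_mono pivots_mono assms finite_subset[OF pivots_subset])
  then show ?thesis
    using dim_eq_card_pivots[OF assms(1) \<rho>] assms by auto
qed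

lemma dim_le_card_supp:
  assumes "finite K" "fs.subspace W" "W \<subseteq> supp_on K"
  shows "fs.dim W \<le> card K"
proof -
  obtain \<rho> :: "'a \<Rightarrow> nat" where \<rho>: "inj_on \<rho> K" using ex_nat_rank[OF assms(1)] by blast
  then show ?thesis
    using dim_eq_card_pivots[OF assms(1) \<rho> assms(2,3)] card_mono[OF assms(1) pivots_subset] by metis
qed

lemma subspace_eq_of_dim:
  assumes "finite K" "fs.subspace U" "fs.subspace W" "U \<subseteq> W" "W \<subseteq> supp_on K" "fs.dim W \<le> fs.dim U"
  shows "W = U"
proof -
  obtain \<rho> :: "'a \<Rightarrow> nat" where \<rho>: "inj_on \<rho> K" using ex_nat_rank[OF assms(1)] by blast
  have "pivots K \<rho> U = pivots K \<rho> W"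
    using dim_eq_card_pivots[OF assms(1) \<rho>] assms pivots_mono[OF assms(4)]
    by (intro card_seteq finite_subset[OF pivots_subset assms(1)]) auto
  then show ?thesis
    using subset_of_pivots_subset[OF assms(1) \<rho> assms(2,3,4,5)] assms(4) by auto
qed

lemma dim_image:
  assumes K: "finite K" and W: "fs.subspace W" "W \<subseteq> supp_on K"
    and lin: "Vector_Spaces.linear fscale fscale T" and inj: "inj_on T W"
  shows "fs.dim (T ` W) = fs.dim W"
proof -
  obtain \<rho> :: "'a \<Rightarrow> nat" where \<rho>: "inj_on \<rho> K" using ex_nat_rank[OF K] by blast
  obtain B where B: "fs.independent B" "fs.span B = W"
    using basis_pivots[OF K \<rho> W] by metis
  have "fs.independent (T ` B)"
    using fsp.linear_independent_injective_image[OF lin B(1)] inj B(2) by simp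
  moreover have "fs.span (T ` B) = T ` W"
    using fsp.linear_span_image[OF lin, of B] B(2) by simp
  moreover have "card (T ` B) = card B"
    using inj B(2) fs.span_superset[of B] by (intro card_image) (auto intro: inj_on_subset)
  ultimately show ?thesis
    using fs.dim_span_eq_card_independent[of "T ` B"] fs.dim_span_eq_card_independent[OF B(1)] B(2)
    by (simp del: fs.dim_span)
qed

lemma linearI_fun:
  assumes "\<And>f g. T (\<lambda>x. f x + g x) = (\<lambda>x. T f x + T g x)" "\<And>c f. T (\<lambda>x. c * f x) = (\<lambda>x. c * T f x)"
  shows "Vector_Spaces.linear fscale fscale T"
  unfolding Vector_Spaces.linear_iff
  by (intro conjI allI fs.vector_space_axioms) (simp_all only: plus_fun_def fscale_def assms)

lemma subspace_linear_image:
  assumes "fs.subspace W" "Vector_Spaces.linear fscale fscale T"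
  shows "fs.subspace (T ` W)"
  using fsp.linear_subspace_image[OF assms(2,1)] .

subsection \<open>Initial subspaces\<close>

text \<open>Ties between equal weights are broken by an arbitrary enumeration, and the rank counts
  predecessors. Such a rank makes the pivots of a space and of its initial space comparable.\<close>

lemma ex_refining_rank:
  fixes wt :: "'a \<Rightarrow> real"
  assumes "finite K"
  shows "\<exists>\<rho>::'a \<Rightarrow> nat. inj_on \<rho> K \<and> (\<forall>x\<in>K. \<forall>y\<in>K. wt x < wt y \<longrightarrow> \<rho> x < \<rho> y)"
proof -
  obtain e :: "'a \<Rightarrow> nat" where e: "inj_on e K" using ex_nat_rank[OF assms] by blast
  define lt where "lt x y \<longleftrightarrow> wt x < wt y \<or> wt x = wt y \<and> e x < e y" for x y
  define \<rho> where "\<rho> x = card {y \<in> K. lt y x}" for x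
  have mono: "\<rho> x < \<rho> y" if "x \<in> K" "lt x y" for x y
    unfolding \<rho>_def
  proof (rule psubset_card_mono)
    have "x \<in> {z \<in> K. lt z y}" "x \<notin> {z \<in> K. lt z x}"
      using that by (auto simp: lt_def)
    moreover have "{z \<in> K. lt z x} \<subseteq> {z \<in> K. lt z y}"
      using that by (auto simp: lt_def)
    ultimately show "{z \<in> K. lt z x} \<subset> {z \<in> K. lt z y}" by blast
  qed (use assms in simp)
  have "inj_on \<rho> K"
  proof (rule inj_onI, rule ccontr)
    fix x y assume xy: "x \<in> K" "y \<in> K" "\<rho> x = \<rho> y" "x \<noteq> y"
    then have "e x \<noteq> e y" using e by (auto dest: inj_onD)
    then have "lt x y \<or> lt y x" by (auto simp: lt_def)
    then show False using mono xy by fastforce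
  qed
  then show ?thesis using mono by (auto simp: lt_def)
qed

text \<open>For a subspace \<open>W\<close> of \<open>supp_on K\<close> with finite
  \<open>K\<close>, this is the span of the lowest weight components of elements of
  \<open>W\<close>, or the limit of exp(-s wt) W as s tends to infinity. Where \<open>u\<close> has
  no component of weight \<open>k\<close>, the zero vector is a witness.\<close>

definition init_space :: "'a set \<Rightarrow> ('a \<Rightarrow> real) \<Rightarrow> ('a \<Rightarrow> complex) set \<Rightarrow> ('a \<Rightarrow> complex) set" where
  "init_space K wt W = {u \<in> supp_on K. \<forall>k. \<exists>w\<in>W. (\<forall>x\<in>K. wt x < k \<longrightarrow> w x = 0) \<and>
     (\<forall>x\<in>K. wt x = k \<longrightarrow> w x = u x)}"

lemma init_space_subset: "init_space K wt W \<subseteq> supp_on K"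
  by (auto simp: init_space_def)

lemma init_space_mono: "U \<subseteq> W \<Longrightarrow> init_space K wt U \<subseteq> init_space K wt W"
  unfolding init_space_def by blast

lemma subspace_init_space:
  assumes "fs.subspace W"
  shows "fs.subspace (init_space K wt W)"
  unfolding subspace_iff
proof (intro conjI ballI allI)
  show "(\<lambda>_. 0) \<in> init_space K wt W"
    using subspace_zero[OF assms] by (auto simp: init_space_def supp_on_def intro!: bexI[of _ "\<lambda>_. 0"])
next
  fix f g assume fg: "f \<in> init_space K wt W" "g \<in> init_space K wt W"
  show "(\<lambda>x. f x + g x) \<in> init_space K wt W"
    unfolding init_space_def
  proof (intro CollectI conjI allI)
    show "(\<lambda>x. f x + g x) \<in> supp_on K"
      using fg by (auto simp: init_space_def supp_on_def)
    fix k
    obtain v where v: "v \<in> W" "\<forall>x\<in>K. wt x < k \<longrightarrow> v x = 0" "\<forall>x\<in>K. wt x = k \<longrightarrow> v x = f x"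
      using fg(1) unfolding init_space_def by blast
    obtain w where w: "w \<in> W" "\<forall>x\<in>K. wt x < k \<longrightarrow> w x = 0" "\<forall>x\<in>K. wt x = k \<longrightarrow> w x = g x"
      using fg(2) unfolding init_space_def by blast
    show "\<exists>w\<in>W. (\<forall>x\<in>K. wt x < k \<longrightarrow> w x = 0) \<and> (\<forall>x\<in>K. wt x = k \<longrightarrow> w x = f x + g x)"
      by (rule bexI[OF _ subspace_add[OF assms v(1) w(1)]]) (use v w in auto)
  qed
next
  fix c f assume f: "f \<in> init_space K wt W"
  show "(\<lambda>x. c * f x) \<in> init_space K wt W"
    unfolding init_space_def
  proof (intro CollectI conjI allI)
    show "(\<lambda>x. c * f x) \<in> supp_on K"
      using f by (auto simp: init_space_def supp_on_def)
    fix k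
    obtain v where v: "v \<in> W" "\<forall>x\<in>K. wt x < k \<longrightarrow> v x = 0" "\<forall>x\<in>K. wt x = k \<longrightarrow> v x = f x"
      using f unfolding init_space_def by blast
    show "\<exists>w\<in>W. (\<forall>x\<in>K. wt x < k \<longrightarrow> w x = 0) \<and> (\<forall>x\<in>K. wt x = k \<longrightarrow> w x = c * f x)"
      by (rule bexI[OF _ subspace_cmult[OF assms v(1), of c]]) (use v in auto)
  qed
qed

text \<open>As \<open>\<rho>\<close> refines \<open>wt\<close>, the leading coordinate of a vector
  lies in its lowest weight component, and cutting the vector down to that component keeps the
  pivot.\<close>

lemma pivots_init_space:
  assumes ref: "\<forall>x\<in>K. \<forall>y\<in>K. wt x < wt y \<longrightarrow> \<rho> x < \<rho> y" and W: "fs.subspace W"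
  shows "pivots K \<rho> (init_space K wt W) = pivots K \<rho> W"
proof (intro subset_antisym subsetI)
  fix p assume "p \<in> pivots K \<rho> (init_space K wt W)"
  then obtain u where p: "p \<in> K" and u: "u \<in> init_space K wt W" "u p \<noteq> 0" "\<forall>q\<in>K. \<rho> q < \<rho> p \<longrightarrow> u q = 0"
    by (auto simp: pivots_def leads_def)
  obtain w where w: "w \<in> W" "\<forall>x\<in>K. wt x < wt p \<longrightarrow> w x = 0" "\<forall>x\<in>K. wt x = wt p \<longrightarrow> w x = u x"
    using u(1) unfolding init_space_def by blast
  have "w q = 0" if "q \<in> K" "\<rho> q < \<rho> p" for q
  proof -
    have "\<not> wt p < wt q" using ref p that by fastforce
    then show ?thesis using w u(3) that by (cases "wt q = wt p") auto
  qed
  then have "leads K \<rho> p w" using w p u(2) by (auto simp: leads_def)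
  then show "p \<in> pivots K \<rho> W" using p w(1) by (auto simp: pivots_def)
next
  fix p assume "p \<in> pivots K \<rho> W"
  then obtain w where p: "p \<in> K" and w: "w \<in> W" "w p \<noteq> 0" "\<forall>q\<in>K. \<rho> q < \<rho> p \<longrightarrow> w q = 0"
    by (auto simp: pivots_def leads_def)
  define u where "u = (\<lambda>x. if x \<in> K \<and> wt x = wt p then w x else 0)"
  have "u \<in> init_space K wt W"
    unfolding init_space_def
  proof (intro CollectI conjI allI)
    show "u \<in> supp_on K" by (auto simp: u_def supp_on_def)
    fix k
    show "\<exists>w\<in>W. (\<forall>x\<in>K. wt x < k \<longrightarrow> w x = 0) \<and> (\<forall>x\<in>K. wt x = k \<longrightarrow> w x = u x)"
    proof (cases "k = wt p")
      case True
      then show ?thesis using w p ref by (intro bexI[OF _ w(1)]) (auto simp: u_def)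
    next
      case False
      then show ?thesis by (intro bexI[OF _ subspace_zero[OF W]]) (auto simp: u_def)
    qed
  qed
  moreover have "leads K \<rho> p u" using w p by (auto simp: leads_def u_def)
  ultimately show "p \<in> pivots K \<rho> (init_space K wt W)" using p by (auto simp: pivots_def)
qed

lemma dim_init_space:
  assumes "finite K" "fs.subspace W" "W \<subseteq> supp_on K"
  shows "fs.dim (init_space K wt W) = fs.dim W"
proof -
  obtain \<rho> :: "'a \<Rightarrow> nat" where \<rho>: "inj_on \<rho> K" "\<forall>x\<in>K. \<forall>y\<in>K. wt x < wt y \<longrightarrow> \<rho> x < \<rho> y"
    using ex_refining_rank[OF assms(1), of wt] by blast
  show ?thesis
    using dim_eq_card_pivots[OF assms(1) \<rho>(1) assms(2,3)]
      dim_eq_card_pivots[OF assms(1) \<rho>(1) subspace_init_space[OF assms(2)] init_space_subset]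
      pivots_init_space[OF \<rho>(2) assms(2)] by metis
qed

text \<open>Distinct weights make every weight space a coordinate line. This turns an initial flag
  into a flag of coordinate subspaces.\<close>

lemma init_space_proj:
  assumes "inj_on wt K" "fs.subspace W" "v \<in> init_space K wt W"
  shows "(\<lambda>x. if x = j then v x else 0) \<in> init_space K wt W"
  unfolding init_space_def
proof (intro CollectI conjI allI)
  show "(\<lambda>x. if x = j then v x else 0) \<in> supp_on K"
    using assms(3) by (auto simp: init_space_def supp_on_def)
  fix k
  show "\<exists>w\<in>W. (\<forall>x\<in>K. wt x < k \<longrightarrow> w x = 0) \<and> (\<forall>x\<in>K. wt x = k \<longrightarrow> w x = (if x = j then v x else 0))"
  proof (cases "j \<in> K \<and> k = wt j")
    case True
    obtain w where w: "w \<in> W" "\<forall>x\<in>K. wt x < k \<longrightarrow> w x = 0" "\<forall>x\<in>K. wt x = k \<longrightarrow> w x = v x"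
      using assms(3) unfolding init_space_def by blast
    show ?thesis
      by (rule bexI[OF _ w(1)]) (use w True assms(1) in \<open>auto dest: inj_onD\<close>)
  next
    case False
    then show ?thesis using assms(3)
      by (intro bexI[OF _ subspace_zero[OF assms(2)]]) auto
  qed
qed

text \<open>Interpolation: the projection to a weight space is a polynomial in the diagonal operator
  with the pairwise distinct eigenvalues \<open>exp (wt x)\<close>.\<close>

lemma weight_component_mem:
  fixes wt :: "'a \<Rightarrow> real"
  assumes K: "finite K" and W: "fs.subspace W" "W \<subseteq> supp_on K"
    and stable: "\<And>f. f \<in> W \<Longrightarrow> (\<lambda>x. of_real (exp (wt x)) * f x) \<in> W" and f: "f \<in> W"
  shows "(\<lambda>x. if wt x = k then f x else 0) \<in> W"
proof -
  let ?e = "\<lambda>a. complex_of_real (exp a)"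
  have prod: "(\<lambda>x. (\<Prod>a\<in>A. ?e (wt x) - ?e a) * f x) \<in> W" if "finite A" for A :: "real set"
    using that
  proof (induction A rule: finite_induct)
    case empty
    then show ?case using f by simp
  next
    case (insert a A)
    let ?g = "\<lambda>x. (\<Prod>a\<in>A. ?e (wt x) - ?e a) * f x"
    have "(\<lambda>x. ?e (wt x) * ?g x + (- ?e a) * ?g x) \<in> W"
      by (rule subspace_axpy[OF W(1) stable[OF insert.IH] insert.IH])
    also have "(\<lambda>x. ?e (wt x) * ?g x + (- ?e a) * ?g x) =
        (\<lambda>x. (\<Prod>a\<in>insert a A. ?e (wt x) - ?e a) * f x)"
      using insert.hyps by (auto simp: algebra_simps)
    finally show ?case .
  qed
  define A where "A = wt ` K - {k}"
  define c where "c = (\<Prod>a\<in>A. ?e k - ?e a)"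
  have A: "finite A" using K by (simp add: A_def)
  have c: "c \<noteq> 0" using A by (auto simp: c_def A_def)
  have "(\<lambda>x. (1 / c) * ((\<Prod>a\<in>A. ?e (wt x) - ?e a) * f x)) \<in> W"
    by (rule subspace_cmult[OF W(1) prod[OF A]])
  also have "(\<lambda>x. (1 / c) * ((\<Prod>a\<in>A. ?e (wt x) - ?e a) * f x)) = (\<lambda>x. if wt x = k then f x else 0)"
  proof
    fix x
    show "(1 / c) * ((\<Prod>a\<in>A. ?e (wt x) - ?e a) * f x) = (if wt x = k then f x else 0)"
    proof (cases "x \<in> K")
      case False
      then show ?thesis using f W(2) by (auto simp: supp_on_def)
    next
      case True
      show ?thesis
      proof (cases "wt x = k")
        case True
        then show ?thesis using c by (simp add: c_def)
      next
        case False
        then have "(\<Prod>a\<in>A. ?e (wt x) - ?e a) = 0"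
          using A True by (intro prod_zero bexI[of _ "wt x"]) (auto simp: A_def)
        then show ?thesis using False by simp
      qed
    qed
  qed
  finally show ?thesis .
qed

text \<open>Stability under the diagonal operator makes \<open>G\<close> graded. Each weight
  component of \<open>u\<close> is also a component of an element of \<open>W\<close>, so it lies in
  \<open>G\<close>, and so does their sum.\<close>

lemma init_space_subset_graded:
  fixes wt :: "'a \<Rightarrow> real"
  assumes K: "finite K" and G: "fs.subspace G" "G \<subseteq> supp_on K"
    and stable: "\<And>f. f \<in> G \<Longrightarrow> (\<lambda>x. of_real (exp (wt x)) * f x) \<in> G" and W: "W \<subseteq> G"
  shows "init_space K wt W \<subseteq> G"
proof
  fix u assume u: "u \<in> init_space K wt W"
  have comp: "(\<lambda>x. if wt x = k then u x else 0) \<in> G" for k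
  proof -
    obtain w where w: "w \<in> W" "\<forall>x\<in>K. wt x = k \<longrightarrow> w x = u x"
      using u unfolding init_space_def by blast
    then have "(\<lambda>x. if wt x = k then w x else 0) \<in> G"
      using weight_component_mem[OF K G stable] W by blast
    also have "(\<lambda>x. if wt x = k then w x else 0) = (\<lambda>x. if wt x = k then u x else 0)"
    proof
      fix x show "(if wt x = k then w x else 0) = (if wt x = k then u x else 0)"
        using w u W G by (cases "x \<in> K") (auto simp: supp_on_def init_space_def)
    qed
    finally show ?thesis .
  qed
  have "(\<lambda>x. \<Sum>k\<in>wt ` K. if wt x = k then u x else 0) \<in> G"
    by (rule subspace_sum[OF G(1)]) (rule comp)
  also have "(\<lambda>x. \<Sum>k\<in>wt ` K. if wt x = k then u x else 0) = u"
    using K u by (auto simp: fun_eq_iff init_space_def supp_on_def)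
  finally show "u \<in> G" .
qed

lemma dim_supp_on:
  assumes "finite J"
  shows "fs.dim (supp_on J) = card J"
proof -
  obtain \<rho> :: "'a \<Rightarrow> nat" where \<rho>: "inj_on \<rho> J" using ex_nat_rank[OF assms] by blast
  have "pivots J \<rho> (supp_on J) = J"
    by (auto simp: pivots_def leads_def supp_on_def intro!: exI[of _ "\<lambda>x. if x = _ then 1 else 0"])
  then show ?thesis
    using dim_eq_card_pivots[OF assms \<rho> subspace_supp_on order_refl] by simp
qed

subsection \<open>Matrices and flags\<close>

definition app :: "nat \<Rightarrow> (nat \<times> nat \<Rightarrow> complex) \<Rightarrow> (nat \<Rightarrow> complex) \<Rightarrow> nat \<Rightarrow> complex" where
  "app n D v = (\<lambda>i. \<Sum>j<n. D (i, j) * v j)"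

definition mm :: "nat \<Rightarrow> (nat \<times> nat \<Rightarrow> complex) \<Rightarrow> (nat \<times> nat \<Rightarrow> complex) \<Rightarrow> nat \<times> nat \<Rightarrow> complex" where
  "mm n A B = (\<lambda>(i, k). \<Sum>j<n. A (i, j) * B (j, k))"

abbreviation sq :: "nat \<Rightarrow> (nat \<times> nat) set" where
  "sq n \<equiv> {..<n} \<times> {..<n}"

definition idm :: "nat \<Rightarrow> nat \<times> nat \<Rightarrow> complex" where
  "idm n = (\<lambda>(i, j). if i = j \<and> i < n then 1 else 0)"

lemma app_mm: "app n (mm n A B) v = app n A (app n B v)"
proof
  fix i
  have "app n (mm n A B) v i = (\<Sum>k<n. \<Sum>j<n. A (i, j) * B (j, k) * v k)"
    by (simp add: app_def mm_def sum_distrib_right)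
  also have "\<dots> = (\<Sum>j<n. \<Sum>k<n. A (i, j) * B (j, k) * v k)"
    by (rule sum.swap)
  also have "\<dots> = app n A (app n B v) i"
    by (simp add: app_def sum_distrib_left mult.assoc)
  finally show "app n (mm n A B) v i = app n A (app n B v) i" .
qed

lemma mm_assoc: "mm n (mm n A B) C = mm n A (mm n B C)"
proof
  fix x :: "nat \<times> nat"
  obtain i l where x: "x = (i, l)" by force
  have "mm n (mm n A B) C x = (\<Sum>k<n. \<Sum>j<n. A (i, j) * B (j, k) * C (k, l))"
    by (simp add: mm_def x sum_distrib_right)
  also have "\<dots> = (\<Sum>j<n. \<Sum>k<n. A (i, j) * B (j, k) * C (k, l))"
    by (rule sum.swap)
  also have "\<dots> = mm n A (mm n B C) x"
    by (simp add: mm_def x sum_distrib_left mult.assoc)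
  finally show "mm n (mm n A B) C x = mm n A (mm n B C) x" .
qed

lemma mm_idm_right:
  assumes "D \<in> supp_on (sq n)"
  shows "mm n D (idm n) = D"
proof (rule ext, clarify)
  fix a b
  show "mm n D (idm n) (a, b) = D (a, b)"
    using assms
    by (cases "b < n") (auto simp: mm_def idm_def supp_on_def if_distrib if_distribR cong: if_cong)
qed

lemma mm_idm_left:
  assumes "D \<in> supp_on (sq n)"
  shows "mm n (idm n) D = D"
proof (rule ext, clarify)
  fix a b
  show "mm n (idm n) D (a, b) = D (a, b)"
    using assms
    by (cases "a < n") (auto simp: mm_def idm_def supp_on_def if_distrib if_distribR cong: if_cong)
qed

lemma app_idm:
  assumes "v \<in> supp_on {..<n}"
  shows "app n (idm n) v = v"
proof
  fix a
  show "app n (idm n) v a = v a"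
    using assms
    by (cases "a < n") (auto simp: app_def idm_def supp_on_def if_distrib if_distribR cong: if_cong)
qed

lemma mm_supp: "A \<in> supp_on (sq n) \<Longrightarrow> B \<in> supp_on (sq n) \<Longrightarrow> mm n A B \<in> supp_on (sq n)"
  by (auto simp: mm_def supp_on_def)

lemma app_supp: "A \<in> supp_on (sq n) \<Longrightarrow> app n A v \<in> supp_on {..<n}"
  by (auto simp: app_def supp_on_def)

lemma app_add: "app n D (\<lambda>x. f x + g x) = (\<lambda>x. app n D f x + app n D g x)"
  and app_cmult: "app n D (\<lambda>x. c * f x) = (\<lambda>x. c * app n D f x)"
  and app_add_left: "app n (\<lambda>x. A x + B x) v = (\<lambda>x. app n A v x + app n B v x)"
  and app_cmult_left: "app n (\<lambda>x. c * A x) v = (\<lambda>x. c * app n A v x)"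
  by (auto simp: app_def fun_eq_iff algebra_simps sum.distrib sum_distrib_left)

lemma linear_app: "Vector_Spaces.linear fscale fscale (app n D)"
  by (rule linearI_fun) (simp_all add: app_add app_cmult)

definition conj_by :: "nat \<Rightarrow> (nat \<times> nat \<Rightarrow> complex) \<Rightarrow> (nat \<times> nat \<Rightarrow> complex) \<Rightarrow>
    (nat \<times> nat \<Rightarrow> complex) \<Rightarrow> nat \<times> nat \<Rightarrow> complex" where
  "conj_by n Q R D = mm n Q (mm n D R)"

lemma linear_conj_by: "Vector_Spaces.linear fscale fscale (conj_by n Q R)"
  by (rule linearI_fun)
    (auto simp: conj_by_def mm_def fun_eq_iff algebra_simps sum.distrib sum_distrib_left)

lemma conj_by_supp:
  "Q \<in> supp_on (sq n) \<Longrightarrow> R \<in> supp_on (sq n) \<Longrightarrow> D \<in> supp_on (sq n) \<Longrightarrow> conj_by n Q R D \<in> supp_on (sq n)"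
  by (simp add: conj_by_def mm_supp)

lemma conj_by_inverse:
  assumes "mm n R Q = idm n" "D \<in> supp_on (sq n)"
  shows "conj_by n R Q (conj_by n Q R D) = D"
proof -
  have "conj_by n R Q (conj_by n Q R D) = mm n (mm n R Q) (mm n D (mm n R Q))"
    by (simp add: conj_by_def mm_assoc)
  then show ?thesis using assms by (simp add: mm_idm_left mm_idm_right)
qed

section \<open>Full flags, their stabilizers and their initial flags\<close>

definition is_flag :: "nat \<Rightarrow> (nat \<Rightarrow> (nat \<Rightarrow> complex) set) \<Rightarrow> bool" where
  "is_flag n F \<longleftrightarrow> (\<forall>i\<le>n. fs.subspace (F i) \<and> F i \<subseteq> supp_on {..<n} \<and> fs.dim (F i) = i) \<and>
     (\<forall>i<n. F i \<subseteq> F (Suc i))"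

definition stab :: "nat \<Rightarrow> (nat \<Rightarrow> (nat \<Rightarrow> complex) set) \<Rightarrow> (nat \<times> nat \<Rightarrow> complex) set" where
  "stab n F = {D. \<forall>i\<le>n. \<forall>v\<in>F i. app n D v \<in> F i}"

lemma subspace_stab:
  assumes "is_flag n F"
  shows "fs.subspace (stab n F)"
proof -
  have F: "fs.subspace (F i)" if "i \<le> n" for i using assms that by (simp add: is_flag_def)
  have zero: "app n (\<lambda>_. 0) v = (\<lambda>_. 0)" for v by (simp add: app_def)
  show ?thesis
    unfolding subspace_iff
    by (auto simp: stab_def app_add_left app_cmult_left zero
        intro: subspace_add[OF F] subspace_cmult[OF F] subspace_zero[OF F])
qed

lemma is_flag_init:
  assumes "is_flag n F"
  shows "is_flag n (\<lambda>i. init_space {..<n} wt (F i))"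
  using assms unfolding is_flag_def
  by (auto simp: subspace_init_space dim_init_space init_space_mono init_space_subset
      dest: subsetD[OF init_space_subset] subsetD[OF init_space_mono, rotated])

text \<open>The entry (i, j) moves weight \<open>\<mu> j\<close> to weight \<open>\<mu> i\<close>,
  and lowest terms multiply to lowest terms. The coordinates of \<open>v\<close> have different
  weights and may come from different elements of \<open>F i\<close>, so one product of
  \<open>D j\<close> and \<open>w j\<close> is formed per coordinate \<open>j\<close> and all are
  added up.\<close>

lemma init_space_stab:
  assumes \<mu>: "inj_on \<mu> {..<n}" and F: "is_flag n F"
    and W: "W \<subseteq> stab n F"
  shows "init_space (sq n) (\<lambda>(i, j). \<mu> i - \<mu> j) W \<subseteq> stab n (\<lambda>i. init_space {..<n} \<mu> (F i))"
proof
  fix u assume u: "u \<in> init_space (sq n) (\<lambda>(i, j). \<mu> i - \<mu> j) W"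
  then have usupp: "u \<in> supp_on (sq n)" by (simp add: init_space_def)
  show "u \<in> stab n (\<lambda>i. init_space {..<n} \<mu> (F i))"
    unfolding stab_def
  proof (intro CollectI allI impI ballI)
    fix i v assume i: "i \<le> n" and v: "v \<in> init_space {..<n} \<mu> (F i)"
    have Fi: "fs.subspace (F i)" using F i by (auto simp: is_flag_def)
    show "app n u v \<in> init_space {..<n} \<mu> (F i)"
      unfolding init_space_def
    proof (intro CollectI conjI allI)
      show "app n u v \<in> supp_on {..<n}" using app_supp[OF usupp] .
      fix l
      \<comment> \<open>A matrix agreeing with \<open>u\<close> at exactly the weight that carries
        coordinate \<open>j\<close> to weight \<open>l\<close>, and vanishing at lower
        weights.\<close>
      have "\<exists>D. D \<in> W \<and> (\<forall>x<n. \<forall>q<n. \<mu> x - \<mu> q < l - \<mu> j \<longrightarrow> D (x, q) = 0) \<and>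
          (\<forall>x<n. \<forall>q<n. \<mu> x - \<mu> q = l - \<mu> j \<longrightarrow> D (x, q) = u (x, q))" for j
      proof -
        obtain D where "D \<in> W" "\<forall>x\<in>sq n. (\<lambda>(i, j). \<mu> i - \<mu> j) x < l - \<mu> j \<longrightarrow> D x = 0"
          "\<forall>x\<in>sq n. (\<lambda>(i, j). \<mu> i - \<mu> j) x = l - \<mu> j \<longrightarrow> D x = u x"
          using u unfolding init_space_def by blast
        then show ?thesis by (intro exI[of _ D]) auto
      qed
      then obtain D where DW: "\<And>j. D j \<in> W"
        and D0: "\<And>j x q. x < n \<Longrightarrow> q < n \<Longrightarrow> \<mu> x - \<mu> q < l - \<mu> j \<Longrightarrow> D j (x, q) = 0"
        and D1: "\<And>j x q. x < n \<Longrightarrow> q < n \<Longrightarrow> \<mu> x - \<mu> q = l - \<mu> j \<Longrightarrow> D j (x, q) = u (x, q)"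
        by metis
      have "\<exists>w. w \<in> F i \<and> (\<forall>x<n. \<mu> x < \<mu> j \<longrightarrow> w x = 0) \<and> (\<forall>x<n. \<mu> x = \<mu> j \<longrightarrow> w x = v x)" for j
      proof -
        obtain w where "w \<in> F i" "\<forall>x\<in>{..<n}. \<mu> x < \<mu> j \<longrightarrow> w x = 0"
          "\<forall>x\<in>{..<n}. \<mu> x = \<mu> j \<longrightarrow> w x = v x"
          using v unfolding init_space_def by blast
        then show ?thesis by (intro exI[of _ w]) auto
      qed
      then obtain w where wF: "\<And>j. w j \<in> F i"
        and w0: "\<And>j x. x < n \<Longrightarrow> \<mu> x < \<mu> j \<Longrightarrow> w j x = 0"
        and w1: "\<And>j x. x < n \<Longrightarrow> \<mu> x = \<mu> j \<Longrightarrow> w j x = v x"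
        by metis
      define y where "y = (\<lambda>x. \<Sum>j<n. app n (D j) (w j) x)"
      have "y \<in> F i"
        unfolding y_def
      proof (rule subspace_sum[OF Fi])
        fix j
        have "D j \<in> stab n F" using DW W by blast
        then show "app n (D j) (w j) \<in> F i" using wF i by (simp add: stab_def)
      qed
      moreover have "y x = 0" if "x < n" "\<mu> x < l" for x
      proof -
        \<comment> \<open>Either \<open>\<mu> q < \<mu> j\<close> and the entry of
          \<open>w j\<close> vanishes, or \<open>\<mu> x - \<mu> q < l - \<mu> j\<close> and the
          entry of \<open>D j\<close> does.\<close>
        have z: "D j (x, q) * w j q = 0" if "q < n" for j q
          using D0[of x q j] w0[of q j] that \<open>x < n\<close> \<open>\<mu> x < l\<close> by (cases "\<mu> q < \<mu> j") auto
        then show ?thesis unfolding y_def app_def by (intro sum.neutral ballI z) simp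
      qed
      moreover have "y x = app n u v x" if x: "x < n" "\<mu> x = l" for x
      proof -
        \<comment> \<open>At weight \<open>l\<close> only the term with \<open>q = j\<close>
          survives, by injectivity of \<open>\<mu>\<close>; there the factors are those of
          \<open>u\<close> and \<open>v\<close>.\<close>
        have "app n (D j) (w j) x = u (x, j) * v j" if j: "j < n" for j
        proof -
          have "D j (x, q) * w j q = 0" if "q < n" "q \<noteq> j" for q
          proof -
            have "\<mu> q \<noteq> \<mu> j" using \<mu> that j by (auto dest: inj_onD)
            then show ?thesis
              using D0[of x q j] w0[of q j] that x by (cases "\<mu> q < \<mu> j") auto
          qed
          then have "(\<Sum>q\<in>{..<n} - {j}. D j (x, q) * w j q) = 0"
            by (intro sum.neutral) auto
          then show ?thesis
            using j D1[of x j j] w1[of j j] x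
            by (simp add: app_def sum.remove[of "{..<n}" j])
        qed
        then show ?thesis by (simp add: y_def app_def)
      qed
      ultimately show "\<exists>y\<in>F i. (\<forall>x\<in>{..<n}. \<mu> x < l \<longrightarrow> y x = 0) \<and>
          (\<forall>x\<in>{..<n}. \<mu> x = l \<longrightarrow> y x = app n u v x)"
        by (intro bexI[of _ y]) auto
    qed
  qed
qed

text \<open>The initial flag consists of coordinate subspaces, and multiplying coordinates by
  scalars preserves these.\<close>

lemma diag_mem_stab_init:
  assumes \<mu>: "inj_on \<mu> {..<n}" and F: "is_flag n F"
  shows "(\<lambda>(i, j). if i = j \<and> i < n then h i else 0) \<in> stab n (\<lambda>i. init_space {..<n} \<mu> (F i))"
  unfolding stab_def
proof (intro CollectI allI impI ballI)
  fix i v assume i: "i \<le> n" and v: "v \<in> init_space {..<n} \<mu> (F i)"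
  have Fi: "fs.subspace (F i)" using F i by (auto simp: is_flag_def)
  have "(\<lambda>x. \<Sum>j<n. h j * (if x = j then v x else 0)) \<in> init_space {..<n} \<mu> (F i)"
    by (intro subspace_sum subspace_cmult subspace_init_space Fi init_space_proj \<mu> v)
  also have "(\<lambda>x. \<Sum>j<n. h j * (if x = j then v x else 0)) =
      app n (\<lambda>(i, j). if i = j \<and> i < n then h i else 0) v"
    by (auto simp: app_def fun_eq_iff if_distrib if_distribR cong: if_cong)
  finally show "app n (\<lambda>(i, j). if i = j \<and> i < n then h i else 0) v \<in> init_space {..<n} \<mu> (F i)" .
qed

lemma flag_top:
  assumes "is_flag n F"
  shows "F n = supp_on {..<n}"
proof (rule sym, rule subspace_eq_of_dim[where K = "{..<n}"])
  show "fs.dim (supp_on {..<n}) \<le> fs.dim (F n)"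
    using assms by (simp add: dim_supp_on is_flag_def)
qed (use assms in \<open>auto simp: is_flag_def subspace_supp_on\<close>)

lemma flag_bot:
  assumes "is_flag n F"
  shows "F 0 = {\<lambda>_. 0}"
proof (rule subspace_eq_of_dim[where K = "{..<n}"])
  show "fs.subspace {\<lambda>_::nat. 0::complex}" by (simp add: subspace_iff)
  show "{\<lambda>_. 0} \<subseteq> F 0" using assms by (simp add: is_flag_def subspace_zero)
qed (use assms in \<open>auto simp: is_flag_def\<close>)

lemma supp_on_mono: "J \<subseteq> K \<Longrightarrow> supp_on J \<subseteq> supp_on K"
  by (auto simp: supp_on_def)

lemma is_flag_standard: "is_flag n (\<lambda>i. supp_on {..<i})"
  by (simp add: is_flag_def subspace_supp_on dim_supp_on supp_on_mono)

definition unitv :: "nat \<Rightarrow> nat \<Rightarrow> complex" where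
  "unitv p = (\<lambda>x. if x = p then 1 else 0)"

lemma unitv_mem:
  assumes "fs.subspace W" "(\<lambda>x. if x = p then v x else 0) \<in> W" "v p \<noteq> 0"
  shows "unitv p \<in> W"
proof -
  have "(\<lambda>x. (1 / v p) * (if x = p then v x else 0)) \<in> W"
    using subspace_cmult[OF assms(1,2)] .
  also have "(\<lambda>x. (1 / v p) * (if x = p then v x else 0)) = unitv p"
    using assms(3) by (auto simp: unitv_def)
  finally show ?thesis .
qed

lemma dim_coordinate_subspace:
  assumes W: "fs.subspace W" "W \<subseteq> supp_on {..<n}"
    and proj: "\<And>v p. v \<in> W \<Longrightarrow> (\<lambda>x. if x = p then v x else 0) \<in> W"
  shows "fs.dim W = card {p. p < n \<and> unitv p \<in> W}"
proof -
  have "pivots {..<n} id W = {p. p < n \<and> unitv p \<in> W}"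
  proof (intro subset_antisym subsetI)
    fix p assume "p \<in> pivots {..<n} id W"
    then obtain w where "p < n" "w \<in> W" "w p \<noteq> 0" by (auto simp: pivots_def leads_def)
    then show "p \<in> {p. p < n \<and> unitv p \<in> W}" using unitv_mem[OF W(1) proj] by blast
  next
    fix p assume "p \<in> {p. p < n \<and> unitv p \<in> W}"
    then show "p \<in> pivots {..<n} id W"
      by (auto simp: pivots_def leads_def unitv_def intro!: bexI[of _ "unitv p"])
  qed
  then show ?thesis using dim_eq_card_pivots[of "{..<n}" id W] W by simp
qed

text \<open>A matrix stabilizing a coordinate flag is triangular up to a permutation of the basis.\<close>

lemma eigenvalue_on_diagonal:
  assumes F: "is_flag n F" and proj: "\<And>i v p. i \<le> n \<Longrightarrow> v \<in> F i \<Longrightarrow> (\<lambda>x. if x = p then v x else 0) \<in> F i"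
    and D: "D \<in> stab n F" and v: "v \<in> supp_on {..<n}" "v \<noteq> (\<lambda>_. 0)" "app n D v = (\<lambda>x. c * v x)"
  obtains p where "p < n" "D (p, p) = c"
proof -
  \<comment> \<open>The first member of the flag containing \<open>v\<close>. The previous one,
    \<open>F k\<close>, misses \<open>v\<close>, so the only unit vector that is new in
    \<open>F i\<close> is some \<open>unitv p\<close> with \<open>v p\<close> non-zero.\<close>
  define i where "i = (LEAST i. v \<in> F i)"
  have "v \<in> F n" using flag_top[OF F] v by simp
  then have i: "v \<in> F i" "i \<le> n"
    unfolding i_def by (rule LeastI, rule Least_le)
  have "i \<noteq> 0"
  proof
    assume "i = 0"
    then have "v \<in> F 0" using i by simp
    then show False using flag_bot[OF F] v(2) by simp
  qed
  then obtain k where k: "i = Suc k" by (cases i) auto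
  have vk: "v \<notin> F k" using k not_less_Least[of k "\<lambda>i. v \<in> F i"] by (auto simp: i_def)
  have Fs: "fs.subspace (F j)" "F j \<subseteq> supp_on {..<n}" "fs.dim (F j) = j" if "j \<le> n" for j
    using F that by (auto simp: is_flag_def)
  define P where "P j = {p. p < n \<and> unitv p \<in> F j}" for j
  have card: "card (P j) = j" if "j \<le> n" for j
    using dim_coordinate_subspace[OF Fs(1,2)[OF that] proj[OF that]] Fs(3)[OF that] by (simp add: P_def)
  have "F k \<subseteq> F i" using F k i by (auto simp: is_flag_def)
  then have PP: "P k \<subseteq> P i" by (auto simp: P_def)
  have kn: "k \<le> n" using k i by simp
  have "\<exists>p<n. (\<lambda>x. if x = p then v x else 0) \<notin> F k"
  proof (rule ccontr)
    assume "\<not> ?thesis"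
    then have "(\<lambda>x. \<Sum>p<n. if x = p then v x else 0) \<in> F k"
      by (intro subspace_sum Fs kn) auto
    also have "(\<lambda>x. \<Sum>p<n. if x = p then v x else 0) = v"
      using v by (auto simp: fun_eq_iff supp_on_def)
    finally show False using vk by simp
  qed
  then obtain p where p: "p < n" "(\<lambda>x. if x = p then v x else 0) \<notin> F k" by blast
  have vp: "v p \<noteq> 0"
  proof
    assume "v p = 0"
    then have "(\<lambda>x. if x = p then v x else 0) = (\<lambda>_. 0)" by auto
    then show False using p subspace_zero[OF Fs(1)[OF kn]] by simp
  qed
  have pk: "p \<notin> P k"
  proof
    assume "p \<in> P k"
    then have "(\<lambda>x. v p * unitv p x) \<in> F k"
      using subspace_cmult[OF Fs(1)[OF kn]] by (simp add: P_def)
    also have "(\<lambda>x. v p * unitv p x) = (\<lambda>x. if x = p then v x else 0)"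
      by (auto simp: unitv_def)
    finally show False using p by simp
  qed
  have pi: "p \<in> P i" using unitv_mem[OF Fs(1)[OF i(2)] proj[OF i(2,1)] vp] p by (simp add: P_def)
  have "finite (P i)" by (simp add: P_def)
  then have Pi: "insert p (P k) = P i"
    using PP pk pi card[OF kn] card[OF i(2)] k finite_subset[OF PP]
    by (intro card_subset_eq) auto
  \<comment> \<open>The other unit vectors in the support of \<open>v\<close> lie in
    \<open>F k\<close>, and \<open>D\<close> maps them into \<open>F k\<close>, whose elements
    vanish at \<open>p\<close>. Row \<open>p\<close> of the eigenvalue equation thus reduces to the
    diagonal entry.\<close>
  have zero: "D (p, q) * v q = 0" if q: "q < n" "q \<noteq> p" for q
  proof (cases "v q = 0")
    case False
    then have "q \<in> P i" using unitv_mem[OF Fs(1)[OF i(2)] proj[OF i(2,1)]] q by (simp add: P_def)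
    then have "unitv q \<in> F k" using Pi q by (auto simp: P_def)
    then have "app n D (unitv q) \<in> F k" using D kn by (auto simp: stab_def)
    moreover have "app n D (unitv q) = (\<lambda>x. D (x, q))"
      using q by (auto simp: app_def unitv_def if_distrib cong: if_cong)
    ultimately have "D (p, q) = 0"
      using unitv_mem[OF Fs(1)[OF kn] proj[OF kn]] pk p by (fastforce simp: P_def)
    then show ?thesis by simp
  qed simp
  have "c * v p = app n D v p" using v by simp
  also have "\<dots> = D (p, p) * v p + (\<Sum>q\<in>{..<n} - {p}. D (p, q) * v q)"
    using p by (simp add: app_def sum.remove)
  also have "(\<Sum>q\<in>{..<n} - {p}. D (p, q) * v q) = 0"
    using zero by (intro sum.neutral) auto
  finally show ?thesis using that[of p] p vp by simp
qed

text \<open>\<open>D\<close> is triangular for the order by \<open>\<mu>\<close>: it preserves the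
  span of the coordinates of weight at least \<open>\<mu> k\<close>, and \<open>D\<close> minus
  \<open>h k\<close> maps that span into the one without coordinate \<open>k\<close>. A dimension
  count gives a kernel vector.\<close>

lemma eigenvector_triangular:
  fixes \<mu> :: "nat \<Rightarrow> real"
  assumes \<mu>: "inj_on \<mu> {..<n}" and D: "D \<in> supp_on (sq n)" "\<And>i. i < n \<Longrightarrow> D (i, i) = h i"
    "\<And>i j. i < n \<Longrightarrow> j < n \<Longrightarrow> \<mu> i < \<mu> j \<Longrightarrow> D (i, j) = 0" and k: "k < n"
  obtains v where "v \<in> supp_on {..<n}" "v \<noteq> (\<lambda>_. 0)" "app n D v = (\<lambda>x. h k * v x)"
proof -
  define J where "J = {x. x < n \<and> \<mu> k \<le> \<mu> x}"
  define T where "T v = (\<lambda>x. app n D v x - h k * v x)" for v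
  have J: "finite J" "k \<in> J" "J \<subseteq> {..<n}" using k by (auto simp: J_def)
  have lin: "Vector_Spaces.linear fscale fscale T"
    by (rule linearI_fun) (auto simp: T_def app_add app_cmult algebra_simps)
  have "T ` supp_on J \<subseteq> supp_on (J - {k})"
  proof clarify
    fix v :: "nat \<Rightarrow> complex" assume v: "v \<in> supp_on J"
    have "T v x = 0" if x: "x \<notin> J - {k}" for x
    proof -
      consider "x \<ge> n" | "x < n" "x \<notin> J" | "x = k" using x by fastforce
      then show ?thesis
      proof cases
        case 1
        then show ?thesis using v D(1) J by (auto simp: T_def app_def supp_on_def)
      next
        case 2
        have z: "D (x, j) * v j = 0" if "j < n" for j
          using 2 that D(3)[of x j] v by (cases "j \<in> J") (auto simp: J_def supp_on_def)
        have "app n D v x = 0" unfolding app_def by (intro sum.neutral ballI z) simp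
        then show ?thesis using 2 v by (simp add: T_def supp_on_def)
      next
        case 3
        have "D (k, j) * v j = 0" if "j < n" "j \<noteq> k" for j
        proof (cases "j \<in> J")
          case True
          then have "\<mu> k < \<mu> j" using \<mu> that k by (auto simp: J_def less_le dest: inj_onD)
          then show ?thesis using D(3)[of k j] that k by simp
        qed (use v in \<open>simp add: supp_on_def\<close>)
        then have "(\<Sum>j\<in>{..<n} - {k}. D (k, j) * v j) = 0" by (intro sum.neutral) auto
        then show ?thesis using 3 k D(2)[of k] by (simp add: T_def app_def sum.remove[of "{..<n}" k])
      qed
    qed
    then show "T v \<in> supp_on (J - {k})" by (simp add: supp_on_def)
  qed
  then have le: "fs.dim (T ` supp_on J) \<le> card (J - {k})"
    using dim_mono[OF _ subspace_linear_image[OF subspace_supp_on lin] subspace_supp_on, of "J - {k}" J "J - {k}"] J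
    by (simp add: dim_supp_on)
  have "\<not> inj_on T (supp_on J)"
  proof
    assume "inj_on T (supp_on J)"
    then have "fs.dim (T ` supp_on J) = card J"
      using dim_image[OF J(1) subspace_supp_on order_refl lin] J by (simp add: dim_supp_on)
    then show False using le J card_Diff1_less[of J k] by simp
  qed
  then obtain u w where uw: "u \<in> supp_on J" "w \<in> supp_on J" "u \<noteq> w" "T u = T w"
    by (auto simp: inj_on_def)
  define v where "v = (\<lambda>x. u x + (-1) * w x)"
  have "app n D v x = h k * v x" for x
  proof -
    have "app n D v x = app n D u x + (-1) * app n D w x"
      by (simp only: v_def app_add app_cmult)
    also have "app n D u x - h k * u x = app n D w x - h k * w x"
      using uw(4) by (auto simp: T_def fun_eq_iff)
    then have "app n D u x + (-1) * app n D w x = h k * (u x + (-1) * w x)"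
      by (simp add: algebra_simps)
    also have "\<dots> = h k * v x" by (simp add: v_def)
    finally show ?thesis .
  qed
  then have "app n D v = (\<lambda>x. h k * v x)" by blast
  moreover have "v \<in> supp_on J" using uw by (auto simp: v_def supp_on_def)
  then have "v \<in> supp_on {..<n}" using supp_on_mono[OF J(3)] by blast
  moreover have "v \<noteq> (\<lambda>_. 0)" using uw(3) by (auto simp: v_def fun_eq_iff)
  ultimately show ?thesis using that by blast
qed

lemma stab_conj:
  assumes F: "is_flag n F" and RQ: "mm n R Q = idm n" and D: "D \<in> stab n F"
  shows "conj_by n Q R D \<in> stab n (\<lambda>i. app n Q ` F i)"
  unfolding stab_def
proof (intro CollectI allI impI ballI)
  fix i w assume i: "i \<le> n" "w \<in> app n Q ` F i"
  then obtain v where v: "v \<in> F i" "w = app n Q v" by blast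
  have "v \<in> supp_on {..<n}" using F v i by (auto simp: is_flag_def)
  then have "app n R w = v" by (simp add: v(2) flip: app_mm) (simp add: RQ app_idm)
  then have "app n (conj_by n Q R D) w = app n Q (app n D v)"
    by (simp add: conj_by_def app_mm)
  then show "app n (conj_by n Q R D) w \<in> app n Q ` F i" using D v i by (auto simp: stab_def)
qed

lemma is_flag_image:
  assumes F: "is_flag n F" and Q: "Q \<in> supp_on (sq n)" and RQ: "mm n R Q = idm n"
  shows "is_flag n (\<lambda>i. app n Q ` F i)"
proof -
  have "fs.dim (app n Q ` F i) = i" if "i \<le> n" for i
  proof -
    have Fi: "fs.subspace (F i)" "F i \<subseteq> supp_on {..<n}" "fs.dim (F i) = i"
      using F that by (auto simp: is_flag_def)
    have "inj_on (app n Q) (F i)"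
    proof (rule inj_on_inverseI)
      fix v assume "v \<in> F i"
      then show "app n R (app n Q v) = v"
        using Fi by (simp flip: app_mm) (auto simp: RQ app_idm)
    qed
    then show ?thesis using dim_image[OF _ Fi(1,2) linear_app] Fi(3) by simp
  qed
  then show ?thesis
    using F unfolding is_flag_def
    by (simp add: subspace_linear_image[OF _ linear_app] image_mono)
      (simp add: image_subset_iff app_supp[OF Q])
qed

text \<open>Takes the place of the conjugacy of maximal tori. Spectra are compared instead of tori,
  because the eigenvalues of a matrix stabilizing a coordinate flag can be read off its
  diagonal.\<close>

lemma conjugate_tori_spectrum:
  fixes \<nu> \<mu> :: "nat \<Rightarrow> real"
  assumes G: "fs.subspace G" "G \<subseteq> supp_on (sq n)" and G': "fs.subspace G'" "G' \<subseteq> supp_on (sq n)"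
    and \<nu>: "inj_on \<nu> {..<n}" and \<mu>: "inj_on \<mu> {..<n}"
    and stableG: "\<And>D. D \<in> G \<Longrightarrow> (\<lambda>x. of_real (exp ((\<lambda>(i, j). \<nu> i - \<nu> j) x)) * D x) \<in> G"
    and stableG': "\<And>D. D \<in> G' \<Longrightarrow> (\<lambda>x. of_real (exp ((\<lambda>(i, j). \<mu> i - \<mu> j) x)) * D x) \<in> G'"
    and QR: "Q \<in> supp_on (sq n)" "R \<in> supp_on (sq n)" "mm n R Q = idm n" "mm n Q R = idm n"
    and QG: "\<And>D. D \<in> G \<Longrightarrow> conj_by n Q R D \<in> G'" and RG: "\<And>D. D \<in> G' \<Longrightarrow> conj_by n R Q D \<in> G"
    and diag: "(\<lambda>(i, j). if i = j \<and> i < n then of_real (\<mu> i) else 0) \<in> G'"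
  obtains \<sigma> where "bij_betw \<sigma> {..<n} {..<n}"
    "(\<lambda>(i, j). if i = j \<and> i < n then of_real (\<mu> (\<sigma> i)) else 0) \<in> G"
proof -
  let ?w = "\<lambda>(i, j). \<nu> i - \<nu> j" and ?w' = "\<lambda>(i, j). \<mu> i - \<mu> j"
  have fin: "finite (sq n)" "finite {..<n}" by auto
  have sub: "fs.subspace (G \<inter> stab n F)" "fs.subspace (G' \<inter> stab n F)" if "is_flag n F" for F
    using fs.subspace_inter[OF _ subspace_stab[OF that]] G G' by auto
  \<comment> \<open>There are infinitely many flags in general; the bound on the dimension makes a
    maximum exist.\<close>
  have "\<forall>F. is_flag n F \<longrightarrow> fs.dim (G \<inter> stab n F) \<le> card (sq n)"
    using dim_le_card_supp[OF fin(1) sub(1)] G by blast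
  then obtain F where F: "is_flag n F"
    and Fmax: "\<And>F'. is_flag n F' \<Longrightarrow> fs.dim (G \<inter> stab n F') \<le> fs.dim (G \<inter> stab n F)"
    using ex_has_greatest_nat[of "is_flag n" _ "\<lambda>F. fs.dim (G \<inter> stab n F)" "Suc (card (sq n))"]
      is_flag_standard[of n] by (metis le_imp_less_Suc)
  define F1 where "F1 = (\<lambda>i. init_space {..<n} \<nu> (F i))"
  have F1: "is_flag n F1" unfolding F1_def by (rule is_flag_init[OF F])
  have proj: "(\<lambda>x. if x = p then v x else 0) \<in> F1 i" if "i \<le> n" "v \<in> F1 i" for i v p
    using that F unfolding F1_def by (auto simp: is_flag_def intro!: init_space_proj[OF \<nu>])
  have "init_space (sq n) ?w (G \<inter> stab n F) \<subseteq> G \<inter> stab n F1"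
    using init_space_subset_graded[OF fin(1) G stableG] init_space_stab[OF \<nu> F, of "G \<inter> stab n F"]
    unfolding F1_def by blast
  then have "fs.dim (init_space (sq n) ?w (G \<inter> stab n F)) \<le> fs.dim (G \<inter> stab n F1)"
    using dim_mono[OF fin(1) subspace_init_space[OF sub(1)[OF F]] sub(1)[OF F1]] G by blast
  then have "fs.dim (G \<inter> stab n F) \<le> fs.dim (G \<inter> stab n F1)"
    using dim_init_space[OF fin(1) sub(1)[OF F]] G by (metis le_infI1)
  then have F1max: "fs.dim (G \<inter> stab n F') \<le> fs.dim (G \<inter> stab n F1)" if "is_flag n F'" for F'
    using Fmax[OF that] by simp
  define W where "W = conj_by n Q R ` (G \<inter> stab n F1)"
  have W_dim: "fs.dim W = fs.dim (G \<inter> stab n F1)"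
    unfolding W_def
  proof (rule dim_image[OF fin(1) sub(1)[OF F1] _ linear_conj_by])
    show "inj_on (conj_by n Q R) (G \<inter> stab n F1)"
      by (rule inj_on_inverseI[where g = "conj_by n R Q"]) (use QR G conj_by_inverse in blast)
  qed (use G in blast)
  have W_sub: "fs.subspace W"
    unfolding W_def by (rule subspace_linear_image[OF sub(1)[OF F1] linear_conj_by])
  define F2 where "F2 = (\<lambda>i. app n Q ` F1 i)"
  have F2: "is_flag n F2" unfolding F2_def by (rule is_flag_image[OF F1 QR(1,3)])
  have WG: "W \<subseteq> G'" and WF2: "W \<subseteq> stab n F2"
    unfolding W_def F2_def using QG stab_conj[OF F1 QR(3)] by auto
  have Wsupp: "W \<subseteq> supp_on (sq n)" using WG G' by blast
  define F3 where "F3 = (\<lambda>i. init_space {..<n} \<mu> (F2 i))"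
  have F3: "is_flag n F3" unfolding F3_def by (rule is_flag_init[OF F2])
  let ?W2 = "G' \<inter> stab n F3"
  have "?W2 = init_space (sq n) ?w' W"
  proof (rule subspace_eq_of_dim[OF fin(1) subspace_init_space[OF W_sub] sub(2)[OF F3]])
    show "init_space (sq n) ?w' W \<subseteq> ?W2"
      using init_space_subset_graded[OF fin(1) G' stableG' WG] init_space_stab[OF \<mu> F2 WF2]
      unfolding F3_def by blast
    \<comment> \<open>Carried back by \<open>R\<close>, these matrices lie in \<open>G\<close> and
      stabilize the image of \<open>F3\<close> under \<open>R\<close>; as \<open>F1\<close> is
      maximal among all flags, their dimension is bounded.\<close>
    have "fs.dim ?W2 = fs.dim (conj_by n R Q ` ?W2)"
    proof (rule dim_image[symmetric, OF fin(1) sub(2)[OF F3] _ linear_conj_by])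
      show "inj_on (conj_by n R Q) ?W2"
        by (rule inj_on_inverseI[where g = "conj_by n Q R"]) (use QR G' conj_by_inverse in blast)
    qed (use G' in blast)
    also have "\<dots> \<le> fs.dim (G \<inter> stab n (\<lambda>i. app n R ` F3 i))"
    proof (rule dim_mono[OF fin(1) subspace_linear_image[OF sub(2)[OF F3] linear_conj_by]])
      show "fs.subspace (G \<inter> stab n (\<lambda>i. app n R ` F3 i))"
        by (rule sub(1)[OF is_flag_image[OF F3 QR(2,4)]])
      show "conj_by n R Q ` ?W2 \<subseteq> G \<inter> stab n (\<lambda>i. app n R ` F3 i)"
        using RG stab_conj[OF F3 QR(4)] by auto
    qed (use G in blast)
    also have "\<dots> \<le> fs.dim (G \<inter> stab n F1)"
      by (rule F1max[OF is_flag_image[OF F3 QR(2,4)]])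
    also have "\<dots> = fs.dim (init_space (sq n) ?w' W)"
      using dim_init_space[OF fin(1) W_sub Wsupp] W_dim by simp
    finally show "fs.dim ?W2 \<le> fs.dim (init_space (sq n) ?w' W)" .
  qed (use G' in blast)
  moreover have "(\<lambda>(i, j). if i = j \<and> i < n then of_real (\<mu> i) else 0) \<in> ?W2"
    using diag diag_mem_stab_init[OF \<mu> F2, of "\<lambda>i. of_real (\<mu> i)"] unfolding F3_def by simp
  ultimately have "(\<lambda>(i, j). if i = j \<and> i < n then of_real (\<mu> i) else 0) \<in> init_space (sq n) ?w' W"
    by blast
  \<comment> \<open>Membership is read at weight 0, the weight of the diagonal: \<open>D'\<close>
    has no entries of negative weight and has diagonal \<mu>, so it is triangular with these
    eigenvalues.\<close>
  then obtain D' where D': "D' \<in> W" "\<forall>x\<in>sq n. ?w' x < 0 \<longrightarrow> D' x = 0"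
    "\<forall>x\<in>sq n. ?w' x = 0 \<longrightarrow> D' x = (\<lambda>(i, j). if i = j \<and> i < n then of_real (\<mu> i) else 0) x"
    unfolding init_space_def by blast
  obtain D where D: "D \<in> G" "D \<in> stab n F1" "D' = conj_by n Q R D"
    using D'(1) unfolding W_def by blast
  have D's: "D' \<in> supp_on (sq n)" using D' Wsupp by blast
  \<comment> \<open>An eigenvector of \<open>D'\<close> carried back by \<open>R\<close> is an
    eigenvector of \<open>D\<close>, which stabilizes the coordinate flag \<open>F1\<close>; so the
    eigenvalue occurs on the diagonal of \<open>D\<close>.\<close>
  have ex: "\<exists>p. p < n \<and> D (p, p) = of_real (\<mu> k)" if k: "k < n" for k
  proof -
    obtain v where v: "v \<in> supp_on {..<n}" "v \<noteq> (\<lambda>_. 0)" "app n D' v = (\<lambda>x. of_real (\<mu> k) * v x)"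
      by (rule eigenvector_triangular[OF \<mu> D's, of "\<lambda>i. of_real (\<mu> i)" k]) (use D' k in auto)
    define u where "u = app n R v"
    have Qu: "app n Q u = v" using v by (simp add: u_def QR app_idm flip: app_mm)
    have u: "u \<in> supp_on {..<n}" by (simp add: u_def app_supp QR)
    have "app n Q (app n D (app n R v)) = (\<lambda>x. of_real (\<mu> k) * v x)"
      using v by (simp add: D conj_by_def app_mm)
    then have "app n (mm n R Q) (app n D u) = (\<lambda>x. of_real (\<mu> k) * u x)"
      by (simp add: app_cmult u_def app_mm)
    moreover have "app n D u \<in> supp_on {..<n}" using D G by (intro app_supp) blast
    ultimately have "app n D u = (\<lambda>x. of_real (\<mu> k) * u x)"
      by (simp add: QR app_idm)
    moreover have "u \<noteq> (\<lambda>_. 0)"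
    proof
      assume "u = (\<lambda>_. 0)"
      then have "v = (\<lambda>_. 0)" using Qu by (simp add: app_def)
      then show False using v by simp
    qed
    ultimately show ?thesis
      using eigenvalue_on_diagonal[OF F1 proj D(2) u] by metis
  qed
  then obtain \<tau> where \<tau>: "\<And>k. k < n \<Longrightarrow> \<tau> k < n" "\<And>k. k < n \<Longrightarrow> D (\<tau> k, \<tau> k) = of_real (\<mu> k)"
    by metis
  have "inj_on \<tau> {..<n}"
    using \<tau> \<mu> by (intro inj_onI) (metis inj_onD lessThan_iff of_real_eq_iff)
  then have bij: "bij_betw \<tau> {..<n} {..<n}"
    using \<tau>(1) endo_inj_surj[of "{..<n}" \<tau>] by (auto simp: bij_betw_def)
  define \<sigma> where "\<sigma> = inv_into {..<n} \<tau>"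
  have \<sigma>: "bij_betw \<sigma> {..<n} {..<n}" unfolding \<sigma>_def by (rule bij_betw_inv_into[OF bij])
  have D\<sigma>: "D (i, i) = of_real (\<mu> (\<sigma> i))" if "i < n" for i
  proof -
    have "\<tau> (\<sigma> i) = i" "\<sigma> i < n"
      using bij \<sigma> that by (auto simp: \<sigma>_def bij_betw_inv_into_right dest: bij_betwE)
    then show ?thesis using \<tau>(2) by metis
  qed
  \<comment> \<open>By injectivity of \<nu> the weight 0 part of \<open>D\<close> is its diagonal
    part, and \<open>G\<close> contains the weight components of its elements.\<close>
  have "(\<lambda>x. if ?w x = 0 then D x else 0) \<in> G"
    by (rule weight_component_mem[OF fin(1) G stableG D(1)])
  also have "(\<lambda>x. if ?w x = 0 then D x else 0) =
      (\<lambda>(i, j). if i = j \<and> i < n then of_real (\<mu> (\<sigma> i)) else 0)"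
  proof
    fix x :: "nat \<times> nat"
    obtain i j where x: "x = (i, j)" by force
    show "(if ?w x = 0 then D x else 0) = (\<lambda>(i, j). if i = j \<and> i < n then of_real (\<mu> (\<sigma> i)) else 0) x"
      unfolding x using D\<sigma> D G \<nu> by (cases "i < n \<and> j < n") (auto simp: supp_on_def dest: inj_onD)
  qed
  finally show ?thesis using that[OF \<sigma>] by blast
qed

subsection \<open>Homogeneous polynomial functions\<close>

text \<open>Polynomial functions in place of coefficient families: closure under linear
  substitution, scaling and existence of gradients become inductions. The zero function has every
  degree.\<close>

inductive hpoly :: "nat \<Rightarrow> nat \<Rightarrow> ((nat \<Rightarrow> complex) \<Rightarrow> complex) \<Rightarrow> bool" for N where
  const: "hpoly N 0 (\<lambda>x. c)"
| var: "hpoly N k g \<Longrightarrow> i \<le> N \<Longrightarrow> hpoly N (Suc k) (\<lambda>x. x i * g x)"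
| add: "hpoly N k g \<Longrightarrow> hpoly N k h \<Longrightarrow> hpoly N k (\<lambda>x. g x + h x)"

lemma hpoly_zero: "hpoly N k (\<lambda>x. 0)"
proof (induction k)
  case 0
  show ?case by (rule hpoly.const)
next
  case (Suc k)
  from hpoly.var[OF this, of 0] show ?case by simp
qed

lemma hpoly_cmult: "hpoly N k g \<Longrightarrow> hpoly N k (\<lambda>x. c * g x)"
proof (induction rule: hpoly.induct)
  case (const a)
  show ?case by (rule hpoly.const)
next
  case (var k g i)
  from hpoly.var[OF var.IH var.hyps(2)] show ?case by (simp add: mult.left_commute)
next
  case (add k g h)
  from hpoly.add[OF add.IH] show ?case by (simp add: distrib_left)
qed

lemma hpoly_sum: "(\<And>i. i \<in> A \<Longrightarrow> hpoly N k (g i)) \<Longrightarrow> hpoly N k (\<lambda>x. \<Sum>i\<in>A. g i x)"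
  by (induction A rule: infinite_finite_induct) (auto intro: hpoly_zero hpoly.add)

lemma hpoly_mult:
  assumes "hpoly N l h"
  shows "hpoly N k g \<Longrightarrow> hpoly N (k + l) (\<lambda>x. g x * h x)"
proof (induction rule: hpoly.induct)
  case (const c)
  from hpoly_cmult[OF assms] show ?case by simp
next
  case (var k g i)
  from hpoly.var[OF var.IH var.hyps(2)] show ?case by (simp add: mult.assoc)
next
  case (add k g g')
  from hpoly.add[OF add.IH] show ?case by (simp add: distrib_right)
qed

lemma hpoly_coord: "i \<le> N \<Longrightarrow> hpoly N 1 (\<lambda>x. x i)"
  using hpoly.var[OF hpoly.const[where c = 1]] by simp

lemma hpoly_power: "i \<le> N \<Longrightarrow> hpoly N k (\<lambda>x. x i ^ k)"
proof (induction k)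
  case 0
  from hpoly.const[where c = 1] show ?case by simp
next
  case (Suc k)
  from hpoly.var[OF Suc.IH[OF Suc.prems] Suc.prems] show ?case by simp
qed

lemma hpoly_monom:
  "A \<subseteq> {..N} \<Longrightarrow> hpoly N (\<Sum>i\<in>A. a i) (\<lambda>x. \<Prod>i\<in>A. x i ^ a i)"
proof (induction A rule: infinite_finite_induct)
  case (insert i A)
  then show ?case using hpoly_mult[OF insert.IH hpoly_power[of i N "a i"]] by simp
qed (use hpoly.const[where c = 1] in simp_all)

lemma hpoly_subst:
  assumes "\<And>i. i \<le> N \<Longrightarrow> hpoly N 1 (L i)"
  shows "hpoly N k g \<Longrightarrow> hpoly N k (\<lambda>x. g (\<lambda>i. L i x))"
proof (induction rule: hpoly.induct)
  case (const c)
  show ?case by (rule hpoly.const)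
next
  case (var k g i)
  from hpoly_mult[OF var.IH assms[OF var.hyps(2)]] show ?case by simp
next
  case (add k g h)
  from hpoly.add[OF add.IH] show ?case .
qed

lemma hpoly_app:
  assumes "hpoly N k g" "n \<le> Suc N"
  shows "hpoly N k (\<lambda>x. g (app n A x))"
  unfolding app_def
proof (rule hpoly_subst[OF _ assms(1)])
  fix i
  show "hpoly N 1 (\<lambda>x. \<Sum>j<n. A (i, j) * x j)"
    using assms(2) by (intro hpoly_sum hpoly_cmult hpoly_coord) auto
qed

lemma hpoly_cong: "hpoly N k g \<Longrightarrow> (\<And>i. i \<le> N \<Longrightarrow> x i = y i) \<Longrightarrow> g x = g y"
  by (induction rule: hpoly.induct) auto

lemma hpoly_scale: "hpoly N k g \<Longrightarrow> g (\<lambda>i. c * x i) = c ^ k * g x"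
  by (induction rule: hpoly.induct) (auto simp: algebra_simps)

lemma hpoly_of_poly:
  assumes "homogeneous_poly N f"
  obtains k g where "hpoly N k g" "\<And>v. poly_value N f v = g (\<lambda>i. v $ i)"
proof -
  obtain k where k: "\<And>\<alpha>. \<alpha> \<in> Poly_Mapping.keys f \<Longrightarrow> (\<Sum>i\<le>N. Poly_Mapping.lookup \<alpha> i) = k"
    using assms by (auto simp: homogeneous_poly_def)
  have "hpoly N k (\<lambda>x. \<Sum>\<alpha>\<in>Poly_Mapping.keys f.
      Poly_Mapping.lookup f \<alpha> * (\<Prod>i\<le>N. x i ^ Poly_Mapping.lookup \<alpha> i))"
    using k hpoly_monom[of "{..N}" N] by (intro hpoly_sum hpoly_cmult) auto
  then show ?thesis using that by (simp add: poly_value_def)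
qed

text \<open>\<open>A\<close> need only contain the support of \<open>c\<close>, so cancellation in a
  sum is harmless and the union of two such sets serves the sum.\<close>

definition expansion :: "nat \<Rightarrow> nat \<Rightarrow> ((nat \<Rightarrow> complex) \<Rightarrow> complex) \<Rightarrow> (nat \<Rightarrow>\<^sub>0 nat) set \<Rightarrow>
    ((nat \<Rightarrow>\<^sub>0 nat) \<Rightarrow> complex) \<Rightarrow> bool" where
  "expansion N k g A c \<longleftrightarrow> finite A \<and>
    (\<forall>\<alpha>\<in>A. Poly_Mapping.keys \<alpha> \<subseteq> {..N} \<and> (\<Sum>i\<le>N. Poly_Mapping.lookup \<alpha> i) = k) \<and>
    (\<forall>\<alpha>. \<alpha> \<notin> A \<longrightarrow> c \<alpha> = 0) \<and>
    (\<forall>x. g x = (\<Sum>\<alpha>\<in>A. c \<alpha> * (\<Prod>i\<le>N. x i ^ Poly_Mapping.lookup \<alpha> i)))"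

lemma expansionD:
  assumes "expansion N k g A c"
  shows "finite A" "\<And>\<alpha>. \<alpha> \<in> A \<Longrightarrow> Poly_Mapping.keys \<alpha> \<subseteq> {..N}"
    "\<And>\<alpha>. \<alpha> \<in> A \<Longrightarrow> (\<Sum>i\<le>N. Poly_Mapping.lookup \<alpha> i) = k" "\<And>\<alpha>. \<alpha> \<notin> A \<Longrightarrow> c \<alpha> = 0"
    "\<And>x. g x = (\<Sum>\<alpha>\<in>A. c \<alpha> * (\<Prod>i\<le>N. x i ^ Poly_Mapping.lookup \<alpha> i))"
  using assms by (simp_all add: expansion_def)

lemma ex_expansion: "hpoly N k g \<Longrightarrow> \<exists>A c. expansion N k g A c"
proof (induction rule: hpoly.induct)
  case (const a)
  have "expansion N 0 (\<lambda>x. a) {0} (\<lambda>\<alpha>. if \<alpha> = 0 then a else 0)"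
    by (simp add: expansion_def)
  then show ?case by blast
next
  case (var k g i)
  then obtain A c where e: "expansion N k g A c" by blast
  note A = expansionD[OF e]
  \<comment> \<open>Multiplication by the variable shifts exponents injectively, so coefficients are
    carried over one by one and never merge.\<close>
  define T where "T \<alpha> = \<alpha> + Poly_Mapping.single i (1::nat)" for \<alpha>
  have inj: "inj T" by (auto simp: T_def inj_on_def)
  have T: "Poly_Mapping.lookup (T \<alpha>) j = Poly_Mapping.lookup \<alpha> j + (if j = i then 1 else 0)" for \<alpha> j
    by (auto simp: T_def lookup_add lookup_single when_def)
  have "Poly_Mapping.keys (T \<alpha>) \<subseteq> {..N}" if "\<alpha> \<in> A" for \<alpha>
  proof
    fix j assume "j \<in> Poly_Mapping.keys (T \<alpha>)"
    then have "j \<in> Poly_Mapping.keys \<alpha> \<or> j = i" by (auto simp: in_keys_iff T split: if_splits)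
    then show "j \<in> {..N}" using A(2)[OF that] var.hyps(2) by auto
  qed
  moreover have "(\<Sum>j\<le>N. Poly_Mapping.lookup (T \<alpha>) j) = Suc k" if "\<alpha> \<in> A" for \<alpha>
    using A(3)[OF that] var.hyps(2) by (simp add: T sum.distrib)
  moreover have "x i * g x = (\<Sum>\<alpha>\<in>T ` A. (if \<alpha> \<in> T ` A then c (inv_into UNIV T \<alpha>) else 0) *
      (\<Prod>i\<le>N. x i ^ Poly_Mapping.lookup \<alpha> i))" for x
  proof -
    have "(\<Prod>j\<le>N. x j ^ Poly_Mapping.lookup (T \<alpha>) j) =
        x i * (\<Prod>j\<le>N. x j ^ Poly_Mapping.lookup \<alpha> j)" for \<alpha>
    proof -
      have "(\<Prod>j\<le>N. x j ^ (if j = i then 1 else 0)) = (\<Prod>j\<le>N. if j = i then x j else 1)"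
        by (intro prod.cong) auto
      also have "\<dots> = x i" using var.hyps(2) by simp
      finally show ?thesis by (simp add: T power_add prod.distrib)
    qed
    then show ?thesis
      using A(5)[of x] by (simp add: sum.reindex[OF inj_on_subset[OF inj]] inv_f_f[OF inj] sum_distrib_left algebra_simps)
  qed
  ultimately have "expansion N (Suc k) (\<lambda>x. x i * g x) (T ` A) (\<lambda>\<alpha>. if \<alpha> \<in> T ` A then c (inv_into UNIV T \<alpha>) else 0)"
    using A(1) by (simp add: expansion_def)
  then show ?case by blast
next
  case (add k g h)
  then obtain A c B b where e: "expansion N k g A c" "expansion N k h B b" by blast
  note A = expansionD[OF e(1)] and B = expansionD[OF e(2)]
  have "g x + h x = (\<Sum>\<alpha>\<in>A \<union> B. (c \<alpha> + b \<alpha>) * (\<Prod>i\<le>N. x i ^ Poly_Mapping.lookup \<alpha> i))" for x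
  proof -
    let ?m = "\<lambda>\<alpha>. \<Prod>i\<le>N. x i ^ Poly_Mapping.lookup \<alpha> i"
    have "g x = (\<Sum>\<alpha>\<in>A \<union> B. c \<alpha> * ?m \<alpha>)"
      unfolding A(5) by (rule sum.mono_neutral_left) (use A B in auto)
    moreover have "h x = (\<Sum>\<alpha>\<in>A \<union> B. b \<alpha> * ?m \<alpha>)"
      unfolding B(5) by (rule sum.mono_neutral_left) (use A B in auto)
    ultimately show ?thesis by (simp add: sum.distrib distrib_right)
  qed
  moreover have "\<forall>\<alpha>\<in>A \<union> B. Poly_Mapping.keys \<alpha> \<subseteq> {..N} \<and> (\<Sum>i\<le>N. Poly_Mapping.lookup \<alpha> i) = k"
    using A(2,3) B(2,3) by blast
  ultimately have "expansion N k (\<lambda>x. g x + h x) (A \<union> B) (\<lambda>\<alpha>. c \<alpha> + b \<alpha>)"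
    unfolding expansion_def using A(1,4) B(1,4) by simp
  then show ?case by blast
qed

lemma poly_of_hpoly:
  assumes "hpoly N k g"
  obtains f where "homogeneous_poly N f" "\<And>v. poly_value N f v = g (\<lambda>i. v $ i)"
proof -
  obtain A c where e: "expansion N k g A c" using ex_expansion[OF assms] by blast
  note A = expansionD[OF e]
  define f where "f = Abs_poly_mapping c"
  have "{\<alpha>. c \<alpha> \<noteq> 0} \<subseteq> A" using A(4) by blast
  then have "finite {\<alpha>. c \<alpha> \<noteq> 0}" by (rule finite_subset[OF _ A(1)])
  then have f: "Poly_Mapping.lookup f = c" by (simp add: f_def)
  have keys: "Poly_Mapping.keys f \<subseteq> A"
  proof
    fix \<alpha> assume "\<alpha> \<in> Poly_Mapping.keys f"
    then have "c \<alpha> \<noteq> 0" by (simp add: in_keys_iff f)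
    then show "\<alpha> \<in> A" using A(4) by blast
  qed
  show ?thesis
  proof (rule that)
    have "\<forall>\<alpha>\<in>Poly_Mapping.keys f. Poly_Mapping.keys \<alpha> \<subseteq> {..N} \<and> (\<Sum>i\<le>N. Poly_Mapping.lookup \<alpha> i) = k"
      using A(2,3) keys by blast
    then show "homogeneous_poly N f" unfolding homogeneous_poly_def by (rule exI)
    fix v
    show "poly_value N f v = g (\<lambda>i. v $ i)"
      unfolding poly_value_def A(5) f
    proof (rule sum.mono_neutral_left[OF A(1) keys], rule ballI)
      fix \<alpha> assume "\<alpha> \<in> A - Poly_Mapping.keys f"
      then have "c \<alpha> = 0" by (simp add: in_keys_iff f)
      then show "c \<alpha> * (\<Prod>i\<le>N. v $ i ^ Poly_Mapping.lookup \<alpha> i) = 0" by simp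
    qed
  qed
qed

text \<open>A gradient through the chain rule along all complex curves passing through
  \<open>x\<close>. Differentials of composites are then compared by uniqueness of the derivative,
  without partial derivatives.\<close>

definition is_grad :: "nat \<Rightarrow> ((nat \<Rightarrow> complex) \<Rightarrow> complex) \<Rightarrow> (nat \<Rightarrow> complex) \<Rightarrow> (nat \<Rightarrow> complex) \<Rightarrow> bool" where
  "is_grad N g x p \<longleftrightarrow> (\<forall>\<gamma> w. \<gamma> 0 = x \<longrightarrow>
     (\<forall>i\<le>N. ((\<lambda>s. \<gamma> s i) has_field_derivative w i) (at 0)) \<longrightarrow>
     ((\<lambda>s. g (\<gamma> s)) has_field_derivative (\<Sum>i\<le>N. p i * w i)) (at (0::complex)))"

lemma ex_grad: "hpoly N k g \<Longrightarrow> \<exists>p. is_grad N g x p"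
proof (induction rule: hpoly.induct)
  case (const c)
  show ?case by (rule exI[of _ "\<lambda>_. 0"]) (simp add: is_grad_def)
next
  case (var k g i)
  then obtain p where p: "is_grad N g x p" by blast
  show ?case
  \<comment> \<open>The product rule: \<open>g x\<close> times the \<open>i\<close>-th unit vector
    plus \<open>x i\<close> times the gradient of \<open>g\<close>.\<close>
  proof (rule exI[of _ "\<lambda>j. (if j = i then g x else 0) + x i * p j"], unfold is_grad_def, intro allI impI)
    fix \<gamma> w assume \<gamma>: "\<gamma> 0 = x" "\<forall>i\<le>N. ((\<lambda>s. \<gamma> s i) has_field_derivative w i) (at (0::complex))"
    have "((\<lambda>s. g (\<gamma> s)) has_field_derivative (\<Sum>i\<le>N. p i * w i)) (at 0)"
      using p \<gamma> by (simp add: is_grad_def)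
    from DERIV_mult[OF \<gamma>(2)[rule_format, OF var.hyps(2)] this]
    have "((\<lambda>s. \<gamma> s i * g (\<gamma> s)) has_field_derivative (w i * g x + (\<Sum>i\<le>N. p i * w i) * x i)) (at 0)"
      by (simp add: \<gamma>(1))
    also have "w i * g x + (\<Sum>i\<le>N. p i * w i) * x i =
        (\<Sum>j\<le>N. (if j = i then g x else 0) * w j) + (\<Sum>j\<le>N. x i * p j * w j)"
    proof -
      have "(\<Sum>j\<le>N. (if j = i then g x else 0) * w j) = w i * g x"
        using var.hyps(2) by (simp add: if_distrib if_distribR cong: if_cong)
      moreover have "(\<Sum>j\<le>N. x i * p j * w j) = (\<Sum>i\<le>N. p i * w i) * x i"
        by (subst sum_distrib_right) (simp add: mult_ac)
      ultimately show ?thesis by simp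
    qed
    also have "\<dots> = (\<Sum>j\<le>N. ((if j = i then g x else 0) + x i * p j) * w j)"
      by (simp only: distrib_right sum.distrib)
    finally show "((\<lambda>s. \<gamma> s i * g (\<gamma> s)) has_field_derivative
        (\<Sum>j\<le>N. ((if j = i then g x else 0) + x i * p j) * w j)) (at 0)" .
  qed
next
  case (add k g h)
  then obtain p q where "is_grad N g x p" "is_grad N h x q" by blast
  then have "is_grad N (\<lambda>x. g x + h x) x (\<lambda>i. p i + q i)"
    unfolding is_grad_def by (auto simp: distrib_right sum.distrib intro!: DERIV_add)
  then show ?case by blast
qed

text \<open>The Lie algebra of the linear group preserving a cone, as matrices whose linear vector field is
  annihilated on the cone by the differentials of all homogeneous equations of the cone.\<close>

definition lie :: "nat \<Rightarrow> nat \<Rightarrow> (nat \<Rightarrow> complex) set \<Rightarrow> (nat \<times> nat \<Rightarrow> complex) set" where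
  "lie N n X = {D \<in> supp_on (sq n). \<forall>k. \<forall>g. hpoly N k g \<longrightarrow> (\<forall>v\<in>X. g v = 0) \<longrightarrow>
     (\<forall>v\<in>X. \<forall>p. is_grad N g v p \<longrightarrow> (\<Sum>i\<le>N. p i * app n D v i) = 0)}"

lemma lie_supp: "lie N n X \<subseteq> supp_on (sq n)"
  by (auto simp: lie_def)

lemma subspace_lie: "fs.subspace (lie N n X)"
proof -
  have "(\<Sum>i\<le>N. p i * (c * app n D v i)) = c * (\<Sum>i\<le>N. p i * app n D v i)" for p c D v
    by (simp add: sum_distrib_left algebra_simps)
  then show ?thesis
    unfolding subspace_iff
    by (auto simp: lie_def supp_on_def app_add_left app_cmult_left distrib_left sum.distrib)
      (auto simp: app_def)
qed

text \<open>An equation \<open>g\<close> of \<open>Y\<close> pulls back along \<open>Q\<close> to an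
  equation of \<open>X\<close>. Since \<open>Q\<close> maps the line u + s D u to the line v + s (Q
  D R) v, where v = Q u, both gradients give the derivative at 0 of the same function of s.\<close>

lemma lie_transport:
  assumes n: "n \<le> Suc N" and X: "X \<subseteq> supp_on {..<n}" and Y: "Y \<subseteq> supp_on {..<n}"
    and Q: "Q \<in> supp_on (sq n)" and R: "R \<in> supp_on (sq n)" and QR: "mm n Q R = idm n"
    and XY: "\<And>v. v \<in> X \<Longrightarrow> app n Q v \<in> Y" and YX: "\<And>v. v \<in> Y \<Longrightarrow> app n R v \<in> X"
    and D: "D \<in> lie N n X"
  shows "conj_by n Q R D \<in> lie N n Y"
  unfolding lie_def
proof (intro CollectI conjI allI ballI impI)
  show "conj_by n Q R D \<in> supp_on (sq n)" using conj_by_supp[OF Q R] D by (simp add: lie_def)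
  fix k g v p
  assume g: "hpoly N k g" "\<forall>v\<in>Y. g v = 0" and v: "v \<in> Y" and p: "is_grad N g v p"
  define u where "u = app n R v"
  have u: "u \<in> X" using YX v by (simp add: u_def)
  have Qu: "app n Q u = v" using v Y QR by (auto simp: u_def app_idm simp flip: app_mm)
  have g': "hpoly N k (\<lambda>x. g (app n Q x))" by (rule hpoly_app[OF g(1) n])
  then obtain q where q: "is_grad N (\<lambda>x. g (app n Q x)) u q" using ex_grad by blast
  have "(\<Sum>i\<le>N. q i * app n D u i) = 0"
    using D g' g(2) XY u q unfolding lie_def by blast
  moreover have "((\<lambda>s. g (app n Q (\<lambda>i. u i + s * app n D u i))) has_field_derivative
      (\<Sum>i\<le>N. q i * app n D u i)) (at 0)"
    by (rule q[unfolded is_grad_def, rule_format]) (auto intro!: derivative_eq_intros)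
  moreover have "((\<lambda>s. g (\<lambda>i. v i + s * app n (conj_by n Q R D) v i)) has_field_derivative
      (\<Sum>i\<le>N. p i * app n (conj_by n Q R D) v i)) (at 0)"
    by (rule p[unfolded is_grad_def, rule_format]) (auto intro!: derivative_eq_intros)
  moreover have "app n Q (\<lambda>i. u i + s * app n D u i) = (\<lambda>i. v i + s * app n (conj_by n Q R D) v i)" for s
    by (simp only: app_add app_cmult Qu) (simp add: conj_by_def app_mm u_def)
  ultimately show "(\<Sum>i\<le>N. p i * app n (conj_by n Q R D) v i) = 0"
    by (auto dest: DERIV_unique)
qed

section \<open>Diagonal matrices and the Lie algebra of a cone\<close>

definition diagm :: "nat \<Rightarrow> (nat \<Rightarrow> complex) \<Rightarrow> nat \<times> nat \<Rightarrow> complex" where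
  "diagm n h = (\<lambda>(i, j). if i = j \<and> i < n then h i else 0)"

lemma app_diagm: "app n (diagm n h) v = (\<lambda>i. if i < n then h i * v i else 0)"
proof
  fix i
  show "app n (diagm n h) v i = (if i < n then h i * v i else 0)"
    by (cases "i < n") (auto simp: app_def diagm_def if_distrib if_distribR cong: if_cong)
qed

lemma diagm_supp: "diagm n h \<in> supp_on (sq n)"
  by (auto simp: diagm_def supp_on_def)

lemma mm_diagm_left: "mm n (diagm n h) D = (\<lambda>(i, j). if i < n then h i * D (i, j) else 0)"
proof (rule ext, clarify)
  fix i j
  show "mm n (diagm n h) D (i, j) = (if i < n then h i * D (i, j) else 0)"
    by (cases "i < n") (auto simp: mm_def diagm_def if_distrib if_distribR cong: if_cong)
qed

lemma mm_diagm_right: "mm n D (diagm n h) = (\<lambda>(i, j). if j < n then D (i, j) * h j else 0)"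
proof (rule ext, clarify)
  fix i j
  show "mm n D (diagm n h) (i, j) = (if j < n then D (i, j) * h j else 0)"
    by (cases "j < n") (auto simp: mm_def diagm_def if_distrib if_distribR cong: if_cong)
qed

text \<open>Conjugation by the exponential of diag \<nu>, which preserves the cone, multiplies the
  entry (i, j) by exp(\<nu> i - \<nu> j). In this form the grading of the Lie algebra is
  used.\<close>

lemma lie_stable:
  fixes \<nu> :: "nat \<Rightarrow> real"
  assumes n: "n \<le> Suc N" and X: "X \<subseteq> supp_on {..<n}"
    and act: "\<And>v s. v \<in> X \<Longrightarrow> (\<lambda>i. exp (s * of_real (\<nu> i)) * v i) \<in> X"
    and D: "D \<in> lie N n X"
  shows "(\<lambda>x. of_real (exp ((\<lambda>(i, j). \<nu> i - \<nu> j) x)) * D x) \<in> lie N n X"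
proof -
  define E where "E s = diagm n (\<lambda>i. exp (s * of_real (\<nu> i)))" for s :: complex
  have E: "E s \<in> supp_on (sq n)" for s by (simp add: E_def diagm_supp)
  have mapX: "app n (E s) v \<in> X" if "v \<in> X" for v s
  proof -
    have "app n (E s) v i = exp (s * of_real (\<nu> i)) * v i" for i
      using X that by (cases "i < n") (auto simp: E_def app_diagm supp_on_def)
    then have "app n (E s) v = (\<lambda>i. exp (s * of_real (\<nu> i)) * v i)" by blast
    then show ?thesis using act that by simp
  qed
  have "mm n (E 1) (E (-1)) = idm n"
    by (auto simp: E_def mm_diagm_left idm_def fun_eq_iff) (auto simp: diagm_def simp flip: exp_add)
  then have "conj_by n (E 1) (E (-1)) D \<in> lie N n X"
    by (rule lie_transport[OF n X X E E _ mapX mapX D])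
  also have "conj_by n (E 1) (E (-1)) D = (\<lambda>x. of_real (exp ((\<lambda>(i, j). \<nu> i - \<nu> j) x)) * D x)"
  proof
    fix x :: "nat \<times> nat"
    obtain i j where x: "x = (i, j)" by force
    show "conj_by n (E 1) (E (-1)) D x = of_real (exp ((\<lambda>(i, j). \<nu> i - \<nu> j) x)) * D x"
      unfolding x using D by (cases "i < n \<and> j < n")
        (auto simp: conj_by_def E_def mm_diagm_left mm_diagm_right lie_def supp_on_def exp_diff
          exp_minus field_simps simp flip: exp_of_real)
  qed
  finally show ?thesis .
qed

text \<open>The curve s -> exp(s h) v stays in the cone, so every equation of the cone is zero along
  it; its derivative at 0 is the differential applied to the vector field of
  \<open>diagm n h\<close>.\<close>

lemma diag_mem_lie:
  assumes n: "n \<le> Suc N" and X: "X \<subseteq> supp_on {..<n}"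
    and act: "\<And>v s. v \<in> X \<Longrightarrow> (\<lambda>i. exp (s * h i) * v i) \<in> X"
  shows "diagm n h \<in> lie N n X"
  unfolding lie_def
proof (intro CollectI conjI allI ballI impI)
  show "diagm n h \<in> supp_on (sq n)" by (rule diagm_supp)
  fix k g v p
  assume g: "hpoly N k g" "\<forall>v\<in>X. g v = 0" and v: "v \<in> X" and p: "is_grad N g v p"
  have "((\<lambda>s. g (\<lambda>i. exp (s * h i) * v i)) has_field_derivative
      (\<Sum>i\<le>N. p i * app n (diagm n h) v i)) (at 0)"
    using v X by (intro p[unfolded is_grad_def, rule_format])
      (auto simp: app_diagm supp_on_def intro!: derivative_eq_intros)
  moreover have "(\<lambda>s. g (\<lambda>i. exp (s * h i) * v i)) = (\<lambda>s. 0)"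
    using g act v by auto
  ultimately show "(\<Sum>i\<le>N. p i * app n (diagm n h) v i) = 0"
    using DERIV_unique[OF _ DERIV_const] by metis
qed

definition ones :: "nat \<Rightarrow> nat \<Rightarrow> complex" where
  "ones n = (\<lambda>i. if i < n then 1 else 0)"

text \<open>The binomial is differentiated along s -> exp(s h), starting at the point with all
  coordinates 1. It becomes exp(s a) - exp(s b), with derivative a - b at 0, and a - b is the
  asserted sum.\<close>

lemma lie_diag_relation:
  fixes c :: "nat \<Rightarrow> int"
  assumes n: "n \<le> Suc N" and X: "ones n \<in> X" and c: "(\<Sum>i<n. c i) = 0"
    and binom: "\<And>v. v \<in> X \<Longrightarrow> (\<Prod>i<n. v i ^ nat (c i)) = (\<Prod>i<n. v i ^ nat (- c i))"
    and D: "diagm n h \<in> lie N n X"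
  shows "(\<Sum>i<n. of_int (c i) * h i) = 0"
proof -
  \<comment> \<open>The positive and negative parts of \<open>c\<close> are the exponents of two
    monomials, of equal degree because the \<open>c i\<close> sum to 0.\<close>
  define g where "g x = (\<Prod>i<n. x i ^ nat (c i)) + (-1) * (\<Prod>i<n. x i ^ nat (- c i))" for x :: "nat \<Rightarrow> complex"
  have "(\<Sum>i<n. int (nat (c i))) - (\<Sum>i<n. int (nat (- c i))) = (\<Sum>i<n. c i)"
    unfolding sum_subtractf[symmetric] by (intro sum.cong) auto
  then have "int (\<Sum>i<n. nat (c i)) = int (\<Sum>i<n. nat (- c i))"
    using c by simp
  then have deg: "(\<Sum>i<n. nat (c i)) = (\<Sum>i<n. nat (- c i))" by (simp only: of_nat_eq_iff)
  have "{..<n} \<subseteq> {..N}" using n by auto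
  from hpoly_monom[OF this, of "\<lambda>i. nat (c i)"] hpoly_monom[OF this, of "\<lambda>i. nat (- c i)"]
  have g: "hpoly N (\<Sum>i<n. nat (c i)) g"
    unfolding g_def deg by (intro hpoly.add hpoly_cmult)
  moreover have "\<forall>v\<in>X. g v = 0" using binom by (simp add: g_def)
  moreover obtain p where p: "is_grad N g (ones n) p" using ex_grad[OF g] by blast
  ultimately have "(\<Sum>i\<le>N. p i * app n (diagm n h) (ones n) i) = 0"
    using D X unfolding lie_def by blast
  moreover have "((\<lambda>s. g (\<lambda>i. exp (s * h i) * ones n i)) has_field_derivative
      (\<Sum>i\<le>N. p i * app n (diagm n h) (ones n) i)) (at 0)"
    by (intro p[unfolded is_grad_def, rule_format])
      (auto simp: app_diagm ones_def intro!: derivative_eq_intros)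
  moreover have "(\<lambda>s. g (\<lambda>i. exp (s * h i) * ones n i)) =
      (\<lambda>s. exp (s * (\<Sum>i<n. of_nat (nat (c i)) * h i)) - exp (s * (\<Sum>i<n. of_nat (nat (- c i)) * h i)))"
    by (simp add: g_def ones_def exp_sum sum_distrib_left flip: exp_of_nat_mult)
      (simp add: mult_ac)
  ultimately have *: "((\<lambda>s. exp (s * (\<Sum>i<n. of_nat (nat (c i)) * h i)) -
      exp (s * (\<Sum>i<n. of_nat (nat (- c i)) * h i))) has_field_derivative 0) (at 0)"
    by simp
  have exp: "((\<lambda>s. exp (s * a) - exp (s * b)) has_field_derivative a - b) (at 0)" for a b :: complex
    by (auto intro!: derivative_eq_intros)
  have "(\<Sum>i<n. of_nat (nat (c i)) * h i) - (\<Sum>i<n. of_nat (nat (- c i)) * h i) = 0"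
    by (rule DERIV_unique[OF exp *])
  moreover have "of_int (c i) * h i = of_nat (nat (c i)) * h i - of_nat (nat (- c i)) * h i" for i
    by (cases "c i \<ge> 0") auto
  ultimately show ?thesis by (simp add: sum_subtractf)
qed

subsection \<open>Lattice polytopes and affine maps\<close>

lemma carrier_GL:
  "A \<in> carrier (GL TYPE('a::comm_ring_1) n) \<longleftrightarrow>
    A \<in> carrier_mat n n \<and> (\<exists>B\<in>carrier_mat n n. A * B = 1\<^sub>m n \<and> B * A = 1\<^sub>m n)"
  by (auto simp: GL_def units_of_def Units_def ring_mat_def)

lemma sum_pick_difference:
  fixes f :: "nat \<Rightarrow> int"
  assumes "p < n" "q < n"
  shows "(\<Sum>i<n. ((if i = p then 1 else 0) - (if i = q then 1 else 0)) * f i) = f p - f q"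
proof -
  have "(\<Sum>i<n. (if i = p then 1 else 0) * f i) = f p" if "p < n" for p
  proof -
    have "(\<Sum>i<n. (if i = p then 1 else 0) * f i) = (\<Sum>i<n. if i = p then f i else 0)"
      by (intro sum.cong) auto
    then show ?thesis using that by simp
  qed
  then show ?thesis using assms by (simp only: left_diff_distrib sum_subtractf)
qed

text \<open>The coefficients of a difference sum to 0, and this persists under sums and inverses.
  Such combinations do not see the translation part of an affine map.\<close>

lemma generated_combination:
  assumes S: "set ms \<subseteq> carrier_vec d"
    and z: "z \<in> generate (monoid_vec TYPE(int) d) {m - m' | m m'. m \<in> set ms \<and> m' \<in> set ms}"
  shows "\<exists>c::nat \<Rightarrow> int. (\<Sum>i<length ms. c i) = 0 \<and> (\<forall>k<d. (\<Sum>i<length ms. c i * ms ! i $ k) = z $ k)"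
proof -
  let ?n = "length ms"
  interpret comm_group "monoid_vec TYPE(int) d" by (rule comm_group_vec)
  have diff: "\<exists>c::nat \<Rightarrow> int. (\<Sum>i<?n. c i) = 0 \<and> (\<forall>k<d. (\<Sum>i<?n. c i * ms ! i $ k) = (m - m') $ k)"
    if m: "m \<in> set ms" "m' \<in> set ms" for m m'
  proof -
    obtain p q where pq: "p < ?n" "ms ! p = m" "q < ?n" "ms ! q = m'"
      using m by (metis in_set_conv_nth)
    have "m \<in> carrier_vec d" "m' \<in> carrier_vec d" using m S by blast+
    then have dim: "dim_vec m = d" "dim_vec m' = d" by simp_all
    let ?c = "\<lambda>i. (if i = p then 1 else 0) - (if i = q then 1 else 0) :: int"
    have "(\<Sum>i<?n. ?c i) = 0"
      using sum_pick_difference[OF pq(1,3), of "\<lambda>_. 1"] by simp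
    moreover have "\<forall>k<d. (\<Sum>i<?n. ?c i * ms ! i $ k) = (m - m') $ k"
      using dim by (simp add: sum_pick_difference[OF pq(1,3)] pq(2,4))
    ultimately show ?thesis by blast
  qed
  show ?thesis
    using z
  proof (induction rule: generate.induct)
    case one
    show ?case by (rule exI[of _ "\<lambda>_. 0"]) (simp add: monoid_vec_def)
  next
    case (incl h)
    then show ?case using diff by blast
  next
    case (inv h)
    then obtain m m' where m: "h = m - m'" "m \<in> set ms" "m' \<in> set ms" by blast
    then have car: "m \<in> carrier_vec d" "m' \<in> carrier_vec d" using S by auto
    have "m_inv (monoid_vec TYPE(int) d) h = m' - m"
    proof (rule inv_equality)
      show "(m' - m) \<otimes>\<^bsub>monoid_vec TYPE(int) d\<^esub> h = \<one>\<^bsub>monoid_vec TYPE(int) d\<^esub>"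
        using car by (auto simp: m(1) monoid_vec_def intro!: eq_vecI)
    qed (use car m(1) in \<open>auto simp: monoid_vec_def\<close>)
    then show ?case using diff[OF m(3,2)] by simp
  next
    case (eng h1 h2)
    then obtain c1 c2 :: "nat \<Rightarrow> int" where c: "(\<Sum>i<?n. c1 i) = 0" "\<forall>k<d. (\<Sum>i<?n. c1 i * ms ! i $ k) = h1 $ k"
      "(\<Sum>i<?n. c2 i) = 0" "\<forall>k<d. (\<Sum>i<?n. c2 i * ms ! i $ k) = h2 $ k" by blast
    have "{m - m' | m m'. m \<in> set ms \<and> m' \<in> set ms} \<subseteq> carrier (monoid_vec TYPE(int) d)"
      by (auto simp: monoid_vec_def dest!: subsetD[OF S])
    from generate_in_carrier[OF this eng.hyps(2)] have "dim_vec h2 = d"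
      by (auto simp: monoid_vec_def)
    then show ?case
      using c by (intro exI[of _ "\<lambda>i. c1 i + c2 i"]) (simp add: monoid_vec_def sum.distrib distrib_right)
  qed
qed

lemma affinely_generating_combination:
  assumes "affinely_generating d (set ms)" "set ms \<subseteq> carrier_vec d" "z \<in> carrier_vec d"
  obtains c :: "nat \<Rightarrow> int" where "(\<Sum>i<length ms. c i) = 0"
    "\<And>k. k < d \<Longrightarrow> (\<Sum>i<length ms. c i * ms ! i $ k) = z $ k"
  using generated_combination[OF assms(2), of z] assms(1,3) unfolding affinely_generating_def by blast

text \<open>Over a field a one-sided inverse of a square matrix is two-sided; the equation found
  over the reals comes back because the integers embed injectively.\<close>

lemma int_right_inverse_carrier_GL:
  assumes A: "A \<in> carrier_mat d d" and B: "B \<in> carrier_mat d d" and AB: "A * B = 1\<^sub>m d"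
  shows "A \<in> carrier (GL TYPE(int) d)"
proof -
  let ?h = "map_mat real_of_int"
  have "?h A * ?h B = 1\<^sub>m d"
    using of_int_hom.mat_hom_mult[OF A B, where ?'a = real] AB by (simp add: of_int_hom.mat_hom_one)
  then have "?h B * ?h A = 1\<^sub>m d"
    using A B by (intro mat_mult_left_right_inverse[of "?h A" d "?h B"]) auto
  then have "?h (B * A) = ?h (1\<^sub>m d)"
    using of_int_hom.mat_hom_mult[OF B A, where ?'a = real] by (simp add: of_int_hom.mat_hom_one)
  then have "B * A = 1\<^sub>m d" by (rule of_int_hom.mat_hom_inj)
  then show ?thesis unfolding carrier_GL using A B AB by blast
qed

text \<open>Sending a combination of the \<open>ms ! i\<close> with coefficient sum 0 to the same
  combination of the \<open>ms' ! (\<sigma> i)\<close> is well defined by \<open>rel\<close>, and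
  defined everywhere because \<open>ms\<close> generates. The resulting additive map has an integral
  matrix and is onto because \<open>ms'\<close> generates, which provides a right inverse.\<close>

lemma affine_map_of_relations:
  assumes ms: "set ms \<subseteq> carrier_vec d" "affinely_generating d (set ms)" "ms \<noteq> []"
    and ms': "set ms' \<subseteq> carrier_vec d" "affinely_generating d (set ms')" "length ms' = length ms"
    and \<sigma>: "bij_betw \<sigma> {..<length ms} {..<length ms}"
    and rel: "\<And>(c::nat \<Rightarrow> int) k. (\<Sum>i<length ms. c i) = 0 \<Longrightarrow>
      (\<And>k. k < d \<Longrightarrow> (\<Sum>i<length ms. c i * ms ! i $ k) = 0) \<Longrightarrow> k < d \<Longrightarrow>
      (\<Sum>i<length ms. c i * ms' ! (\<sigma> i) $ k) = 0"
  obtains A b where "A \<in> carrier (GL TYPE(int) d)" "b \<in> carrier_vec d"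
    "(\<lambda>m. A *\<^sub>v m + b) ` set ms = set ms'"
proof -
  let ?n = "length ms"
  have \<sigma>n: "\<sigma> i < ?n" if "i < ?n" for i using \<sigma> that by (auto dest: bij_betwE)
  have car: "ms ! i \<in> carrier_vec d" "ms' ! (\<sigma> i) \<in> carrier_vec d" if "i < ?n" for i
    using ms(1) ms'(1,3) \<sigma>n[OF that] that by auto
  have "\<exists>c::nat \<Rightarrow> int. (\<Sum>i<?n. c i) = 0 \<and> (\<forall>k<d. (\<Sum>i<?n. c i * ms ! i $ k) = (if k = j then 1 else 0))" for j
  proof -
    have "vec d (\<lambda>k. if k = j then 1 else 0) \<in> carrier_vec d" by simp
    from affinely_generating_combination[OF ms(2,1) this]
    obtain c where c: "(\<Sum>i<?n. c i) = 0"
      "\<And>k. k < d \<Longrightarrow> (\<Sum>i<?n. c i * ms ! i $ k) = vec d (\<lambda>k. if k = j then 1 else 0) $ k" by blast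
    then show ?thesis by (intro exI[of _ c]) simp
  qed
  \<comment> \<open>\<open>u j\<close> expresses the \<open>j\<close>-th basis vector; for j \<ge> d
    it expresses 0.\<close>
  then obtain u :: "nat \<Rightarrow> nat \<Rightarrow> int" where u: "\<And>j. (\<Sum>i<?n. u j i) = 0"
    "\<And>j k. k < d \<Longrightarrow> (\<Sum>i<?n. u j i * ms ! i $ k) = (if k = j then 1 else 0)" by metis
  define A where "A = mat d d (\<lambda>(k, j). \<Sum>i<?n. u j i * ms' ! (\<sigma> i) $ k)"
  have A: "A \<in> carrier_mat d d" by (simp add: A_def)
  have Av: "(A *\<^sub>v z) $ k = (\<Sum>i<?n. c i * ms' ! (\<sigma> i) $ k)"
    if z: "z \<in> carrier_vec d" and c: "(\<Sum>i<?n. c i) = 0"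
      "\<And>k. k < d \<Longrightarrow> (\<Sum>i<?n. c i * ms ! i $ k) = z $ k" and k: "k < d" for z c k
  proof -
    \<comment> \<open>The difference of two expressions for \<open>z\<close>, the given one and the
      one through the basis vectors. It is an affine relation, so \<open>rel\<close> applies to
      it.\<close>
    define e where "e i = c i - (\<Sum>j<d. z $ j * u j i)" for i
    have swap: "(\<Sum>i<?n. (\<Sum>j<d. z $ j * u j i) * f i) = (\<Sum>j<d. z $ j * (\<Sum>i<?n. u j i * f i))" for f
      by (simp add: sum_distrib_left sum_distrib_right mult.assoc) (rule sum.swap)
    have "(\<Sum>i<?n. e i) = 0"
      using swap[of "\<lambda>_. 1"] c(1) u(1) by (simp add: e_def sum_subtractf)
    moreover have "(\<Sum>i<?n. e i * ms ! i $ l) = 0" if l: "l < d" for l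
    proof -
      have "(\<Sum>j<d. z $ j * (\<Sum>i<?n. u j i * ms ! i $ l)) = z $ l"
        using l by (simp add: u(2) if_distrib cong: if_cong)
      then show ?thesis
        using c(2)[OF l] swap by (simp add: e_def left_diff_distrib sum_subtractf)
    qed
    ultimately have "(\<Sum>i<?n. e i * ms' ! (\<sigma> i) $ k) = 0" using rel k by blast
    then have "(\<Sum>i<?n. c i * ms' ! (\<sigma> i) $ k) = (\<Sum>j<d. z $ j * (\<Sum>i<?n. u j i * ms' ! (\<sigma> i) $ k))"
      using swap by (simp add: e_def left_diff_distrib sum_subtractf)
    also have "\<dots> = (A *\<^sub>v z) $ k"
      using z k by (auto simp: A_def scalar_prod_def atLeast0LessThan mult.commute intro!: sum.cong)
    finally show ?thesis by simp
  qed
  have "\<exists>z. z \<in> carrier_vec d \<and> A *\<^sub>v z = unit_vec d j" for j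
  proof -
    have "unit_vec d j \<in> carrier_vec d" by simp
    from affinely_generating_combination[OF ms'(2,1) this]
    obtain c where c: "(\<Sum>i<?n. c i) = 0"
      "\<And>k. k < d \<Longrightarrow> (\<Sum>i<?n. c i * ms' ! i $ k) = unit_vec d j $ k" unfolding ms'(3) by blast
    \<comment> \<open>The coefficients are reindexed by \<sigma>, so that \<open>A\<close> sends
      this combination to the one that gives the unit vector.\<close>
    define z where "z = vec d (\<lambda>k. \<Sum>i<?n. c (\<sigma> i) * ms ! i $ k)"
    have reindex: "(\<Sum>i<?n. f (\<sigma> i)) = (\<Sum>i<?n. f i)" for f :: "nat \<Rightarrow> int"
      by (rule sum.reindex_bij_betw[OF \<sigma>])
    have "(A *\<^sub>v z) $ k = unit_vec d j $ k" if k: "k < d" for k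
    proof -
      have "(A *\<^sub>v z) $ k = (\<Sum>i<?n. c (\<sigma> i) * ms' ! (\<sigma> i) $ k)"
        by (rule Av) (use k reindex[of c] c(1) in \<open>auto simp: z_def\<close>)
      also have "\<dots> = (\<Sum>i<?n. c i * ms' ! i $ k)"
        by (rule reindex[of "\<lambda>i. c i * ms' ! i $ k"])
      finally show ?thesis using c(2)[OF k] by simp
    qed
    then have "A *\<^sub>v z = unit_vec d j" using A by (intro eq_vecI) auto
    then show ?thesis by (intro exI[of _ z]) (simp add: z_def)
  qed
  then obtain w where w: "\<And>j. w j \<in> carrier_vec d" "\<And>j. A *\<^sub>v w j = unit_vec d j" by metis
  define B where "B = mat d d (\<lambda>(k, j). w j $ k)"
  have B: "B \<in> carrier_mat d d" by (simp add: B_def)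
  have "A * B = 1\<^sub>m d"
  proof (rule eq_matI)
    fix i j assume ij: "i < dim_row (1\<^sub>m d)" "j < dim_col (1\<^sub>m d)"
    have "col B j = w j" using ij w(1)[of j] by (intro eq_vecI) (auto simp: B_def)
    then have "(A * B) $$ (i, j) = (A *\<^sub>v w j) $ i" using A B ij by auto
    then show "(A * B) $$ (i, j) = 1\<^sub>m d $$ (i, j)" using w(2) ij by auto
  qed (use A B in auto)
  then have AGL: "A \<in> carrier (GL TYPE(int) d)" by (rule int_right_inverse_carrier_GL[OF A B])
  \<comment> \<open>The translation is fixed by the first point; the others follow by applying
    \<open>A\<close> to \<open>ms ! i - ms ! 0\<close>.\<close>
  define b where "b = ms' ! (\<sigma> 0) - A *\<^sub>v ms ! 0"
  have n0: "0 < ?n" using ms(3) by simp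
  have b: "b \<in> carrier_vec d" using A car[OF n0] by (simp add: b_def)
  have map: "A *\<^sub>v ms ! i + b = ms' ! (\<sigma> i)" if i: "i < ?n" for i
  proof (rule eq_vecI)
    fix k assume "k < dim_vec (ms' ! (\<sigma> i))"
    then have k: "k < d" using car[OF i] by simp
    have dims: "dim_vec (ms ! 0) = d" "dim_vec (ms' ! \<sigma> 0) = d" "dim_vec (ms ! i) = d"
      using car[OF n0] car[OF i] by auto
    have "(A *\<^sub>v (ms ! i - ms ! 0)) $ k =
        (\<Sum>l<?n. ((if l = i then 1 else 0) - (if l = 0 then 1 else 0)) * ms' ! (\<sigma> l) $ k)"
    proof (rule Av)
      show "ms ! i - ms ! 0 \<in> carrier_vec d" using car[OF n0] car[OF i] by simp
      show "(\<Sum>l<?n. (if l = i then 1 else 0) - (if l = 0 then 1 else 0)) = (0::int)"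
        using sum_pick_difference[OF i n0, of "\<lambda>_. 1"] by simp
      show "(\<Sum>l<?n. ((if l = i then 1 else 0) - (if l = 0 then 1 else 0)) * ms ! l $ q) =
          (ms ! i - ms ! 0) $ q" if "q < d" for q
        using that dims by (simp add: sum_pick_difference[OF i n0])
    qed (rule k)
    also have "\<dots> = ms' ! (\<sigma> i) $ k - ms' ! (\<sigma> 0) $ k"
      by (rule sum_pick_difference[OF i n0])
    also have "A *\<^sub>v (ms ! i - ms ! 0) = A *\<^sub>v ms ! i - A *\<^sub>v ms ! 0"
      using A car[OF i] car[OF n0] by (simp add: mult_minus_distrib_mat_vec)
    finally show "(A *\<^sub>v ms ! i + b) $ k = ms' ! (\<sigma> i) $ k"
      using A k dims by (simp add: b_def del: index_mult_mat_vec)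
  qed (use A b car[OF i] in auto)
  have "(\<lambda>m. A *\<^sub>v m + b) ` set ms = (\<lambda>i. ms' ! (\<sigma> i)) ` {..<?n}"
    using map by (auto simp: set_conv_nth image_iff) (metis)+
  also have "\<dots> = (\<lambda>i. ms' ! i) ` (\<sigma> ` {..<?n})" by (simp add: image_image)
  also have "\<dots> = set ms'" using \<sigma> ms'(3) by (auto simp: bij_betw_def set_conv_nth)
  finally show ?thesis using that AGL b by blast
qed

section \<open>Convex hulls and lattice points under integral affine maps\<close>

lemma convex_vecI:
  assumes "C \<subseteq> carrier_vec d"
    "\<And>x y u v. x \<in> C \<Longrightarrow> y \<in> C \<Longrightarrow> u \<ge> 0 \<Longrightarrow> v \<ge> 0 \<Longrightarrow> u + v = 1 \<Longrightarrow> u \<cdot>\<^sub>v x + v \<cdot>\<^sub>v y \<in> C"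
  shows "convex_vec d C"
  using assms by (auto simp: convex_vec_def)

lemma convex_vecD:
  "convex_vec d C \<Longrightarrow> x \<in> C \<Longrightarrow> y \<in> C \<Longrightarrow> u \<ge> 0 \<Longrightarrow> v \<ge> 0 \<Longrightarrow> u + v = 1 \<Longrightarrow> u \<cdot>\<^sub>v x + v \<cdot>\<^sub>v y \<in> C"
  by (auto simp: convex_vec_def)

lemma convex_vec_carrier: "convex_vec d (carrier_vec d)"
  by (auto simp: convex_vec_def)

text \<open>The carrier is itself a convex set containing \<open>V\<close>, so the hull is an
  intersection over a non-empty family and stays inside the carrier.\<close>

lemma convex_vec_hull:
  assumes "V \<subseteq> carrier_vec d"
  shows "convex_vec d (convex_vec d hull V)"
proof -
  have "convex_vec d hull V \<subseteq> carrier_vec d"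
    using assms by (rule hull_minimal) (rule convex_vec_carrier)
  moreover have "u \<cdot>\<^sub>v x + v \<cdot>\<^sub>v y \<in> convex_vec d hull V"
    if "x \<in> convex_vec d hull V" "y \<in> convex_vec d hull V" "u \<ge> 0" "v \<ge> 0" "u + v = 1" for x y u v
    using that unfolding hull_def convex_vec_def by blast
  ultimately show ?thesis unfolding convex_vec_def by blast
qed

definition affine_vec :: "int mat \<Rightarrow> int vec \<Rightarrow> real vec \<Rightarrow> real vec" where
  "affine_vec A b x = map_mat real_of_int A *\<^sub>v x + real_vec b"

lemma affine_vec_carrier:
  "A \<in> carrier_mat d d \<Longrightarrow> b \<in> carrier_vec d \<Longrightarrow> x \<in> carrier_vec d \<Longrightarrow> affine_vec A b x \<in> carrier_vec d"
  by (simp add: affine_vec_def real_vec_def)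

lemma affine_vec_convex_combination:
  assumes A: "A \<in> carrier_mat d d" and b: "b \<in> carrier_vec d"
    and x: "x \<in> carrier_vec d" "y \<in> carrier_vec d" and uv: "u + v = (1::real)"
  shows "affine_vec A b (u \<cdot>\<^sub>v x + v \<cdot>\<^sub>v y) = u \<cdot>\<^sub>v affine_vec A b x + v \<cdot>\<^sub>v affine_vec A b y"
proof -
  let ?A = "map_mat real_of_int A" and ?b = "real_vec b"
  have car: "?A \<in> carrier_mat d d" "?b \<in> carrier_vec d" using A b by (simp_all add: real_vec_def)
  have "?A *\<^sub>v (u \<cdot>\<^sub>v x + v \<cdot>\<^sub>v y) = u \<cdot>\<^sub>v (?A *\<^sub>v x) + v \<cdot>\<^sub>v (?A *\<^sub>v y)"
    using car x by (simp add: mult_add_distrib_mat_vec mult_mat_vec)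
  moreover have "?b $ k = u * ?b $ k + v * ?b $ k" for k
    using uv by (simp flip: distrib_right)
  ultimately show ?thesis
    unfolding affine_vec_def using car x
    by (intro eq_vecI) (auto simp: distrib_left simp del: index_mult_mat_vec)
qed

text \<open>Affine maps respect convex combinations: the preimage of the right side is convex and
  contains \<open>V\<close>, and the left side is convex and contains the image of
  \<open>V\<close>.\<close>

lemma affine_vec_hull:
  assumes A: "A \<in> carrier_mat d d" and b: "b \<in> carrier_vec d" and V: "V \<subseteq> carrier_vec d"
  shows "affine_vec A b ` (convex_vec d hull V) = convex_vec d hull (affine_vec A b ` V)"
proof
  have hullV: "convex_vec d hull V \<subseteq> carrier_vec d"
    using V by (rule hull_minimal) (rule convex_vec_carrier)
  have V': "affine_vec A b ` V \<subseteq> carrier_vec d" using V affine_vec_carrier[OF A b] by blast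
  show "affine_vec A b ` (convex_vec d hull V) \<subseteq> convex_vec d hull (affine_vec A b ` V)"
  proof -
    let ?C = "{x \<in> carrier_vec d. affine_vec A b x \<in> convex_vec d hull (affine_vec A b ` V)}"
    have "convex_vec d ?C"
      using convex_vec_hull[OF V'] affine_vec_convex_combination[OF A b]
      unfolding convex_vec_def by auto
    moreover have "V \<subseteq> ?C" using V hull_subset[of "affine_vec A b ` V"] by blast
    ultimately have "convex_vec d hull V \<subseteq> ?C" by (intro hull_minimal)
    then show ?thesis by blast
  qed
  show "convex_vec d hull (affine_vec A b ` V) \<subseteq> affine_vec A b ` (convex_vec d hull V)"
  proof (rule hull_minimal)
    show "affine_vec A b ` V \<subseteq> affine_vec A b ` (convex_vec d hull V)"
      by (intro image_mono hull_subset)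
    show "convex_vec d (affine_vec A b ` (convex_vec d hull V))"
    proof (rule convex_vecI)
      show "affine_vec A b ` (convex_vec d hull V) \<subseteq> carrier_vec d"
        using hullV affine_vec_carrier[OF A b] by blast
      fix p q u v
      assume pq: "p \<in> affine_vec A b ` (convex_vec d hull V)" "q \<in> affine_vec A b ` (convex_vec d hull V)"
        and uv: "u \<ge> 0" "v \<ge> 0" "u + v = (1::real)"
      then obtain x y where xy: "x \<in> convex_vec d hull V" "y \<in> convex_vec d hull V"
        "p = affine_vec A b x" "q = affine_vec A b y" by blast
      have "u \<cdot>\<^sub>v x + v \<cdot>\<^sub>v y \<in> convex_vec d hull V"
        by (rule convex_vecD[OF convex_vec_hull[OF V] xy(1,2) uv])
      moreover have "x \<in> carrier_vec d" "y \<in> carrier_vec d" using xy hullV by blast+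
      then have "u \<cdot>\<^sub>v p + v \<cdot>\<^sub>v q = affine_vec A b (u \<cdot>\<^sub>v x + v \<cdot>\<^sub>v y)"
        using affine_vec_convex_combination[OF A b _ _ uv(3)] xy(3,4) by simp
      ultimately show "u \<cdot>\<^sub>v p + v \<cdot>\<^sub>v q \<in> affine_vec A b ` (convex_vec d hull V)" by blast
    qed
  qed
qed

lemma affine_vec_real_vec:
  assumes "A \<in> carrier_mat d d" "b \<in> carrier_vec d" "m \<in> carrier_vec d"
  shows "affine_vec A b (real_vec m) = real_vec (A *\<^sub>v m + b)"
proof -
  have "map_mat real_of_int A *\<^sub>v map_vec real_of_int m = map_vec real_of_int (A *\<^sub>v m)"
    using of_int_hom.mult_mat_vec_hom[OF assms(1,3), where ?'a = real] by simp
  then show ?thesis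
    unfolding affine_vec_def real_vec_def using assms
    by (intro eq_vecI) (auto simp del: index_mult_mat_vec)
qed

text \<open>The points spanning \<open>P\<close> are lattice points of \<open>P\<close>. Hence an
  affine map matching the lattice points of two polytopes also matches the polytopes.\<close>

lemma lattice_polytope_hull:
  assumes "lattice_polytope d P"
  shows "P = convex_vec d hull (real_vec ` lattice_points d P)"
proof -
  obtain V where V: "V \<subseteq> carrier_vec d" "P = convex_vec d hull (real_vec ` V)"
    using assms by (auto simp: lattice_polytope_def)
  have sub: "real_vec ` V \<subseteq> P" unfolding V(2) by (rule hull_subset)
  have "V \<subseteq> lattice_points d P" using V(1) sub by (auto simp: lattice_points_def)
  then have "P \<subseteq> convex_vec d hull (real_vec ` lattice_points d P)"
    unfolding V(2) by (intro hull_mono image_mono)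
  moreover have "convex_vec d hull (real_vec ` lattice_points d P) \<subseteq> P"
  proof (rule hull_minimal)
    show "real_vec ` lattice_points d P \<subseteq> P" by (auto simp: lattice_points_def)
    show "convex_vec d P" unfolding V(2)
      by (rule convex_vec_hull) (use V(1) in \<open>auto simp: real_vec_def\<close>)
  qed
  ultimately show ?thesis by blast
qed

lemma lattice_points_nonempty:
  assumes "lattice_polytope d P"
  shows "lattice_points d P \<noteq> {}"
proof -
  obtain V where V: "V \<subseteq> carrier_vec d" "V \<noteq> {}" "P = convex_vec d hull (real_vec ` V)"
    using assms by (auto simp: lattice_polytope_def)
  have "real_vec ` V \<subseteq> P" unfolding V(3) by (rule hull_subset)
  then show ?thesis using V(1,2) by (auto simp: lattice_points_def)
qed

lemma lattice_polytope_carrier: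
  assumes "lattice_polytope d P"
  shows "P \<subseteq> carrier_vec d"
proof -
  obtain V where V: "V \<subseteq> carrier_vec d" "P = convex_vec d hull (real_vec ` V)"
    using assms by (auto simp: lattice_polytope_def)
  show ?thesis unfolding V(2)
    by (rule hull_minimal) (use V(1) convex_vec_carrier in \<open>auto simp: real_vec_def\<close>)
qed

lemma finite_lattice_points:
  assumes "lattice_polytope d P"
  shows "finite (lattice_points d P)"
proof -
  obtain V where V: "V \<subseteq> carrier_vec d" "finite V" "P = convex_vec d hull (real_vec ` V)"
    using assms by (auto simp: lattice_polytope_def)
  \<comment> \<open>This sum bounds every coordinate of every spanning point without a maximum over
    a possibly empty index set, as for \<open>d\<close> = 0. The box of this size is convex, so it
    contains \<open>P\<close>.\<close>
  define B :: int where "B = (\<Sum>m\<in>V. \<Sum>i<d. \<bar>m $ i\<bar>)"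
  have B: "\<bar>m $ i\<bar> \<le> B" if "m \<in> V" "i < d" for m i
  proof -
    have "\<bar>m $ i\<bar> \<le> (\<Sum>i<d. \<bar>m $ i\<bar>)" using that by (intro member_le_sum) auto
    also have "\<dots> \<le> B" unfolding B_def using that V(2) by (intro member_le_sum) (auto intro: sum_nonneg)
    finally show ?thesis .
  qed
  define C where "C = {x \<in> carrier_vec d. \<forall>i<d. \<bar>x $ i\<bar> \<le> real_of_int B}"
  have "convex_vec d C"
  proof (rule convex_vecI)
    show "C \<subseteq> carrier_vec d" by (auto simp: C_def)
    fix x y u v assume xy: "x \<in> C" "y \<in> C" and uv: "(u::real) \<ge> 0" "v \<ge> 0" "u + v = 1"
    have "\<bar>u * x $ i + v * y $ i\<bar> \<le> real_of_int B" if "i < d" for i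
    proof -
      have "\<bar>u * x $ i + v * y $ i\<bar> \<le> u * \<bar>x $ i\<bar> + v * \<bar>y $ i\<bar>"
        using uv by (intro order_trans[OF abs_triangle_ineq]) (simp add: abs_mult)
      also have "\<dots> \<le> u * real_of_int B + v * real_of_int B"
        using xy uv that by (intro add_mono mult_left_mono) (auto simp: C_def)
      also have "\<dots> = real_of_int B" using uv by (simp flip: distrib_right)
      finally show ?thesis .
    qed
    then show "u \<cdot>\<^sub>v x + v \<cdot>\<^sub>v y \<in> C" using xy by (auto simp: C_def)
  qed
  moreover have "real_vec ` V \<subseteq> C"
  proof clarify
    fix m assume m: "m \<in> V"
    have "\<bar>real_of_int (m $ i)\<bar> \<le> real_of_int B" if "i < d" for i
      using B[OF m that] by (metis of_int_abs of_int_le_iff)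
    then show "real_vec m \<in> C" using m V(1) by (auto simp: C_def real_vec_def)
  qed
  ultimately have PC: "P \<subseteq> C" unfolding V(3) by (intro hull_minimal)
  have "lattice_points d P \<subseteq> vec_of_list ` {xs. set xs \<subseteq> {- B..B} \<and> length xs = d}"
  proof
    fix m assume m: "m \<in> lattice_points d P"
    then have car: "m \<in> carrier_vec d" and "real_vec m \<in> C" using PC by (auto simp: lattice_points_def)
    have "m $ i \<in> {- B..B}" if "i < d" for i
    proof -
      have "\<bar>real_of_int (m $ i)\<bar> \<le> real_of_int B"
        using \<open>real_vec m \<in> C\<close> that car by (auto simp: C_def real_vec_def)
      then have "\<bar>m $ i\<bar> \<le> B" by (metis of_int_abs of_int_le_iff)
      then show ?thesis by auto
    qed
    then have "set (list_of_vec m) \<subseteq> {- B..B}" using car by (auto simp: set_list_of_vec vec_set_def)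
    then show "m \<in> vec_of_list ` {xs. set xs \<subseteq> {- B..B} \<and> length xs = d}"
      using car by (intro image_eqI[of _ _ "list_of_vec m"]) (auto simp: vec_list)
  qed
  then show ?thesis by (rule finite_subset) (intro finite_imageI finite_lists_length_eq finite_atLeastAtMost_int)
qed

text \<open>The inverse of \<open>A\<close> is integral, so a lattice point of the image comes from
  a lattice point of \<open>P\<close>.\<close>

lemma lattice_points_affine_image:
  assumes P: "P \<subseteq> carrier_vec d" and A: "A \<in> carrier (GL TYPE(int) d)" and b: "b \<in> carrier_vec d"
  shows "lattice_points d (affine_vec A b ` P) = (\<lambda>m. A *\<^sub>v m + b) ` lattice_points d P"
proof -
  obtain B where AB: "A \<in> carrier_mat d d" "B \<in> carrier_mat d d" "A * B = 1\<^sub>m d" "B * A = 1\<^sub>m d"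
    using A unfolding carrier_GL by blast
  show ?thesis
  proof (intro subset_antisym subsetI)
    fix m' assume "m' \<in> lattice_points d (affine_vec A b ` P)"
    then obtain x where m': "m' \<in> carrier_vec d" "x \<in> P" "real_vec m' = affine_vec A b x"
      by (auto simp: lattice_points_def)
    have x: "x \<in> carrier_vec d" using m' P by blast
    define m where "m = B *\<^sub>v (m' - b)"
    have mb: "m' - b \<in> carrier_vec d" using m'(1) b by simp
    have m: "m \<in> carrier_vec d" unfolding m_def by (rule mult_mat_vec_carrier[OF AB(2) mb])
    have "A *\<^sub>v m = (A * B) *\<^sub>v (m' - b)"
      unfolding m_def by (rule assoc_mult_mat_vec[symmetric, OF AB(1,2) mb])
    then have "A *\<^sub>v m = m' - b" using AB(3) mb by simp
    then have Am: "A *\<^sub>v m + b = m'" using m' b by auto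
    have "affine_vec A b (real_vec m) = affine_vec A b x"
      using affine_vec_real_vec[OF AB(1) b m] Am m'(3) by simp
    moreover have rm: "real_vec m \<in> carrier_vec d" using m by (simp add: real_vec_def)
    ultimately have eq: "map_mat real_of_int A *\<^sub>v real_vec m = map_mat real_of_int A *\<^sub>v x"
      unfolding affine_vec_def using AB(1) b x by (intro eq_vecI) (auto simp: vec_eq_iff real_vec_def)
    have BA: "map_mat real_of_int B * map_mat real_of_int A = 1\<^sub>m d"
      using of_int_hom.mat_hom_mult[OF AB(2,1), where ?'a = real] AB(4) by (simp add: of_int_hom.mat_hom_one)
    have "y = map_mat real_of_int B *\<^sub>v (map_mat real_of_int A *\<^sub>v y)" if "y \<in> carrier_vec d" for y
      using BA AB that by (simp flip: assoc_mult_mat_vec)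
    then have "real_vec m = x" using eq rm x by metis
    then have "m \<in> lattice_points d P" using m m'(2) by (simp add: lattice_points_def)
    then show "m' \<in> (\<lambda>m. A *\<^sub>v m + b) ` lattice_points d P" using Am by blast
  next
    fix m' assume "m' \<in> (\<lambda>m. A *\<^sub>v m + b) ` lattice_points d P"
    then obtain m where m: "m \<in> carrier_vec d" "real_vec m \<in> P" "m' = A *\<^sub>v m + b"
      by (auto simp: lattice_points_def)
    then show "m' \<in> lattice_points d (affine_vec A b ` P)"
      using affine_vec_real_vec[OF AB(1) b m(1)] AB(1) b by (force simp: lattice_points_def)
  qed
qed

subsection \<open>The cone over a projective toric variety\<close>

definition cone_points :: "nat \<Rightarrow> (nat \<Rightarrow> complex) set" where
  "cone_points N = supp_on {..<N + 1} - {\<lambda>_. 0}"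

definition pt :: "nat \<Rightarrow> (nat \<Rightarrow> complex) \<Rightarrow> complex vec set" where
  "pt N x = proj_point (vec (N + 1) x)"

definition mfn :: "nat \<Rightarrow> complex mat \<Rightarrow> nat \<times> nat \<Rightarrow> complex" where
  "mfn n A = (\<lambda>(i, j). if i < n \<and> j < n then A $$ (i, j) else 0)"

text \<open>The affine cone over the projective closure, without its vertex. It is stable under
  non-zero scalars even if \<open>Y\<close> is not, because the equations are homogeneous.\<close>

definition cone_closure :: "nat \<Rightarrow> (nat \<Rightarrow> complex) set \<Rightarrow> (nat \<Rightarrow> complex) set" where
  "cone_closure N Y = {x \<in> cone_points N. \<forall>k g. hpoly N k g \<longrightarrow> (\<forall>y\<in>Y. g y = 0) \<longrightarrow> g x = 0}"

lemma vec_inj_supp: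
  "x \<in> supp_on {..<n} \<Longrightarrow> y \<in> supp_on {..<n} \<Longrightarrow> vec n x = vec n y \<longleftrightarrow> x = y"
  by (auto simp: vec_eq_iff supp_on_def fun_eq_iff) (metis index_vec)

lemma vec_surj_supp:
  assumes "v \<in> carrier_vec n"
  obtains x where "x \<in> supp_on {..<n}" "v = vec n x"
  by (rule that[of "\<lambda>i. if i < n then v $ i else 0"]) (use assms in \<open>auto simp: supp_on_def\<close>)

lemma mem_pt: "v \<in> pt N x \<longleftrightarrow> (\<exists>c. c \<noteq> 0 \<and> v = vec (N + 1) (\<lambda>i. c * x i))"
proof -
  have "c \<cdot>\<^sub>v vec (N + 1) x = vec (N + 1) (\<lambda>i. c * x i)" for c
    by auto
  then show ?thesis by (auto simp: pt_def proj_point_def)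
qed

lemma vec_mem_pt: "vec (N + 1) x \<in> pt N x"
  unfolding mem_pt by (rule exI[of _ 1]) simp

lemma pt_eqD:
  assumes "pt N x = pt N y" "x \<in> supp_on {..<N + 1}" "y \<in> supp_on {..<N + 1}"
  obtains c where "c \<noteq> 0" "x = (\<lambda>i. c * y i)"
proof -
  have "vec (N + 1) x \<in> pt N y" using vec_mem_pt assms(1) by blast
  then obtain c where c: "c \<noteq> 0" "vec (N + 1) x = vec (N + 1) (\<lambda>i. c * y i)"
    unfolding mem_pt by blast
  have "(\<lambda>i. c * y i) \<in> supp_on {..<N + 1}" using assms(3) by (simp add: supp_on_def)
  then show ?thesis using that c vec_inj_supp[OF assms(2)] by blast
qed

lemma proj_space_eq: "proj_space N = pt N ` cone_points N"
proof (intro subset_antisym subsetI)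
  fix p assume "p \<in> proj_space N"
  then obtain v where v: "v \<in> carrier_vec (N + 1)" "v \<noteq> 0\<^sub>v (N + 1)" "p = proj_point v"
    by (auto simp: proj_space_def)
  obtain x where x: "x \<in> supp_on {..<N + 1}" "v = vec (N + 1) x"
    using vec_surj_supp[OF v(1)] .
  have "x \<noteq> (\<lambda>_. 0)" using x v by auto
  then show "p \<in> pt N ` cone_points N" using x v by (auto simp: pt_def cone_points_def)
next
  fix p assume "p \<in> pt N ` cone_points N"
  then obtain x where x: "x \<in> supp_on {..<N + 1}" "x \<noteq> (\<lambda>_. 0)" "p = pt N x"
    by (auto simp: cone_points_def)
  have nz: "vec (N + 1) x \<noteq> vec (N + 1) (\<lambda>_. 0)"
    using x vec_inj_supp[OF x(1), of "\<lambda>_. 0"] by (simp add: supp_on_def)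
  have zero: "vec (N + 1) (\<lambda>_. 0::complex) = 0\<^sub>v (N + 1)" by auto
  have "vec (N + 1) x \<in> carrier_vec (N + 1) - {0\<^sub>v (N + 1)}"
    using nz vec_carrier[of "N + 1" x] unfolding zero by blast
  then show "p \<in> proj_space N" unfolding x(3) pt_def proj_space_def by (rule imageI)
qed

lemma hpoly_vec: "hpoly N k g \<Longrightarrow> g (\<lambda>i. vec (N + 1) x $ i) = g x"
  by (rule hpoly_cong) auto

text \<open>All homogeneous equations of \<open>Y\<close> together cut out the right side, which is
  therefore closed; any closed set containing the points of \<open>Y\<close> is cut out by some of
  these equations. Homogeneity makes vanishing independent of the representative.\<close>

lemma zariski_closure_pt:
  assumes Y: "Y \<subseteq> cone_points N"
  shows "zariski_closure N (pt N ` Y) = pt N ` cone_closure N Y"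
proof (rule subset_antisym)
  define F where "F = {f. homogeneous_poly N f \<and> (\<forall>y\<in>Y. poly_value N f (vec (N + 1) y) = 0)}"
  have "pt N ` cone_closure N Y = {p \<in> proj_space N. \<forall>f\<in>F. \<forall>v\<in>p. poly_value N f v = 0}"
  proof (intro subset_antisym subsetI)
    fix p assume "p \<in> pt N ` cone_closure N Y"
    then obtain x where x: "x \<in> cone_closure N Y" "p = pt N x" by blast
    have "poly_value N f v = 0" if f: "f \<in> F" and v: "v \<in> p" for f v
    proof -
      obtain k g where g: "hpoly N k g" "\<And>v. poly_value N f v = g (\<lambda>i. v $ i)"
        using hpoly_of_poly f unfolding F_def by blast
      have "\<forall>y\<in>Y. g y = 0"
        using f g(2) hpoly_vec[OF g(1)] unfolding F_def by auto
      then have "g x = 0" using x g(1) unfolding cone_closure_def by blast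
      moreover have "v \<in> pt N x" using v x(2) by simp
      then obtain c where "v = vec (N + 1) (\<lambda>i. c * x i)"
        unfolding mem_pt by blast
      ultimately show ?thesis using g(2) hpoly_vec[OF g(1)] hpoly_scale[OF g(1)] by simp
    qed
    then show "p \<in> {p \<in> proj_space N. \<forall>f\<in>F. \<forall>v\<in>p. poly_value N f v = 0}"
      using x by (auto simp: proj_space_eq cone_closure_def)
  next
    fix p assume p: "p \<in> {p \<in> proj_space N. \<forall>f\<in>F. \<forall>v\<in>p. poly_value N f v = 0}"
    then obtain x where x: "x \<in> cone_points N" "p = pt N x" by (auto simp: proj_space_eq)
    have "g x = 0" if g: "hpoly N k g" "\<forall>y\<in>Y. g y = 0" for k g
    proof -
      obtain f where f: "homogeneous_poly N f" "\<And>v. poly_value N f v = g (\<lambda>i. v $ i)"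
        using poly_of_hpoly[OF g(1)] by blast
      have "f \<in> F" using f g(2) hpoly_vec[OF g(1)] by (auto simp: F_def)
      then have "poly_value N f (vec (N + 1) x) = 0" using p x vec_mem_pt by auto
      then show ?thesis using f(2) hpoly_vec[OF g(1)] by simp
    qed
    then show "p \<in> pt N ` cone_closure N Y" using x by (auto simp: cone_closure_def)
  qed
  moreover have "\<forall>f\<in>F. homogeneous_poly N f" by (simp add: F_def)
  ultimately have "zariski_closed N (pt N ` cone_closure N Y)"
    unfolding zariski_closed_def by blast
  moreover have "Y \<subseteq> cone_closure N Y" using Y by (auto simp: cone_closure_def)
  ultimately show "zariski_closure N (pt N ` Y) \<subseteq> pt N ` cone_closure N Y"
    unfolding zariski_closure_def by (intro hull_minimal image_mono)
next
  show "pt N ` cone_closure N Y \<subseteq> zariski_closure N (pt N ` Y)"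
    unfolding zariski_closure_def hull_def
  proof (rule Inter_greatest, clarify)
    fix Z x assume Z: "zariski_closed N Z" "pt N ` Y \<subseteq> Z" and x: "x \<in> cone_closure N Y"
    obtain F where F: "\<forall>f\<in>F. homogeneous_poly N f"
      "Z = {p \<in> proj_space N. \<forall>f\<in>F. \<forall>v\<in>p. poly_value N f v = 0}"
      using Z(1) unfolding zariski_closed_def by blast
    have "poly_value N f v = 0" if f: "f \<in> F" and v: "v \<in> pt N x" for f v
    proof -
      obtain k g where g: "hpoly N k g" "\<And>v. poly_value N f v = g (\<lambda>i. v $ i)"
        using hpoly_of_poly F(1) f by blast
      have "g y = 0" if "y \<in> Y" for y
      proof -
        have "poly_value N f (vec (N + 1) y) = 0"
          using that Z(2) F(2) f vec_mem_pt by blast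
        then show ?thesis using g(2) hpoly_vec[OF g(1)] by simp
      qed
      then have "g x = 0" using x g(1) unfolding cone_closure_def by blast
      moreover obtain c where "v = vec (N + 1) (\<lambda>i. c * x i)"
        using v unfolding mem_pt by blast
      ultimately show ?thesis using g(2) hpoly_vec[OF g(1)] hpoly_scale[OF g(1)] by simp
    qed
    then show "pt N x \<in> Z" using x F(2) by (auto simp: proj_space_eq cone_closure_def)
  qed
qed

lemma cone_closure_scale:
  assumes "x \<in> cone_closure N Y" "c \<noteq> 0"
  shows "(\<lambda>i. c * x i) \<in> cone_closure N Y"
  using assms by (auto simp: cone_closure_def cone_points_def supp_on_def fun_eq_iff hpoly_scale)

lemma cone_closure_supp: "cone_closure N Y \<subseteq> supp_on {..<N + 1}"
  by (auto simp: cone_closure_def cone_points_def)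

text \<open>Equations of \<open>Y'\<close> pull back along \<open>a\<close> to equations of
  \<open>Y\<close>; the left inverse \<open>b\<close> keeps the image away from the zero
  vector.\<close>

lemma cone_closure_app:
  assumes a: "a \<in> supp_on (sq (N + 1))" and ba: "mm (N + 1) b a = idm (N + 1)"
    and YY': "\<And>y. y \<in> Y \<Longrightarrow> app (N + 1) a y \<in> Y'" and x: "x \<in> cone_closure N Y"
  shows "app (N + 1) a x \<in> cone_closure N Y'"
proof -
  have xs: "x \<in> supp_on {..<N + 1}" "x \<noteq> (\<lambda>_. 0)" using x by (auto simp: cone_closure_def cone_points_def)
  have "app (N + 1) b (app (N + 1) a x) = x" using ba xs by (simp add: app_idm flip: app_mm)
  moreover have "app (N + 1) b (\<lambda>_. 0) = (\<lambda>_. 0)" by (simp add: app_def)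
  ultimately have "app (N + 1) a x \<noteq> (\<lambda>_. 0)" using xs(2) by force
  moreover have "g (app (N + 1) a x) = 0" if "hpoly N k g" "\<forall>y\<in>Y'. g y = 0" for k g
  proof -
    have "hpoly N k (\<lambda>x. g (app (N + 1) a x))" using that by (intro hpoly_app) auto
    moreover have "\<forall>y\<in>Y. g (app (N + 1) a y) = 0" using that YY' by blast
    ultimately show ?thesis using x unfolding cone_closure_def by blast
  qed
  ultimately show ?thesis using app_supp[OF a] by (auto simp: cone_closure_def cone_points_def)
qed

section \<open>Matrices as functions and the action of PGL on points\<close>

lemma mfn_supp: "mfn n A \<in> supp_on (sq n)"
  by (auto simp: mfn_def supp_on_def)

lemma mult_mat_vec_fn: "A \<in> carrier_mat n n \<Longrightarrow> A *\<^sub>v vec n x = vec n (app n (mfn n A) x)"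
  by (rule eq_vecI) (auto simp: app_def mfn_def scalar_prod_def row_def atLeast0LessThan intro!: sum.cong)

lemma mfn_mult: "A \<in> carrier_mat n n \<Longrightarrow> B \<in> carrier_mat n n \<Longrightarrow> mfn n (A * B) = mm n (mfn n A) (mfn n B)"
  by (auto simp: fun_eq_iff mfn_def mm_def scalar_prod_def row_def atLeast0LessThan intro!: sum.cong)

lemma mfn_one: "mfn n (1\<^sub>m n) = idm n"
  by (auto simp: mfn_def idm_def fun_eq_iff)

lemma mfn_mat: "a \<in> supp_on (sq n) \<Longrightarrow> mfn n (mat n n a) = a"
  by (auto simp: mfn_def supp_on_def fun_eq_iff)

lemma mfn_inj:
  assumes "A \<in> carrier_mat n n" "B \<in> carrier_mat n n" "mfn n A = mfn n B"
  shows "A = B"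
proof (rule eq_matI)
  fix i j assume "i < dim_row B" "j < dim_col B"
  then have "i < n" "j < n" using assms by auto
  moreover have "mfn n A (i, j) = mfn n B (i, j)" using assms(3) by simp
  ultimately show "A $$ (i, j) = B $$ (i, j)" by (simp add: mfn_def)
qed (use assms in auto)

lemma PGL_class_eq:
  assumes "A \<in> carrier_mat n n"
  shows "PGL_class n A = {c \<cdot>\<^sub>m A | c. c \<noteq> 0}"
proof -
  have "c \<cdot>\<^sub>m 1\<^sub>m n * A = c \<cdot>\<^sub>m A" for c
    using mult_smult_assoc_mat[OF one_carrier_mat assms] assms by simp
  then show ?thesis
    by (auto simp: PGL_class_def r_coset_def GL_def units_of_def ring_mat_def scalar_matrices_def)
qed

lemma PGL_act_pt:
  assumes A: "A \<in> carrier_mat (N + 1) (N + 1)"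
  shows "PGL_act (PGL_class (N + 1) A) (pt N x) = pt N (app (N + 1) (mfn (N + 1) A) x)"
proof -
  have *: "(c \<cdot>\<^sub>m A) *\<^sub>v vec (N + 1) (\<lambda>i. b * x i) =
      vec (N + 1) (\<lambda>i. (c * b) * app (N + 1) (mfn (N + 1) A) x i)" for c b
  proof -
    have "mfn (N + 1) (c \<cdot>\<^sub>m A) = (\<lambda>x. c * mfn (N + 1) A x)"
      using A by (auto simp: mfn_def fun_eq_iff)
    then have "(c \<cdot>\<^sub>m A) *\<^sub>v vec (N + 1) (\<lambda>i. b * x i) =
        vec (N + 1) (\<lambda>i. c * (b * app (N + 1) (mfn (N + 1) A) x i))"
      using A by (simp add: mult_mat_vec_fn app_cmult_left app_cmult del: One_nat_def)
    then show ?thesis by (simp add: mult.assoc)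
  qed
  show ?thesis
  proof (intro subset_antisym subsetI)
    fix w assume "w \<in> PGL_act (PGL_class (N + 1) A) (pt N x)"
    then obtain c b where "c \<noteq> 0" "b \<noteq> 0" "w = (c \<cdot>\<^sub>m A) *\<^sub>v vec (N + 1) (\<lambda>i. b * x i)"
      unfolding PGL_act_def PGL_class_eq[OF A] mem_pt by blast
    then show "w \<in> pt N (app (N + 1) (mfn (N + 1) A) x)"
      unfolding mem_pt * by (intro exI[of _ "c * b"]) simp
  next
    fix w assume "w \<in> pt N (app (N + 1) (mfn (N + 1) A) x)"
    then obtain c where c: "c \<noteq> 0" "w = vec (N + 1) (\<lambda>i. c * app (N + 1) (mfn (N + 1) A) x i)"
      unfolding mem_pt by blast
    then have "w = (c \<cdot>\<^sub>m A) *\<^sub>v vec (N + 1) (\<lambda>i. 1 * x i)" unfolding * by simp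
    moreover have "c \<cdot>\<^sub>m A \<in> PGL_class (N + 1) A" unfolding PGL_class_eq[OF A] using c by blast
    moreover have "vec (N + 1) (\<lambda>i. 1 * x i) \<in> pt N x" using vec_mem_pt by simp
    ultimately show "w \<in> PGL_act (PGL_class (N + 1) A) (pt N x)" unfolding PGL_act_def by blast
  qed
qed

text \<open>Both sets are stable under non-zero scalars, so equality of the sets of points lifts to
  equality of the cones, for any representative of the class in PGL.\<close>

lemma projectively_equivalent_pt:
  assumes X: "X \<subseteq> supp_on {..<N + 1}" "\<And>x c. x \<in> X \<Longrightarrow> c \<noteq> 0 \<Longrightarrow> (\<lambda>i. c * x i) \<in> X"
    and X': "X' \<subseteq> supp_on {..<N + 1}" "\<And>x c. x \<in> X' \<Longrightarrow> c \<noteq> 0 \<Longrightarrow> (\<lambda>i. c * x i) \<in> X'"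
  shows "projectively_equivalent N (pt N ` X) (pt N ` X') \<longleftrightarrow>
    (\<exists>a\<in>supp_on (sq (N + 1)). \<exists>b\<in>supp_on (sq (N + 1)). mm (N + 1) a b = idm (N + 1) \<and>
      mm (N + 1) b a = idm (N + 1) \<and> app (N + 1) a ` X = X')"
proof
  assume "projectively_equivalent N (pt N ` X) (pt N ` X')"
  then obtain A where A: "A \<in> carrier (GL TYPE(complex) (N + 1))"
    and AX: "PGL_act (PGL_class (N + 1) A) ` pt N ` X = pt N ` X'"
    by (auto simp: projectively_equivalent_def PGL_def FactGroup_def RCOSETS_def PGL_class_def)
  obtain B where AB: "A \<in> carrier_mat (N + 1) (N + 1)" "B \<in> carrier_mat (N + 1) (N + 1)"
    "A * B = 1\<^sub>m (N + 1)" "B * A = 1\<^sub>m (N + 1)"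
    using A unfolding carrier_GL by blast
  define a where "a = mfn (N + 1) A"
  define b where "b = mfn (N + 1) B"
  have ab: "mm (N + 1) a b = idm (N + 1)" "mm (N + 1) b a = idm (N + 1)"
    unfolding a_def b_def using AB by (metis mfn_mult mfn_one)+
  have supp: "a \<in> supp_on (sq (N + 1))" "b \<in> supp_on (sq (N + 1))"
    by (simp_all only: a_def b_def mfn_supp)
  have pts: "pt N ` app (N + 1) a ` X = pt N ` X'"
    using AX unfolding image_image PGL_act_pt[OF AB(1)] a_def .
  have "app (N + 1) a ` X = X'"
  proof (intro subset_antisym subsetI)
    fix y assume y: "y \<in> app (N + 1) a ` X"
    then obtain x' where x': "x' \<in> X'" "pt N y = pt N x'" using pts by blast
    have "y \<in> supp_on {..<N + 1}" using y app_supp[OF supp(1)] by blast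
    then show "y \<in> X'" using pt_eqD[OF x'(2)] x'(1) X' by blast
  next
    fix y assume y: "y \<in> X'"
    then have "pt N y \<in> pt N ` app (N + 1) a ` X" using pts by blast
    then obtain x where x: "x \<in> X" "pt N y = pt N (app (N + 1) a x)" by blast
    obtain c where c: "c \<noteq> 0" "y = (\<lambda>i. c * app (N + 1) a x i)"
      using pt_eqD[OF x(2)] y X' app_supp[OF supp(1)] by blast
    then have "y = app (N + 1) a (\<lambda>i. c * x i)" by (simp add: app_cmult)
    then show "y \<in> app (N + 1) a ` X" using X(2)[OF x(1) c(1)] by blast
  qed
  then show "\<exists>a\<in>supp_on (sq (N + 1)). \<exists>b\<in>supp_on (sq (N + 1)). mm (N + 1) a b = idm (N + 1) \<and>
      mm (N + 1) b a = idm (N + 1) \<and> app (N + 1) a ` X = X'"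
    using ab supp by blast
next
  assume "\<exists>a\<in>supp_on (sq (N + 1)). \<exists>b\<in>supp_on (sq (N + 1)). mm (N + 1) a b = idm (N + 1) \<and>
      mm (N + 1) b a = idm (N + 1) \<and> app (N + 1) a ` X = X'"
  then obtain a b where ab: "a \<in> supp_on (sq (N + 1))" "b \<in> supp_on (sq (N + 1))"
    "mm (N + 1) a b = idm (N + 1)" "mm (N + 1) b a = idm (N + 1)" "app (N + 1) a ` X = X'" by blast
  define A where "A = mat (N + 1) (N + 1) a"
  define B where "B = mat (N + 1) (N + 1) b"
  have car: "A \<in> carrier_mat (N + 1) (N + 1)" "B \<in> carrier_mat (N + 1) (N + 1)"
    by (simp_all add: A_def B_def)
  have mfn: "mfn (N + 1) A = a" "mfn (N + 1) B = b"
    unfolding A_def B_def using ab by (simp_all only: mfn_mat)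
  have "A * B = 1\<^sub>m (N + 1)"
    by (rule mfn_inj[of _ "N + 1"]) (use car ab in \<open>simp_all only: mfn_mult mfn mfn_one mult_carrier_mat one_carrier_mat\<close>)
  moreover have "B * A = 1\<^sub>m (N + 1)"
    by (rule mfn_inj[of _ "N + 1"]) (use car ab in \<open>simp_all only: mfn_mult mfn mfn_one mult_carrier_mat one_carrier_mat\<close>)
  ultimately have "A \<in> carrier (GL TYPE(complex) (N + 1))" unfolding carrier_GL using car by blast
  then have "PGL_class (N + 1) A \<in> carrier (PGL (N + 1))"
    by (auto simp: PGL_def FactGroup_def RCOSETS_def PGL_class_def)
  moreover have "PGL_act (PGL_class (N + 1) A) ` pt N ` X = pt N ` X'"
    unfolding image_image PGL_act_pt[OF car(1)] mfn using ab(5) by (auto simp: image_image)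
  ultimately show "projectively_equivalent N (pt N ` X) (pt N ` X')"
    unfolding projectively_equivalent_def by blast
qed

section \<open>The torus orbit and its closure\<close>

definition torus_orbit :: "nat \<Rightarrow> int vec list \<Rightarrow> (nat \<Rightarrow> complex) set" where
  "torus_orbit d ms = (\<lambda>t i. if i < length ms then character d (ms ! i) t else 0) ` torus d"

lemma character_nonzero: "t \<in> torus d \<Longrightarrow> character d m t \<noteq> 0"
  by (auto simp: character_def torus_def)

lemma torus_orbit_subset:
  assumes "ms \<noteq> []" "length ms \<le> N + 1"
  shows "torus_orbit d ms \<subseteq> cone_points N"
proof
  fix x assume "x \<in> torus_orbit d ms"
  then obtain t where t: "t \<in> torus d" "x = (\<lambda>i. if i < length ms then character d (ms ! i) t else 0)"
    by (auto simp: torus_orbit_def)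
  have "x 0 \<noteq> 0" using t character_nonzero assms(1) by simp
  then have "x \<noteq> (\<lambda>_. 0)" by auto
  then show "x \<in> cone_points N" using t(2) assms(2) by (auto simp: cone_points_def supp_on_def)
qed

text \<open>The ones that pad the diagonal matrices meet zero coordinates of the base point, so the
  orbit is the image of the monomial map given by the characters.\<close>

lemma toric_variety_eq:
  assumes "ms \<noteq> []" "length ms \<le> N + 1"
  shows "toric_variety d N ms = pt N ` cone_closure N (torus_orbit d ms)"
proof -
  define f where "f t i = (if i < length ms then character d (ms ! i) t else 1)" for t i
  have "app (N + 1) (mfn (N + 1) (mat_diag (N + 1) (f t))) (\<lambda>i. if i < length ms then 1 else 0) =
      (\<lambda>i. if i < length ms then character d (ms ! i) t else 0)" for t
  proof -
    have "mfn (N + 1) (mat_diag (N + 1) (f t)) = diagm (N + 1) (f t)"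
      by (auto simp: mfn_def diagm_def mat_diag_def fun_eq_iff)
    then show ?thesis using assms(2) by (simp only: app_diagm) (auto simp: f_def)
  qed
  then have "PGL_act (PGL_class (N + 1) (mat_diag (N + 1) (f t))) (base_point N ms) =
      pt N (\<lambda>i. if i < length ms then character d (ms ! i) t else 0)" for t
    using PGL_act_pt[of "mat_diag (N + 1) (f t)" N "\<lambda>i. if i < length ms then 1 else 0"]
    unfolding base_point_def pt_def by (simp add: mat_diag_def)
  then have "(\<lambda>g. PGL_act g (base_point N ms)) ` torus_image d N ms = pt N ` torus_orbit d ms"
    unfolding torus_image_def torus_orbit_def f_def image_image by simp
  then show ?thesis
    unfolding toric_variety_def using zariski_closure_pt[OF torus_orbit_subset[OF assms]] by simp
qed

lemma projectively_equivalent_toric: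
  assumes "ms \<noteq> []" "length ms \<le> N + 1" "ms' \<noteq> []" "length ms' \<le> N + 1"
  shows "projectively_equivalent N (toric_variety d N ms) (toric_variety d N ms') \<longleftrightarrow>
    (\<exists>a\<in>supp_on (sq (N + 1)). \<exists>b\<in>supp_on (sq (N + 1)). mm (N + 1) a b = idm (N + 1) \<and>
      mm (N + 1) b a = idm (N + 1) \<and>
      app (N + 1) a ` cone_closure N (torus_orbit d ms) = cone_closure N (torus_orbit d ms'))"
  unfolding toric_variety_eq[OF assms(1,2)] toric_variety_eq[OF assms(3,4)]
  by (rule projectively_equivalent_pt[OF cone_closure_supp cone_closure_scale cone_closure_supp cone_closure_scale])

subsection \<open>From projective to affine equivalence\<close>

text \<open>By induction: a relation involving the last number would confine it to a countable set
  determined by the earlier numbers, and the reals are uncountable.\<close>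

lemma ex_rationally_independent:
  "\<exists>\<theta>::nat \<Rightarrow> real. \<forall>c::nat \<Rightarrow> int. (\<Sum>k<d. of_int (c k) * \<theta> k) = 0 \<longrightarrow> (\<forall>k<d. c k = 0)"
proof (induction d)
  case (Suc d)
  then obtain \<theta> :: "nat \<Rightarrow> real"
    where \<theta>: "\<And>c::nat \<Rightarrow> int. (\<Sum>k<d. of_int (c k) * \<theta> k) = 0 \<Longrightarrow> \<forall>k<d. c k = 0" by blast
  \<comment> \<open>Every value that an integral relation could force on the next number.
    Coefficients are coded as integer lists, of which there are countably many.\<close>
  define S where "S = range (\<lambda>(xs::int list, m::int). - (\<Sum>k<d. of_int (xs ! k) * \<theta> k) / of_int m)"
  have "countable S" by (simp add: S_def)
  then have "S \<noteq> UNIV" using uncountable_UNIV_real by metis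
  then obtain x where x: "x \<notin> S" by blast
  show ?case
  proof (rule exI[of _ "\<theta>(d := x)"], intro allI impI)
    fix c :: "nat \<Rightarrow> int" and k
    assume sum: "(\<Sum>k<Suc d. of_int (c k) * (\<theta>(d := x)) k) = 0" and k: "k < Suc d"
    then have eq: "(\<Sum>k<d. of_int (c k) * \<theta> k) + of_int (c d) * x = 0" by simp
    have cd: "c d = 0"
    proof (rule ccontr)
      assume "c d \<noteq> 0"
      then have "x = - (\<Sum>k<d. of_int (map c [0..<d] ! k) * \<theta> k) / of_int (c d)"
        using eq by (simp add: field_simps)
      then have "x \<in> S" unfolding S_def by (intro image_eqI[of _ _ "(map c [0..<d], c d)"]) auto
      then show False using x by simp
    qed
    then show "c k = 0" using \<theta>[of c] eq k by (cases "k = d") auto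
  qed
qed simp

definition weight :: "nat \<Rightarrow> (nat \<Rightarrow> real) \<Rightarrow> int vec \<Rightarrow> real" where
  "weight d \<theta> m = (\<Sum>k<d. of_int (m $ k) * \<theta> k)"

text \<open>The points with coordinates exp(s \<theta> k), for complex s, form a one-parameter
  subgroup of the torus, on which the character of \<open>m\<close> is governed by the single number
  \<open>weight d \<theta> m\<close>.\<close>

lemma character_exp:
  "character d m (vec d (\<lambda>k. exp (s * of_real (\<theta> k)))) = exp (s * of_real (weight d \<theta> m))"
proof -
  have "character d m (vec d (\<lambda>k. exp (s * of_real (\<theta> k)))) =
      (\<Prod>k<d. exp (of_int (m $ k) * (s * of_real (\<theta> k))))"
    unfolding character_def by (intro prod.cong) (auto simp: exp_power_int)
  also have "\<dots> = exp (s * of_real (weight d \<theta> m))"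
    by (simp add: weight_def sum_distrib_left mult_ac flip: exp_sum)
  finally show ?thesis .
qed

lemma inj_on_weight:
  assumes "\<And>c::nat \<Rightarrow> int. (\<Sum>k<d. of_int (c k) * \<theta> k) = 0 \<Longrightarrow> \<forall>k<d. c k = 0"
    and "distinct ms" "set ms \<subseteq> carrier_vec d"
  shows "inj_on (\<lambda>i. weight d \<theta> (ms ! i)) {..<length ms}"
proof (rule inj_onI)
  fix i j assume ij: "i \<in> {..<length ms}" "j \<in> {..<length ms}"
    "weight d \<theta> (ms ! i) = weight d \<theta> (ms ! j)"
  then have "(\<Sum>k<d. of_int (ms ! i $ k - ms ! j $ k) * \<theta> k) = 0"
    by (simp add: weight_def left_diff_distrib sum_subtractf)
  then have "\<forall>k<d. ms ! i $ k - ms ! j $ k = 0" by (rule assms(1))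
  moreover have "ms ! i \<in> carrier_vec d" "ms ! j \<in> carrier_vec d" using ij assms(3) by auto
  ultimately have "ms ! i = ms ! j" by (intro eq_vecI) auto
  then show "i = j" using assms(2) ij by (simp add: nth_eq_iff_index_eq)
qed

lemma toric_cone_supp:
  assumes "length ms \<le> N + 1"
  shows "cone_closure N (torus_orbit d ms) \<subseteq> supp_on {..<length ms}"
proof
  fix x assume x: "x \<in> cone_closure N (torus_orbit d ms)"
  have "x i = 0" if i: "i \<ge> length ms" for i
  proof (cases "i \<le> N")
    case True
    have "\<forall>y\<in>torus_orbit d ms. y i = 0" using i by (auto simp: torus_orbit_def)
    then show ?thesis using x hpoly_coord[OF True] unfolding cone_closure_def by blast
  next
    case False
    then show ?thesis using x by (auto simp: cone_closure_def cone_points_def supp_on_def)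
  qed
  then show "x \<in> supp_on {..<length ms}" by (simp add: supp_on_def)
qed

lemma ones_mem_toric_cone:
  assumes "ms \<noteq> []" "length ms \<le> N + 1"
  shows "ones (length ms) \<in> cone_closure N (torus_orbit d ms)"
proof -
  have "vec d (\<lambda>_. 1) \<in> torus d" by (simp add: torus_def)
  moreover have "character d m (vec d (\<lambda>_. 1)) = 1" for m by (simp add: character_def)
  ultimately have "ones (length ms) \<in> torus_orbit d ms"
    by (auto simp: torus_orbit_def ones_def fun_eq_iff intro!: image_eqI[of _ _ "vec d (\<lambda>_. 1)"])
  then show ?thesis using torus_orbit_subset[OF assms] by (auto simp: cone_closure_def)
qed

text \<open>Translating \<open>t\<close> by the one-parameter subgroup multiplies each coordinate of
  an orbit point by the exponential of its weight. This invertible diagonal map preserves the orbit,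
  hence also the closure.\<close>

lemma torus_acts_on_cone:
  assumes "length ms \<le> N + 1" "v \<in> cone_closure N (torus_orbit d ms)"
  shows "(\<lambda>i. exp (s * of_real (weight d \<theta> (ms ! i))) * v i) \<in> cone_closure N (torus_orbit d ms)"
proof -
  \<comment> \<open>Beyond the end of the list \<open>ms ! i\<close> is unspecified, but the
    exponential is still non-zero and orbit points vanish there, so the diagonal matrix stays
    invertible and preserves the orbit.\<close>
  define e where "e s i = exp (s * of_real (weight d \<theta> (ms ! i)))" for s :: complex and i
  have app: "app (N + 1) (diagm (N + 1) (e s)) v = (\<lambda>i. e s i * v i)" if "v \<in> supp_on {..<N + 1}" for s v
    using that by (auto simp: app_diagm supp_on_def)
  have inv: "mm (N + 1) (diagm (N + 1) (e (- s))) (diagm (N + 1) (e s)) = idm (N + 1)"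
    by (auto simp: mm_diagm_left idm_def fun_eq_iff) (auto simp: diagm_def e_def simp flip: exp_add)
  have "app (N + 1) (diagm (N + 1) (e s)) y \<in> torus_orbit d ms" if "y \<in> torus_orbit d ms" for y
  proof -
    obtain t where t: "t \<in> torus d" "y = (\<lambda>i. if i < length ms then character d (ms ! i) t else 0)"
      using \<open>y \<in> torus_orbit d ms\<close> by (auto simp: torus_orbit_def)
    define t' where "t' = vec d (\<lambda>k. exp (s * of_real (\<theta> k)) * t $ k)"
    have "t' \<in> torus d" using t(1) by (auto simp: t'_def torus_def)
    moreover have "character d m t' = exp (s * of_real (weight d \<theta> m)) * character d m t" for m
      unfolding character_exp[symmetric]
      by (simp add: t'_def character_def power_int_mult_distrib flip: prod.distrib)
    ultimately have "(\<lambda>i. e s i * y i) \<in> torus_orbit d ms"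
      unfolding torus_orbit_def by (intro image_eqI[of _ _ t']) (auto simp: e_def t(2))
    moreover have "y \<in> supp_on {..<N + 1}" using t(2) assms(1) by (auto simp: supp_on_def)
    ultimately show ?thesis by (simp only: app)
  qed
  note closed = cone_closure_app[OF diagm_supp inv this assms(2)]
  have "v \<in> supp_on {..<N + 1}" using assms(2) cone_closure_supp by blast
  from closed show ?thesis unfolding app[OF \<open>v \<in> supp_on {..<N + 1}\<close>] unfolding e_def .
qed

text \<open>On the orbit a monomial is again a character, with exponent the corresponding
  combination of the \<open>ms ! i\<close>, and \<open>rel\<close> makes the two exponents equal. As
  \<open>c\<close> sums to 0 the binomial is homogeneous, so the equation passes to the
  closure.\<close>

lemma binomial_on_toric_cone:
  fixes c :: "nat \<Rightarrow> int"
  assumes n: "length ms \<le> N + 1" and c: "(\<Sum>i<length ms. c i) = 0"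
    and rel: "\<And>k. k < d \<Longrightarrow> (\<Sum>i<length ms. c i * ms ! i $ k) = 0"
    and v: "v \<in> cone_closure N (torus_orbit d ms)"
  shows "(\<Prod>i<length ms. v i ^ nat (c i)) = (\<Prod>i<length ms. v i ^ nat (- c i))"
proof -
  let ?n = "length ms"
  have split: "int (nat a) - int (nat (- a)) = a" for a :: int by simp
  have "(\<Sum>i<?n. int (nat (c i))) - (\<Sum>i<?n. int (nat (- c i))) = (\<Sum>i<?n. c i)"
    unfolding sum_subtractf[symmetric] split ..
  then have "int (\<Sum>i<?n. nat (c i)) = int (\<Sum>i<?n. nat (- c i))" using c by simp
  then have deg: "(\<Sum>i<?n. nat (c i)) = (\<Sum>i<?n. nat (- c i))" by (simp only: of_nat_eq_iff)
  have "{..<?n} \<subseteq> {..N}" using n by auto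
  from hpoly_monom[OF this, of "\<lambda>i. nat (c i)"] hpoly_monom[OF this, of "\<lambda>i. nat (- c i)"]
  have g: "hpoly N (\<Sum>i<?n. nat (c i))
      (\<lambda>x. (\<Prod>i<?n. x i ^ nat (c i)) + (-1) * (\<Prod>i<?n. x i ^ nat (- c i)))"
    unfolding deg by (intro hpoly.add hpoly_cmult)
  have "(\<Prod>i<?n. y i ^ nat (c i)) + (-1) * (\<Prod>i<?n. y i ^ nat (- c i)) = 0" if y: "y \<in> torus_orbit d ms" for y
  proof -
    obtain t where t: "t \<in> torus d" "y = (\<lambda>i. if i < ?n then character d (ms ! i) t else 0)"
      using y by (auto simp: torus_orbit_def)
    have *: "(\<Prod>i<?n. y i ^ b i) = (\<Prod>k<d. t $ k powi (\<Sum>i<?n. int (b i) * ms ! i $ k))" for b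
    proof -
      have "(\<Prod>i<?n. y i ^ b i) = (\<Prod>i<?n. \<Prod>k<d. t $ k powi (int (b i) * ms ! i $ k))"
        by (simp add: t(2) character_def prod_power_distrib power_int_mult mult.commute[of "int _"])
      also have "\<dots> = (\<Prod>k<d. \<Prod>i<?n. t $ k powi (int (b i) * ms ! i $ k))" by (rule prod.swap)
      also have "\<dots> = (\<Prod>k<d. t $ k powi (\<Sum>i<?n. int (b i) * ms ! i $ k))"
      proof (rule prod.cong[OF refl])
        fix k assume "k \<in> {..<d}"
        then have "t $ k \<noteq> 0" using t(1) by (simp add: torus_def)
        then have "(\<Prod>i\<in>A. t $ k powi f i) = t $ k powi (\<Sum>i\<in>A. f i)" for A :: "nat set" and f
          by (induction A rule: infinite_finite_induct) (auto simp: power_int_add)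
        then show "(\<Prod>i<?n. t $ k powi (int (b i) * ms ! i $ k)) =
            t $ k powi (\<Sum>i<?n. int (b i) * ms ! i $ k)" .
      qed
      finally show ?thesis .
    qed
    have "(\<Sum>i<?n. int (nat (c i)) * ms ! i $ k) = (\<Sum>i<?n. int (nat (- c i)) * ms ! i $ k)" if "k < d" for k
    proof -
      have "(\<Sum>i<?n. int (nat (c i)) * ms ! i $ k) - (\<Sum>i<?n. int (nat (- c i)) * ms ! i $ k) =
          (\<Sum>i<?n. c i * ms ! i $ k)"
        unfolding sum_subtractf[symmetric] left_diff_distrib[symmetric] split ..
      then show ?thesis using rel[OF that] by simp
    qed
    then show ?thesis unfolding * by simp
  qed
  then have "(\<Prod>i<?n. v i ^ nat (c i)) + (-1) * (\<Prod>i<?n. v i ^ nat (- c i)) = 0"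
    using v g unfolding cone_closure_def by blast
  then show ?thesis by simp
qed

text \<open>The coordinate vectors lie in the span of the orbit of the point with all coordinates 1,
  because the characters are pairwise distinct.\<close>

lemma unitv_mem_span_cone:
  fixes \<nu> :: "nat \<Rightarrow> real"
  assumes X: "ones n \<in> X" "\<And>v s. v \<in> X \<Longrightarrow> (\<lambda>i. exp (s * of_real (\<nu> i)) * v i) \<in> X"
    and \<nu>: "inj_on \<nu> {..<n}" and U: "fs.subspace U" "X \<subseteq> U" and j: "j < n"
  shows "unitv j \<in> U"
proof -
  \<comment> \<open>\<open>U\<close> itself need not be stable under the diagonal operator;
    \<open>U2\<close> collects the vectors all of whose images under its powers lie in
    \<open>U\<close>. It contains \<open>ones n\<close> because \<open>X\<close> is stable.\<close>
  define U2 where "U2 = {v \<in> supp_on {..<n}. \<forall>s::nat. (\<lambda>i. exp (of_nat s * of_real (\<nu> i)) * v i) \<in> U}"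
  have sub: "fs.subspace U2"
    unfolding subspace_iff
  proof (intro conjI ballI allI)
    show "(\<lambda>_. 0) \<in> U2" using subspace_zero[OF U(1)] by (simp add: U2_def supp_on_def)
    fix f c assume f: "f \<in> U2"
    show "(\<lambda>x. c * f x) \<in> U2"
      using f subspace_cmult[OF U(1), of _ c] by (simp add: U2_def supp_on_def mult.left_commute)
    fix g assume g: "g \<in> U2"
    show "(\<lambda>x. f x + g x) \<in> U2"
      using f g subspace_add[OF U(1)] by (simp add: U2_def supp_on_def distrib_left)
  qed
  have stable: "(\<lambda>x. of_real (exp (\<nu> x)) * f x) \<in> U2" if "f \<in> U2" for f
  proof -
    have "(\<lambda>i. exp (of_nat s * of_real (\<nu> i)) * (of_real (exp (\<nu> i)) * f i)) =
        (\<lambda>i. exp (of_nat (Suc s) * of_real (\<nu> i)) * f i)" for s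
      by (simp add: exp_of_real[symmetric] algebra_simps exp_add)
    then show ?thesis using that unfolding U2_def by (auto simp: supp_on_def simp del: of_nat_Suc)
  qed
  have "ones n \<in> U2" using X U(2) by (auto simp: U2_def supp_on_def ones_def)
  then have "(\<lambda>x. if \<nu> x = \<nu> j then ones n x else 0) \<in> U2"
    by (intro weight_component_mem[where K = "{..<n}", OF _ sub _ stable]) (auto simp: U2_def)
  also have "(\<lambda>x. if \<nu> x = \<nu> j then ones n x else 0) = unitv j"
    using \<nu> j by (auto simp: unitv_def ones_def fun_eq_iff dest: inj_onD)
  finally have "unitv j \<in> U2" .
  then have "(\<lambda>i. exp (of_nat 0 * of_real (\<nu> i)) * unitv j i) \<in> U" unfolding U2_def by blast
  then show ?thesis by simp
qed

lemma toric_equivalence_relations: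
  assumes ms: "ms \<noteq> []" "length ms \<le> N + 1" "distinct ms" "set ms \<subseteq> carrier_vec d"
    and ms': "ms' \<noteq> []" "length ms' \<le> N + 1" "distinct ms'" "set ms' \<subseteq> carrier_vec d"
    and equiv: "projectively_equivalent N (toric_variety d N ms) (toric_variety d N ms')"
  obtains \<sigma> where "length ms = length ms'" "bij_betw \<sigma> {..<length ms} {..<length ms}"
    "\<And>(c::nat \<Rightarrow> int) k. (\<Sum>i<length ms. c i) = 0 \<Longrightarrow>
      (\<And>k. k < d \<Longrightarrow> (\<Sum>i<length ms. c i * ms ! i $ k) = 0) \<Longrightarrow> k < d \<Longrightarrow>
      (\<Sum>i<length ms. c i * ms' ! (\<sigma> i) $ k) = 0"
proof -
  define M where "M = N + 1"
  define X where "X = cone_closure N (torus_orbit d ms)"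
  define X' where "X' = cone_closure N (torus_orbit d ms')"
  obtain a b where ab: "a \<in> supp_on (sq M)" "b \<in> supp_on (sq M)"
    "mm M a b = idm M" "mm M b a = idm M" "app M a ` X = X'"
    using equiv unfolding projectively_equivalent_toric[OF ms(1,2) ms'(1,2)] M_def X_def X'_def by blast
  obtain \<theta> :: "nat \<Rightarrow> real" where \<theta>: "\<And>c::nat \<Rightarrow> int. (\<Sum>k<d. of_int (c k) * \<theta> k) = 0 \<Longrightarrow> \<forall>k<d. c k = 0"
    using ex_rationally_independent[of d] by blast
  define \<nu> where "\<nu> i = weight d \<theta> (ms ! i)" for i
  define \<mu> where "\<mu> i = weight d \<theta> (ms' ! i)" for i
  define n where "n = length ms"
  define n' where "n' = length ms'"
  have nM: "n \<le> M" "n' \<le> M" using ms(2) ms'(2) by (simp_all add: n_def n'_def M_def)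
  have \<nu>: "inj_on \<nu> {..<n}" unfolding n_def \<nu>_def by (rule inj_on_weight[OF _ ms(3,4)]) (use \<theta> in blast)
  have \<mu>: "inj_on \<mu> {..<n'}" unfolding n'_def \<mu>_def by (rule inj_on_weight[OF _ ms'(3,4)]) (use \<theta> in blast)
  have X: "X \<subseteq> supp_on {..<n}" "ones n \<in> X" "\<And>v s. v \<in> X \<Longrightarrow> (\<lambda>i. exp (s * of_real (\<nu> i)) * v i) \<in> X"
    using toric_cone_supp[OF ms(2)] ones_mem_toric_cone[OF ms(1,2)] torus_acts_on_cone[OF ms(2)]
    by (simp_all add: X_def n_def \<nu>_def)
  have X': "X' \<subseteq> supp_on {..<n'}" "ones n' \<in> X'" "\<And>v s. v \<in> X' \<Longrightarrow> (\<lambda>i. exp (s * of_real (\<mu> i)) * v i) \<in> X'"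
    using toric_cone_supp[OF ms'(2)] ones_mem_toric_cone[OF ms'(1,2)] torus_acts_on_cone[OF ms'(2)]
    by (simp_all add: X'_def n'_def \<mu>_def)
  have aX: "app M a v \<in> X'" if "v \<in> X" for v using that ab(5) by blast
  have Xsupp: "X \<subseteq> supp_on {..<M}" using X(1) nM supp_on_mono[of "{..<n}" "{..<M}"] by auto
  have bX: "app M b v \<in> X" if v: "v \<in> X'" for v
  proof -
    obtain u where u: "u \<in> X" "v = app M a u" using v ab(5) by blast
    then have "app M b v = u" using Xsupp ab(4) by (auto simp: app_idm simp flip: app_mm)
    then show ?thesis using u by simp
  qed
  have pre: "fs.subspace {v. app M A v \<in> supp_on J}" for A J
    using subspace_supp_on[of J] by (auto simp: subspace_iff app_add app_cmult) (simp add: app_def)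
  have app_unitv: "app M A (unitv j) i = A (i, j)" if "j < M" for A i j
    using that by (simp add: app_def unitv_def if_distrib cong: if_cong)
  \<comment> \<open>The coordinate vectors of the first cone lie in every subspace containing
    \<open>X\<close>, in particular in the preimage under \<open>a\<close> of the coordinate space
    of \<open>X'\<close>.\<close>
  have a0: "a (i, j) = 0" if "j < n" "i \<ge> n'" for i j
  proof -
    have "unitv j \<in> {v. app M a v \<in> supp_on {..<n'}}"
      by (rule unitv_mem_span_cone[OF X(2,3) \<nu> pre]) (use that aX X'(1) in auto)
    then show ?thesis using app_unitv[of j a i] that nM by (simp add: supp_on_def)
  qed
  have b0: "b (i, j) = 0" if "j < n'" "i \<ge> n" for i j
  proof -
    have "unitv j \<in> {v. app M b v \<in> supp_on {..<n}}"
      by (rule unitv_mem_span_cone[OF X'(2,3) \<mu> pre]) (use that bX X(1) in auto)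
    then show ?thesis using app_unitv[of j b i] that nM by (simp add: supp_on_def)
  qed
  have sum_ab: "(\<Sum>j<n. a (i, j) * b (j, k)) = idm M (i, k)" if "k < n'" for i k
  proof -
    have "(\<Sum>j<n. a (i, j) * b (j, k)) = (\<Sum>j<M. a (i, j) * b (j, k))"
      by (rule sum.mono_neutral_left) (use nM b0 that in auto)
    also have "\<dots> = mm M a b (i, k)" by (simp add: mm_def)
    finally show ?thesis using ab(3) by simp
  qed
  have sum_ba: "(\<Sum>j<n'. b (i, j) * a (j, k)) = idm M (i, k)" if "k < n" for i k
  proof -
    have "(\<Sum>j<n'. b (i, j) * a (j, k)) = (\<Sum>j<M. b (i, j) * a (j, k))"
      by (rule sum.mono_neutral_left) (use nM a0 that in auto)
    also have "\<dots> = mm M b a (i, k)" by (simp add: mm_def)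
    finally show ?thesis using ab(4) by simp
  qed
  \<comment> \<open>The trace of the product of the two blocks, computed in both orders, shows that
    the blocks are square.\<close>
  have "of_nat n' = (\<Sum>i<n'. idm M (i, i))" using nM by (simp add: idm_def)
  also have "\<dots> = (\<Sum>i<n'. \<Sum>j<n. a (i, j) * b (j, i))" by (simp add: sum_ab)
  also have "\<dots> = (\<Sum>j<n. \<Sum>i<n'. b (j, i) * a (i, j))" by (subst sum.swap) (simp add: mult.commute)
  also have "\<dots> = (\<Sum>j<n. idm M (j, j))" by (simp add: sum_ba)
  also have "\<dots> = of_nat n" using nM by (simp add: idm_def)
  finally have nn': "n' = n" by (simp only: of_nat_eq_iff)
  \<comment> \<open>The blocks of \<open>a\<close> and \<open>b\<close> on the span of the cones;
    there they act as \<open>a\<close> and \<open>b\<close> do.\<close>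
  define Q where "Q = (\<lambda>(i, j). if i < n \<and> j < n then a (i, j) else 0)"
  define R where "R = (\<lambda>(i, j). if i < n \<and> j < n then b (i, j) else 0)"
  have supp: "Q \<in> supp_on (sq n)" "R \<in> supp_on (sq n)" by (auto simp: Q_def R_def supp_on_def)
  have idM: "idm M (i, k) = idm n (i, k)" if "i < n" for i k
    using nM that by (simp add: idm_def)
  have QR: "mm n Q R = idm n"
  proof
    fix x :: "nat \<times> nat"
    obtain i k where x: "x = (i, k)" by force
    show "mm n Q R x = idm n x"
    proof (cases "i < n \<and> k < n")
      case True
      then have "mm n Q R x = (\<Sum>j<n. a (i, j) * b (j, k))" by (simp add: mm_def Q_def R_def x)
      then show ?thesis using sum_ab[of k i] True nn' idM x by simp
    qed (auto simp: mm_def Q_def R_def idm_def x)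
  qed
  have RQ: "mm n R Q = idm n"
  proof
    fix x :: "nat \<times> nat"
    obtain i k where x: "x = (i, k)" by force
    show "mm n R Q x = idm n x"
    proof (cases "i < n \<and> k < n")
      case True
      then have "mm n R Q x = (\<Sum>j<n. b (i, j) * a (j, k))" by (simp add: mm_def Q_def R_def x)
      then show ?thesis using sum_ba[of k i] True nn' idM x by simp
    qed (auto simp: mm_def Q_def R_def idm_def x)
  qed
  have restrict: "app n (\<lambda>(i, j). if i < n \<and> j < n then A (i, j) else 0) v = app M A v"
    if v: "v \<in> supp_on {..<n}" and A: "\<And>i j. j < n \<Longrightarrow> i \<ge> n \<Longrightarrow> A (i, j) = 0" for A v
  proof
    fix i
    have "app n (\<lambda>(i, j). if i < n \<and> j < n then A (i, j) else 0) v i = (\<Sum>j<n. A (i, j) * v j)"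
      unfolding app_def by (intro sum.cong) (use A in auto)
    also have "\<dots> = app M A v i"
      unfolding app_def by (rule sum.mono_neutral_left) (use nM v in \<open>auto simp: supp_on_def\<close>)
    finally show "app n (\<lambda>(i, j). if i < n \<and> j < n then A (i, j) else 0) v i = app M A v i" .
  qed
  have QX: "app n Q v \<in> X'" if "v \<in> X" for v
    using restrict[of v a] a0 nn' X(1) that aX unfolding Q_def by auto
  have RX: "app n R v \<in> X" if "v \<in> X'" for v
    using restrict[of v b] b0 nn' X'(1) that bX unfolding R_def by auto
  have nN: "n \<le> Suc N" using nM by (simp add: M_def)
  note X'n = X'(1)[unfolded nn']
  obtain \<sigma> where \<sigma>: "bij_betw \<sigma> {..<n} {..<n}"
    "(\<lambda>(i, j). if i = j \<and> i < n then of_real (\<mu> (\<sigma> i)) else 0) \<in> lie N n X"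
  proof (rule conjugate_tori_spectrum[OF subspace_lie lie_supp subspace_lie lie_supp \<nu> \<mu>[unfolded nn']])
    show "\<And>D. D \<in> lie N n X \<Longrightarrow> (\<lambda>x. of_real (exp ((\<lambda>(i, j). \<nu> i - \<nu> j) x)) * D x) \<in> lie N n X"
      by (rule lie_stable[OF nN X(1,3)])
    show "\<And>D. D \<in> lie N n X' \<Longrightarrow> (\<lambda>x. of_real (exp ((\<lambda>(i, j). \<mu> i - \<mu> j) x)) * D x) \<in> lie N n X'"
      by (rule lie_stable[OF nN X'n X'(3)])
    show "\<And>D. D \<in> lie N n X \<Longrightarrow> conj_by n Q R D \<in> lie N n X'"
      by (rule lie_transport[OF nN X(1) X'n supp QR QX RX])
    show "\<And>D. D \<in> lie N n X' \<Longrightarrow> conj_by n R Q D \<in> lie N n X"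
      by (rule lie_transport[OF nN X'n X(1) supp(2,1) RQ RX QX])
    show "(\<lambda>(i, j). if i = j \<and> i < n then of_real (\<mu> i) else 0) \<in> lie N n X'"
      using diag_mem_lie[OF nN X'n X'(3)] unfolding diagm_def .
  qed (use supp QR RQ in auto)
  show ?thesis
  proof (rule that[of \<sigma>])
    show "length ms = length ms'" using nn' by (simp add: n_def n'_def)
    show "bij_betw \<sigma> {..<length ms} {..<length ms}" using \<sigma>(1) by (simp add: n_def)
    fix c :: "nat \<Rightarrow> int" and k
    assume c: "(\<Sum>i<length ms. c i) = 0" "\<And>k. k < d \<Longrightarrow> (\<Sum>i<length ms. c i * ms ! i $ k) = 0" and k: "k < d"
    have "(\<Sum>i<n. of_int (c i) * complex_of_real (\<mu> (\<sigma> i))) = 0"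
    proof (rule lie_diag_relation[OF nN X(2)])
      show "(\<Sum>i<n. c i) = 0" using c by (simp add: n_def)
      show "\<And>v. v \<in> X \<Longrightarrow> (\<Prod>i<n. v i ^ nat (c i)) = (\<Prod>i<n. v i ^ nat (- c i))"
        unfolding n_def X_def by (rule binomial_on_toric_cone[OF ms(2) c])
      show "diagm n (\<lambda>i. of_real (\<mu> (\<sigma> i))) \<in> lie N n X" using \<sigma>(2) unfolding diagm_def .
    qed
    then have "complex_of_real (\<Sum>i<n. of_int (c i) * \<mu> (\<sigma> i)) = 0" by simp
    then have "(\<Sum>i<n. of_int (c i) * \<mu> (\<sigma> i)) = 0" by (simp only: of_real_eq_0_iff)
    \<comment> \<open>Exchanging the sums leaves an integral combination of the numbers
      \<open>\<theta> k\<close>, so each of its \<open>d\<close> coefficients vanishes.\<close>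
    also have "(\<Sum>i<n. of_int (c i) * \<mu> (\<sigma> i)) =
        (\<Sum>i<n. \<Sum>k<d. of_int (c i) * (of_int (ms' ! \<sigma> i $ k) * \<theta> k))"
      by (simp add: \<mu>_def weight_def sum_distrib_left)
    also have "\<dots> = (\<Sum>k<d. of_int (\<Sum>i<n. c i * ms' ! \<sigma> i $ k) * \<theta> k)"
      by (subst sum.swap) (simp add: sum_distrib_right mult.assoc)
    finally show "(\<Sum>i<length ms. c i * ms' ! (\<sigma> i) $ k) = 0"
      using \<theta>[of "\<lambda>k. \<Sum>i<n. c i * ms' ! \<sigma> i $ k"] k by (simp add: n_def)
  qed
qed

subsection \<open>From affine to projective equivalence\<close>

text \<open>t^(Am+b) = t^b (t')^m for a torus point t' that does not depend on m. So each point of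
  the new orbit is a scalar multiple of a point of the old one, and homogeneous equations ignore the
  scalar.\<close>

lemma cone_closure_affine_image_subset:
  assumes A: "A \<in> carrier_mat d d" and b: "b \<in> carrier_vec d" and ms: "set ms \<subseteq> carrier_vec d"
  shows "cone_closure N (torus_orbit d (map (\<lambda>m. A *\<^sub>v m + b) ms)) \<subseteq> cone_closure N (torus_orbit d ms)"
proof
  fix x assume x: "x \<in> cone_closure N (torus_orbit d (map (\<lambda>m. A *\<^sub>v m + b) ms))"
  have "g x = 0" if g: "hpoly N k g" "\<forall>y\<in>torus_orbit d ms. g y = 0" for k g
  proof -
    have "g y = 0" if y: "y \<in> torus_orbit d (map (\<lambda>m. A *\<^sub>v m + b) ms)" for y
    proof -
      obtain t where t: "t \<in> torus d"
        "y = (\<lambda>i. if i < length ms then character d (map (\<lambda>m. A *\<^sub>v m + b) ms ! i) t else 0)"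
        using y by (auto simp: torus_orbit_def)
      \<comment> \<open>The image of \<open>t\<close> under the homomorphism of tori dual to
        \<open>A\<close>: coordinate \<open>j\<close> is the character given by column
        \<open>j\<close> of \<open>A\<close>.\<close>
      define t' where "t' = vec d (\<lambda>j. \<Prod>k<d. t $ k powi A $$ (k, j))"
      have tk: "t $ k \<noteq> 0" if "k < d" for k using t(1) that by (simp add: torus_def)
      have t': "t' \<in> torus d" using tk by (auto simp: torus_def t'_def)
      have "character d (A *\<^sub>v m + b) t = character d b t * character d m t'" if m: "m \<in> carrier_vec d" for m
      proof -
        have powi_sum: "z powi (\<Sum>j<d. f j) = (\<Prod>j<d. z powi f j)" if "z \<noteq> 0" for z :: complex and f
          using that by (induction d) (auto simp: power_int_add)
        have "character d (A *\<^sub>v m + b) t = (\<Prod>k<d. t $ k powi ((\<Sum>j<d. A $$ (k, j) * m $ j) + b $ k))"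
          unfolding character_def using A b m
          by (intro prod.cong) (auto simp: scalar_prod_def atLeast0LessThan)
        also have "\<dots> = (\<Prod>k<d. (\<Prod>j<d. t $ k powi (A $$ (k, j) * m $ j)) * t $ k powi b $ k)"
          by (intro prod.cong) (auto simp: power_int_add tk powi_sum)
        also have "\<dots> = (\<Prod>j<d. \<Prod>k<d. t $ k powi (A $$ (k, j) * m $ j)) * character d b t"
          unfolding prod.distrib character_def by (subst prod.swap) simp
        also have "(\<Prod>j<d. \<Prod>k<d. t $ k powi (A $$ (k, j) * m $ j)) = character d m t'"
        proof -
          have "(\<Prod>k\<in>K. f k) powi a = (\<Prod>k\<in>K. f k powi a)" for f :: "nat \<Rightarrow> complex" and K a
            by (induction K rule: infinite_finite_induct) (auto simp: power_int_mult_distrib)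
          then show ?thesis by (simp add: character_def t'_def power_int_mult)
        qed
        finally show ?thesis by (simp add: mult.commute)
      qed
      then have "y = (\<lambda>i. character d b t * (if i < length ms then character d (ms ! i) t' else 0))"
        using ms by (auto simp: t(2) fun_eq_iff subset_iff)
      moreover have "g (\<lambda>i. if i < length ms then character d (ms ! i) t' else 0) = 0"
        using g(2) t' by (auto simp: torus_orbit_def)
      ultimately show ?thesis using hpoly_scale[OF g(1)] by simp
    qed
    then show ?thesis using x g(1) unfolding cone_closure_def by blast
  qed
  then show "x \<in> cone_closure N (torus_orbit d ms)" using x unfolding cone_closure_def by blast
qed

text \<open>The inclusion of cones is applied to the affine map and to its inverse. Corresponding
  enumerations therefore give the same variety, not merely an equivalent one.\<close>

lemma toric_variety_affine_image:
  assumes A: "A \<in> carrier (GL TYPE(int) d)" and b: "b \<in> carrier_vec d"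
    and ms: "set ms \<subseteq> carrier_vec d" "ms \<noteq> []" "length ms \<le> N + 1"
  shows "toric_variety d N (map (\<lambda>m. A *\<^sub>v m + b) ms) = toric_variety d N ms"
proof -
  obtain B where AB: "A \<in> carrier_mat d d" "B \<in> carrier_mat d d" "A * B = 1\<^sub>m d" "B * A = 1\<^sub>m d"
    using A unfolding carrier_GL by blast
  let ?ms' = "map (\<lambda>m. A *\<^sub>v m + b) ms"
  define b' where "b' = - (B *\<^sub>v b)"
  have Bb: "B *\<^sub>v b \<in> carrier_vec d" using AB(2) b by (rule mult_mat_vec_carrier)
  have b': "b' \<in> carrier_vec d" using Bb by (simp add: b'_def)
  have "B *\<^sub>v (A *\<^sub>v m + b) + b' = m" if "m \<in> set ms" for m
  proof -
    have m: "m \<in> carrier_vec d" using that ms by blast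
    have Am: "A *\<^sub>v m \<in> carrier_vec d" using AB(1) m by (rule mult_mat_vec_carrier)
    have "B *\<^sub>v (A *\<^sub>v m + b) = B *\<^sub>v (A *\<^sub>v m) + B *\<^sub>v b"
      by (rule mult_add_distrib_mat_vec[OF AB(2) Am b])
    also have "B *\<^sub>v (A *\<^sub>v m) = m"
      using assoc_mult_mat_vec[OF AB(2,1) m] AB(4) m by simp
    finally show ?thesis using m Bb by (auto simp: b'_def)
  qed
  then have inverse: "map (\<lambda>m. B *\<^sub>v m + b') ?ms' = ms" by (simp add: map_idI)
  have car: "set ?ms' \<subseteq> carrier_vec d"
  proof
    fix m' assume "m' \<in> set ?ms'"
    then obtain m where "m \<in> set ms" "m' = A *\<^sub>v m + b" by auto
    then show "m' \<in> carrier_vec d" using AB(1) b ms(1) by auto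
  qed
  have "cone_closure N (torus_orbit d ?ms') = cone_closure N (torus_orbit d ms)"
    using cone_closure_affine_image_subset[OF AB(1) b ms(1), of N]
      cone_closure_affine_image_subset[OF AB(2) b' car, of N] unfolding inverse by blast
  then show ?thesis using toric_variety_eq[of ms N d] toric_variety_eq[of ?ms' N d] ms by simp
qed

text \<open>A permutation matrix carries one orbit onto the other; the permutation fixes all indices
  beyond the list and so acts on all N + 1 coordinates.\<close>

lemma toric_variety_permute:
  assumes ms: "distinct ms" "distinct ms'" "set ms = set ms'" "ms \<noteq> []" "length ms \<le> N + 1"
  shows "projectively_equivalent N (toric_variety d N ms) (toric_variety d N ms')"
proof -
  have "mset ms' = mset ms" using ms by (simp add: set_eq_iff_mset_eq_distinct)
  then obtain p where p: "p permutes {..<length ms}" "permute_list p ms = ms'"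
    using mset_eq_permutation by blast
  have len: "length ms' = length ms" using p(2) by auto
  have nth: "ms' ! i = ms ! p i" if "i < length ms" for i
    using p that by (auto simp: permute_list_nth)
  let ?M = "N + 1"
  have pM: "p permutes {..<?M}" using permutes_subset[OF p(1)] ms(5) by auto
  define q where "q = inv_into UNIV p"
  have q: "q permutes {..<length ms}" "q permutes {..<?M}"
    unfolding q_def using permutes_inv p(1) pM by auto
  have pq: "p (q i) = i" "q (p i) = i" for i
    unfolding q_def using permutes_inverses[OF p(1)] by auto
  define a where "a = (\<lambda>(i, j). if i < ?M \<and> j = p i then 1 else 0 :: complex)"
  define b where "b = (\<lambda>(i, j). if i < ?M \<and> j = q i then 1 else 0 :: complex)"
  have pl: "p i < ?M \<longleftrightarrow> i < ?M" "q i < ?M \<longleftrightarrow> i < ?M" for i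
    using permutes_in_image[OF pM, of i] permutes_in_image[OF q(2), of i] by auto
  have pn: "p i < length ms \<longleftrightarrow> i < length ms" "q i < length ms \<longleftrightarrow> i < length ms" for i
    using permutes_in_image[OF p(1), of i] permutes_in_image[OF q(1), of i] by auto
  have supp: "a \<in> supp_on (sq ?M)" "b \<in> supp_on (sq ?M)"
    using pl by (auto simp: a_def b_def supp_on_def)
  have sel: "(\<Sum>j<?M. (if i < ?M \<and> j = r i then 1 else 0) * f j) = (if i < ?M then f (r i) else (0::complex))"
    if "r i < ?M \<longleftrightarrow> i < ?M" for r i f
  proof (cases "i < ?M")
    case True
    have "(\<Sum>j<?M. (if i < ?M \<and> j = r i then 1 else 0) * f j) = (\<Sum>j<?M. if j = r i then f j else 0)"
      using True by (intro sum.cong) auto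
    then show ?thesis using True that by simp
  qed auto
  have app: "app ?M a v = (\<lambda>i. if i < ?M then v (p i) else 0)"
    "app ?M b v = (\<lambda>i. if i < ?M then v (q i) else 0)" for v
    unfolding app_def a_def b_def prod.case using sel pl by auto
  have mm_app: "mm ?M f h (i, k) = app ?M f (\<lambda>j. h (j, k)) i" for f h i k
    by (simp only: mm_def app_def prod.case)
  have ab: "mm ?M a b = idm ?M" "mm ?M b a = idm ?M"
  proof (rule_tac [!] ext, rule_tac [!] prod.induct)
    fix i k
    show "mm ?M a b (i, k) = idm ?M (i, k)"
      unfolding mm_app app(1) by (auto simp: b_def idm_def pq pl[simplified])
    show "mm ?M b a (i, k) = idm ?M (i, k)"
      unfolding mm_app app(2) by (auto simp: a_def idm_def pq pl[simplified])
  qed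
  have "app ?M a y \<in> torus_orbit d ms'" if "y \<in> torus_orbit d ms" for y
  proof -
    obtain t where t: "t \<in> torus d" "y = (\<lambda>i. if i < length ms then character d (ms ! i) t else 0)"
      using \<open>y \<in> torus_orbit d ms\<close> by (auto simp: torus_orbit_def)
    have "app ?M a y = (\<lambda>i. if i < length ms' then character d (ms' ! i) t else 0)"
      unfolding app(1) using ms(5) by (auto simp: t(2) len nth pn)
    then show ?thesis using t(1) by (auto simp: torus_orbit_def)
  qed
  from cone_closure_app[OF supp(1) ab(2) this]
  have aX: "app ?M a x \<in> cone_closure N (torus_orbit d ms')" if "x \<in> cone_closure N (torus_orbit d ms)" for x
    using that by blast
  have "app ?M b y \<in> torus_orbit d ms" if "y \<in> torus_orbit d ms'" for y
  proof -
    obtain t where t: "t \<in> torus d" "y = (\<lambda>i. if i < length ms' then character d (ms' ! i) t else 0)"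
      using \<open>y \<in> torus_orbit d ms'\<close> by (auto simp: torus_orbit_def)
    have "app ?M b y = (\<lambda>i. if i < length ms then character d (ms ! i) t else 0)"
      unfolding app(2) using ms(5) by (auto simp: t(2) len nth pn pq)
    then show ?thesis using t(1) by (auto simp: torus_orbit_def)
  qed
  from cone_closure_app[OF supp(2) ab(1) this]
  have bX: "app ?M b x \<in> cone_closure N (torus_orbit d ms)" if "x \<in> cone_closure N (torus_orbit d ms')" for x
    using that by blast
  have "app ?M a ` cone_closure N (torus_orbit d ms) = cone_closure N (torus_orbit d ms')"
  proof (intro subset_antisym subsetI)
    fix x assume x: "x \<in> cone_closure N (torus_orbit d ms')"
    then have "x \<in> supp_on {..<?M}" using cone_closure_supp by blast
    then have "app ?M a (app ?M b x) = x" using ab(1) app_idm by (simp flip: app_mm)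
    then show "x \<in> app ?M a ` cone_closure N (torus_orbit d ms)" using bX[OF x] by (metis imageI)
  qed (use aX in auto)
  moreover have "ms' \<noteq> []" "length ms' \<le> N + 1" using ms(4,5) len by auto
  ultimately show ?thesis
    unfolding projectively_equivalent_toric[OF ms(4,5) \<open>ms' \<noteq> []\<close> \<open>length ms' \<le> N + 1\<close>]
    using supp ab by blast
qed

lemma affinely_equivalent_iff:
  "affinely_equivalent d P P' \<longleftrightarrow>
    (\<exists>A\<in>carrier (GL TYPE(int) d). \<exists>b\<in>carrier_vec d. P' = affine_vec A b ` P)"
  by (simp add: affinely_equivalent_def affine_vec_def)

text \<open>The enumeration is transported along the affine bijection between the lattice points.
  This serves both the backward implication and the final claim.\<close>

lemma affinely_equivalent_imp_same_toric_variety: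
  assumes P: "lattice_polytope d P" and eq: "affinely_equivalent d P P'"
    and ms: "enumerates ms (lattice_points d P)" "length ms \<le> N + 1"
  obtains ms' where "enumerates ms' (lattice_points d P')" "toric_variety d N ms' = toric_variety d N ms"
proof -
  obtain A b where A: "A \<in> carrier (GL TYPE(int) d)" and b: "b \<in> carrier_vec d" and P': "P' = affine_vec A b ` P"
    using eq unfolding affinely_equivalent_iff by blast
  obtain B where AB: "A \<in> carrier_mat d d" "B \<in> carrier_mat d d" "B * A = 1\<^sub>m d"
    using A unfolding carrier_GL by blast
  let ?f = "\<lambda>m. A *\<^sub>v m + b"
  have car: "set ms \<subseteq> carrier_vec d" using ms(1) by (auto simp: enumerates_def lattice_points_def)
  have "inj_on ?f (carrier_vec d)"
  proof (rule inj_onI)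
    fix m m' :: "int vec" assume m: "m \<in> carrier_vec d" "m' \<in> carrier_vec d" "?f m = ?f m'"
    have "A *\<^sub>v m \<in> carrier_vec d" "A *\<^sub>v m' \<in> carrier_vec d"
      using mult_mat_vec_carrier[OF AB(1)] m by blast+
    moreover have "v + b - b = v" if "v \<in> carrier_vec d" for v
      using that b by (intro eq_vecI) auto
    ultimately have "A *\<^sub>v m = A *\<^sub>v m'" using m(3) by metis
    then have "(B * A) *\<^sub>v m = (B * A) *\<^sub>v m'"
      using assoc_mult_mat_vec[OF AB(2,1)] m(1,2) by simp
    then show "m = m'" using AB(3) m by simp
  qed
  then have inj: "inj_on ?f (set ms)" using car by (rule inj_on_subset)
  have "set (map ?f ms) = lattice_points d P'"
    using lattice_points_affine_image[OF lattice_polytope_carrier[OF P] A b] ms(1) P'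
    by (simp add: enumerates_def)
  then have "enumerates (map ?f ms) (lattice_points d P')"
    using inj ms(1) by (simp add: enumerates_def distinct_map)
  moreover have "ms \<noteq> []" using lattice_points_nonempty[OF P] ms(1) by (auto simp: enumerates_def)
  ultimately show ?thesis
    using that toric_variety_affine_image[OF A b car _ ms(2)] by blast
qed

theorem corollary1p1:
  fixes d N :: nat and P P' :: "real vec set"
  assumes "lattice_polytope d P" and "lattice_polytope d P'"
    and "Z_solid d P" and "Z_solid d P'"
    and "card (lattice_points d P) \<le> N + 1" and "card (lattice_points d P') \<le> N + 1"
  shows "(\<forall>ms ms'. enumerates ms (lattice_points d P) \<and> enumerates ms' (lattice_points d P') \<longrightarrow>
            (projectively_equivalent N (toric_variety d N ms) (toric_variety d N ms') \<longleftrightarrow>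
             affinely_equivalent d P P')) \<and>
         (affinely_equivalent d P P' \<longrightarrow>
            (\<exists>ms ms'. enumerates ms (lattice_points d P) \<and> enumerates ms' (lattice_points d P') \<and>
               toric_variety d N ms = toric_variety d N ms'))"
proof (intro conjI allI impI iffI)
  have facts: "distinct ms" "set ms = lattice_points d Q" "length ms \<le> N + 1" "ms \<noteq> []"
      "set ms \<subseteq> carrier_vec d" "affinely_generating d (set ms)"
    if "enumerates ms (lattice_points d Q)" "lattice_polytope d Q" "card (lattice_points d Q) \<le> N + 1" "Z_solid d Q"
    for ms Q
    using that lattice_points_nonempty[OF that(2)] distinct_card[of ms]
    by (auto simp: enumerates_def lattice_points_def Z_solid_def)
  {
    fix ms ms'
    assume e: "enumerates ms (lattice_points d P) \<and> enumerates ms' (lattice_points d P')"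
    note ms = facts[OF conjunct1[OF e] assms(1,5,3)] and ms' = facts[OF conjunct2[OF e] assms(2,6,4)]
    show "affinely_equivalent d P P'"
      if pe: "projectively_equivalent N (toric_variety d N ms) (toric_variety d N ms')"
    proof -
      obtain \<sigma> where \<sigma>: "length ms = length ms'" "bij_betw \<sigma> {..<length ms} {..<length ms}"
        "\<And>(c::nat \<Rightarrow> int) k. (\<Sum>i<length ms. c i) = 0 \<Longrightarrow>
          (\<And>k. k < d \<Longrightarrow> (\<Sum>i<length ms. c i * ms ! i $ k) = 0) \<Longrightarrow> k < d \<Longrightarrow>
          (\<Sum>i<length ms. c i * ms' ! (\<sigma> i) $ k) = 0"
        using toric_equivalence_relations[OF ms(4,3,1,5) ms'(4,3,1,5) pe] by blast
      obtain A b where A: "A \<in> carrier (GL TYPE(int) d)" and b: "b \<in> carrier_vec d"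
        and img: "(\<lambda>m. A *\<^sub>v m + b) ` set ms = set ms'"
        by (rule affine_map_of_relations[OF ms(5,6,4) ms'(5,6) \<sigma>(1)[symmetric] \<sigma>(2,3)])
      have Am: "A \<in> carrier_mat d d" using A unfolding carrier_GL by blast
      \<comment> \<open>Affine maps commute with hulls, and both polytopes are hulls of their
        lattice points, so it is enough that the lattice points match.\<close>
      have "affine_vec A b ` real_vec ` set ms = real_vec ` (\<lambda>m. A *\<^sub>v m + b) ` set ms"
        unfolding image_image using ms(5) by (intro image_cong affine_vec_real_vec[OF Am b]) auto
      moreover have "real_vec ` set ms \<subseteq> carrier_vec d" using ms(5) by (auto simp: real_vec_def)
      ultimately have "affine_vec A b ` P = P'"
        using affine_vec_hull[OF Am b, of "real_vec ` set ms"]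
          lattice_polytope_hull[OF assms(1)] lattice_polytope_hull[OF assms(2)] ms(2) ms'(2) img by simp
      then show ?thesis unfolding affinely_equivalent_iff using A b by blast
    qed
    show "projectively_equivalent N (toric_variety d N ms) (toric_variety d N ms')"
      if ae: "affinely_equivalent d P P'"
    proof -
      \<comment> \<open>The transported enumeration may differ from \<open>ms'\<close>; what remains
        is a permutation of coordinates.\<close>
      obtain ms2 where ms2: "enumerates ms2 (lattice_points d P')" "toric_variety d N ms2 = toric_variety d N ms"
        using affinely_equivalent_imp_same_toric_variety[OF assms(1) ae conjunct1[OF e] ms(3)] by blast
      note m2 = facts[OF ms2(1) assms(2,6,4)]
      show ?thesis
        using toric_variety_permute[OF m2(1) ms'(1) _ m2(4,3), of d] m2(2) ms'(2) ms2(2) by simp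
    qed
  }
  assume ae: "affinely_equivalent d P P'"
  obtain ms where ms: "enumerates ms (lattice_points d P)"
    using finite_distinct_list[OF finite_lattice_points[OF assms(1)]] by (auto simp: enumerates_def)
  obtain ms' where "enumerates ms' (lattice_points d P')" "toric_variety d N ms' = toric_variety d N ms"
    using affinely_equivalent_imp_same_toric_variety[OF assms(1) ae ms] facts(3)[OF ms assms(1,5,3)] by blast
  then show "\<exists>ms ms'. enumerates ms (lattice_points d P) \<and> enumerates ms' (lattice_points d P') \<and>
      toric_variety d N ms = toric_variety d N ms'"
    using ms by metis
qed

end
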